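(* Let $g$ be a nondegenerate symmetric bilinear form on $\mathbb{R}^n$ with $n_-(g)=1$, $R:[0,1]\to\mathcal L(\mathbb{R}^n)$ a $C^1$ map of $g$-symmetric linear operators, $P$ a subspace of $\mathbb{R}^n$ on which $g$ is nondegenerate and $S:P\to P$ a $g$-symmetric linear map. Suppose that $V''=RV$ admits a solution $Y$ with $g(Y,Y)<0$ on $[0,1]$. Let $\mathcal K$ be the subspace of $H^1_P([0,1],\mathbb{R}^n)$ consisting of those $V$ such that $g(V',Y)-g(V,Y')$ is constant on $[0,1]$, and assume $g$ is nondegenerate on each $\mathbb J[t]$. Then $$n_-(I_1|_{\mathcal K})=n_-(g|_P)+\sum_{t\in]0,1[}\mathrm{sgn}(t)-n_-(g|_{\mathbb J[1]^\perp}).$$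
   Context: $g$-symmetric: $g(Tx,y)=g(x,Ty)$; $\perp$ denotes $g$-orthogonality. For a symmetric bilinear form $B$, $n_-(B)$ is the supremum of dimensions of subspaces on which $B$ is negative definite, $n_+(B)=n_-(-B)$, $\mathrm{sgn}(B)=n_+(B)-n_-(B)$. $\mathbb J$ is the space of solutions of $J''=R(t)J$ on $[0,1]$ with $J(0)\in P$ and $J'(0)+S[J(0)]\in P^\perp$, and $\mathbb J[t]=\{J(t):J\in\mathbb J\}$. An instant $t\in]0,1]$ is $(P,S)$-focal if $\mathbb J[t]\neq\mathbb{R}^n$, and $\mathrm{sgn}(t)=\mathrm{sgn}(g|_{\mathbb J[t]^\perp})$ (so only focal instants contribute to the sum). $H^1_P([0,1],\mathbb{R}^n)=\{V\in H^1([0,1],\mathbb{R}^n):V(0)\in P,V(1)=0\}$ and $I_1(V,W)=\int_0^1[g(V',W')+g(R(s)V,W)]ds-g(S[V(0)],W(0))$. *)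

theory Defs
  imports "HOL-Analysis.Analysis"
begin

text \<open>Negative index n_-(B|W) of a symmetric bilinear form B restricted to a subspace W:
  supremum of the dimensions of subspaces of W (spanned by finitely many vectors of W)
  on which B is negative definite.\<close>
definition neg_index :: "('v::real_vector \<Rightarrow> 'v \<Rightarrow> real) \<Rightarrow> 'v set \<Rightarrow> enat" where
  "neg_index B W = Sup {enat k | k. \<exists>V::nat \<Rightarrow> 'v. (\<forall>i<k. V i \<in> W) \<and>
     (\<forall>c::nat \<Rightarrow> real. (\<exists>i<k. c i \<noteq> 0) \<longrightarrow>
        B (\<Sum>i<k. c i *\<^sub>R V i) (\<Sum>i<k. c i *\<^sub>R V i) < 0)}"

definition neg_index_fun :: "(('r \<Rightarrow> 'v::real_vector) \<Rightarrow> ('r \<Rightarrow> 'v) \<Rightarrow> real) \<Rightarrow> ('r \<Rightarrow> 'v) set \<Rightarrow> enat" where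
  "neg_index_fun B W = Sup {enat k | k. \<exists>V::nat \<Rightarrow> 'r \<Rightarrow> 'v. (\<forall>i<k. V i \<in> W) \<and>
     (\<forall>c::nat \<Rightarrow> real. (\<exists>i<k. c i \<noteq> 0) \<longrightarrow>
        B (\<lambda>s. \<Sum>i<k. c i *\<^sub>R V i s) (\<lambda>s. \<Sum>i<k. c i *\<^sub>R V i s) < 0)}"

text \<open>Signature n_+ - n_- (used only on finite-dimensional spaces).\<close>
definition sgn_form :: "('v::real_vector \<Rightarrow> 'v \<Rightarrow> real) \<Rightarrow> 'v set \<Rightarrow> int" where
  "sgn_form B W = int (the_enat (neg_index (\<lambda>x y. - B x y) W)) - int (the_enat (neg_index B W))"

definition gorth :: "('v \<Rightarrow> 'v \<Rightarrow> real) \<Rightarrow> 'v set \<Rightarrow> 'v set" where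
  "gorth g W = {v. \<forall>w\<in>W. g v w = 0}"

definition nondeg_on :: "('v::real_vector \<Rightarrow> 'v \<Rightarrow> real) \<Rightarrow> 'v set \<Rightarrow> bool" where
  "nondeg_on g W \<longleftrightarrow> (\<forall>x\<in>W. (\<forall>y\<in>W. g x y = 0) \<longrightarrow> x = 0)"

definition jacobi_sol :: "(real \<Rightarrow> ('a::real_normed_vector \<Rightarrow>\<^sub>L 'a)) \<Rightarrow> (real \<Rightarrow> 'a) \<Rightarrow> bool" where
  "jacobi_sol R J \<longleftrightarrow> (\<exists>J'. \<forall>t\<in>{0..1}.
      (J has_vector_derivative J' t) (at t within {0..1}) \<and>
      (J' has_vector_derivative blinfun_apply (R t) (J t)) (at t within {0..1}))"

definition JJ :: "('a \<Rightarrow> 'a \<Rightarrow> real) \<Rightarrow> (real \<Rightarrow> ('a::real_normed_vector \<Rightarrow>\<^sub>L 'a)) \<Rightarrow> 'a set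
    \<Rightarrow> ('a \<Rightarrow> 'a) \<Rightarrow> (real \<Rightarrow> 'a) set" where
  "JJ g R P S = {J. jacobi_sol R J \<and> J 0 \<in> P \<and>
      vector_derivative J (at 0 within {0..1}) + S (J 0) \<in> gorth g P}"

definition JJt :: "('a \<Rightarrow> 'a \<Rightarrow> real) \<Rightarrow> (real \<Rightarrow> ('a::real_normed_vector \<Rightarrow>\<^sub>L 'a)) \<Rightarrow> 'a set
    \<Rightarrow> ('a \<Rightarrow> 'a) \<Rightarrow> real \<Rightarrow> 'a set" where
  "JJt g R P S t = (\<lambda>J. J t) ` JJ g R P S"

definition focal :: "('a \<Rightarrow> 'a \<Rightarrow> real) \<Rightarrow> (real \<Rightarrow> ('a::real_normed_vector \<Rightarrow>\<^sub>L 'a)) \<Rightarrow> 'a set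
    \<Rightarrow> ('a \<Rightarrow> 'a) \<Rightarrow> real \<Rightarrow> bool" where
  "focal g R P S t \<longleftrightarrow> 0 < t \<and> t \<le> 1 \<and> JJt g R P S t \<noteq> UNIV"

definition sgn_inst :: "('a \<Rightarrow> 'a \<Rightarrow> real) \<Rightarrow> (real \<Rightarrow> ('a::real_normed_vector \<Rightarrow>\<^sub>L 'a)) \<Rightarrow> 'a set
    \<Rightarrow> ('a \<Rightarrow> 'a) \<Rightarrow> real \<Rightarrow> int" where
  "sgn_inst g R P S t = sgn_form g (gorth g (JJt g R P S t))"

definition H1 :: "(real \<Rightarrow> 'a::euclidean_space) set" where
  "H1 = {V. \<exists>W. W absolutely_integrable_on {0..1} \<and>
            (\<lambda>s. (norm (W s))\<^sup>2) integrable_on {0..1} \<and>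
            (\<forall>t\<in>{0..1}. (W has_integral (V t - V 0)) {0..t})}"

definition H1P :: "'a::euclidean_space set \<Rightarrow> (real \<Rightarrow> 'a) set" where
  "H1P P = {V \<in> H1. V 0 \<in> P \<and> V 1 = 0}"

text \<open>Index form; V' is the (a.e. existing) derivative of the H^1 function V.\<close>
definition I1 :: "('a \<Rightarrow> 'a \<Rightarrow> real) \<Rightarrow> (real \<Rightarrow> ('a::euclidean_space \<Rightarrow>\<^sub>L 'a)) \<Rightarrow> ('a \<Rightarrow> 'a)
    \<Rightarrow> (real \<Rightarrow> 'a) \<Rightarrow> (real \<Rightarrow> 'a) \<Rightarrow> real" where
  "I1 g R S V W = integral {0..1} (\<lambda>s. g (vector_derivative V (at s)) (vector_derivative W (at s))
        + g (blinfun_apply (R s) (V s)) (W s)) - g (S (V 0)) (W 0)"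

definition Kspace :: "('a \<Rightarrow> 'a \<Rightarrow> real) \<Rightarrow> (real \<Rightarrow> 'a) \<Rightarrow> 'a::euclidean_space set \<Rightarrow> (real \<Rightarrow> 'a) set" where
  "Kspace g Y P = {V \<in> H1P P. \<exists>c N. negligible N \<and> (\<forall>s\<in>{0..1} - N.
      g (vector_derivative V (at s)) (Y s) - g (V s) (vector_derivative Y (at s within {0..1})) = c)}"

end

theory Submission
  imports Defs "HOL-Library.Function_Algebras"
begin

text \<open>The index of the form on the constrained space over [0, t], extended by zero, is followed as t grows.
  Passing from a to b, one allows the constant g(V', Y) - g(V, Y') to jump at a. This enlarges the
  space over [0, b] by one negative direction, a multiple of Y. When b - a is small, the fields V of the
  enlarged space for which V a is the value at a of some solution J satisfying the initial conditions split
  orthogonally into the space over [0, a], a nonnegative space supported in [a, b], and the solutions J on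
  [0, a] continued by the Jacobi field vanishing at b. Rescaled by b - a, the form on the last summand
  tends to g on the space of values of J at the endpoint that is kept fixed, whose index is one minus the
  index of g on the orthogonal complement. The solutions that vanish at a are isotropic in the enlarged
  space and contribute their dimension. Hence the index drops by the negative index of g on the complement
  on arrival at a focal instant and increases by the positive index on leaving it; a compactness argument
  on [0, 1] adds up these jumps.\<close>

section \<open>The negative index and orthonormal families\<close>

text \<open>On \<open>H1P P\<close> the index is infinite: for f vanishing at 0 and 1, the form at f
  Y is the integral of f'^2 g(Y, Y), which is negative unless f = 0. Pairing V with f Y gives the
  integral of f' (g(V', Y) - g(V, Y')), so the constraint is orthogonality to exactly these fields.
  This makes the index finite and explains why subdividing an interval frees a multiple of Y. The
  spaces change with t, so no fixed operator is followed. Index certificates are compared across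
  algebraic splittings, without completeness or spectral theory. The bookkeeping rests on k + nu =
  1, where k and nu are the indices of g on the values at the fixed endpoint and on their
  complement. Inserting a node adds k and removing the jump of the constant costs 1, hence m - nu on
  arrival. On departure the isotropic fields add nu + pi, pi being the positive index on the
  complement, hence m + pi. Nondegeneracy of g on every \<open>JJt g R P S t\<close> provides the
  splittings and isolates the focal instants. One end of each short interval moves, so all constants
  depend on the fixed end only.\<close>

text \<open>A certificate for the index that makes sense on infinite-dimensional spaces: an orthonormal negative
  family together with semidefiniteness of the form on its orthogonal complement.\<close>

definition has_index :: "('v::real_vector \<Rightarrow> 'v \<Rightarrow> real) \<Rightarrow> 'v set \<Rightarrow> nat \<Rightarrow> bool" where
  "has_index B W m \<longleftrightarrow> (\<exists>F::nat \<Rightarrow> 'v. (\<forall>i<m. F i \<in> W) \<and>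
     (\<forall>i<m. \<forall>j<m. B (F i) (F j) = (if i = j then - 1 else 0)) \<and>
     (\<forall>v\<in>W. (\<forall>i<m. B v (F i) = 0) \<longrightarrow> 0 \<le> B v v))"

definition neg_fam :: "('v::real_vector \<Rightarrow> 'v \<Rightarrow> real) \<Rightarrow> 'v set \<Rightarrow> nat \<Rightarrow> (nat \<Rightarrow> 'v) \<Rightarrow> bool" where
  "neg_fam B W k V \<longleftrightarrow> (\<forall>i<k. V i \<in> W) \<and>
     (\<forall>c::nat \<Rightarrow> real. (\<exists>i<k. c i \<noteq> 0) \<longrightarrow>
        B (\<Sum>i<k. c i *\<^sub>R V i) (\<Sum>i<k. c i *\<^sub>R V i) < 0)"

lemma neg_index_alt: "neg_index B W = Sup {enat k | k. \<exists>V. neg_fam B W k V}"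
  unfolding neg_index_def neg_fam_def ..

text \<open>Gaussian elimination on real coefficients. It is the dimension count behind the index
  bounds, and in this form it also serves vectors that are functions in an infinite-dimensional
  space.\<close>

lemma underdetermined_system:
  fixes a :: "nat \<Rightarrow> nat \<Rightarrow> real"
  assumes "m < k"
  shows "\<exists>c. (\<exists>i<k. c i \<noteq> 0) \<and> (\<forall>j<m. (\<Sum>i<k. c i * a i j) = 0)"
  using assms
proof (induction m arbitrary: k a)
  case 0
  then show ?case by (intro exI[of _ "\<lambda>_. 1"]) auto
next
  case (Suc m)
  show ?case
  proof (cases "\<exists>p<k. a p m \<noteq> 0")
    case False
    obtain c where c: "\<exists>i<k. c i \<noteq> 0" "\<forall>j<m. (\<Sum>i<k. c i * a i j) = 0"
      using Suc.IH[of k a] Suc.prems by auto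
    have "(\<Sum>i<k. c i * a i m) = 0" using False by simp
    with c show ?thesis by (auto simp: less_Suc_eq)
  next
    case True
    then obtain p where p: "p < k" "a p m \<noteq> 0" by blast
    \<comment> \<open>\<open>s\<close> enumerates the indices other than the pivot \<open>p\<close>,
      and \<open>u\<close> below inverts it; \<open>a'\<close> is the matrix after row
      \<open>p\<close> has cleared column \<open>m\<close>.\<close>
    define s where "s i = (if i < p then i else Suc i)" for i
    define a' where "a' i j = a (s i) j - a (s i) m / a p m * a p j" for i j
    have km: "m < k - 1" using Suc.prems by simp
    obtain c where c: "\<exists>i<k - 1. c i \<noteq> 0" "\<forall>j<m. (\<Sum>i<k - 1. c i * a' i j) = 0"
      using Suc.IH[OF km, of a'] by auto
    have bij: "bij_betw s {..<k - 1} ({..<k} - {p})"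
    proof (rule bij_betwI[where g = "\<lambda>i. if i < p then i else i - 1"])
      show "s \<in> {..<k - 1} \<rightarrow> {..<k} - {p}"
      proof
        fix i assume "i \<in> {..<k - 1}"
        then have "i + 1 < k" by simp
        then show "s i \<in> {..<k} - {p}" by (simp add: s_def)
      qed
      show "(\<lambda>i. if i < p then i else i - 1) \<in> {..<k} - {p} \<rightarrow> {..<k - 1}"
      proof
        fix i assume "i \<in> {..<k} - {p}"
        then show "(if i < p then i else i - 1) \<in> {..<k - 1}" using p(1) by (cases "i < p") auto
      qed
      show "(if s i < p then s i else s i - 1) = i" for i by (simp add: s_def)
      show "s (if j < p then j else j - 1) = j" if "j \<in> {..<k} - {p}" for j
        using that by (cases "j < p") (auto simp: s_def)
    qed
    define u where "u i = (if i < p then i else i - 1)" for i :: nat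
    have us: "u (s i) = i" for i by (auto simp: u_def s_def)
    have sp: "s i \<noteq> p" for i by (auto simp: s_def)
    \<comment> \<open>Back substitution: this coefficient of the pivot row makes equation
      \<open>m\<close> hold.\<close>
    define q where "q = - (\<Sum>i<k - 1. c i * (a (s i) m / a p m))"
    define d where "d i = (if i = p then q else c (u i))" for i
    have sum_d: "(\<Sum>i<k. d i * a i j) = q * a p j + (\<Sum>i<k - 1. c i * a (s i) j)" for j
    proof -
      have "(\<Sum>i<k. d i * a i j) = d p * a p j + (\<Sum>i\<in>{..<k} - {p}. d i * a i j)"
        using p by (simp add: sum.remove)
      also have "(\<Sum>i\<in>{..<k} - {p}. d i * a i j) = (\<Sum>i<k - 1. d (s i) * a (s i) j)"
        using sum.reindex_bij_betw[OF bij, of "\<lambda>i. d i * a i j"] by simp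
      finally show ?thesis by (simp add: d_def us sp)
    qed
    have "(\<Sum>i<k. d i * a i m) = 0"
      unfolding sum_d using p by (simp add: q_def sum_distrib_right)
    moreover have "(\<Sum>i<k. d i * a i j) = 0" if "j < m" for j
    proof -
      have "(\<Sum>i<k - 1. c i * a' i j) = 0" using c that by blast
      moreover have "(\<Sum>i<k - 1. c i * a' i j) =
          (\<Sum>i<k - 1. c i * a (s i) j) - (\<Sum>i<k - 1. c i * (a (s i) m / a p m)) * a p j"
        by (simp add: a'_def sum_distrib_right sum_subtractf right_diff_distrib mult.assoc)
      ultimately show ?thesis unfolding sum_d q_def by simp
    qed
    moreover have "\<exists>i<k. d i \<noteq> 0"
    proof -
      obtain i where i: "i < k - 1" "c i \<noteq> 0" using c by blast
      have "s i < k" using bij i by (auto simp: bij_betw_def)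
      moreover have "d (s i) \<noteq> 0" using i by (simp add: d_def us sp)
      ultimately show ?thesis by blast
    qed
    ultimately show ?thesis by (intro exI[of _ d]) (auto simp: less_Suc_eq)
  qed
qed

text \<open>Bilinearity and symmetry are required on a carrier only, because \<open>I1\<close> has
  them only on \<open>H1P P\<close>: the integrals need weak derivatives, and linearity of
  \<open>S\<close> is assumed on \<open>P\<close> alone.\<close>

locale form_on =
  fixes X :: "'v::real_vector set" and B :: "'v \<Rightarrow> 'v \<Rightarrow> real"
  assumes subspace_carrier: "subspace X"
    and form_sym: "x \<in> X \<Longrightarrow> y \<in> X \<Longrightarrow> B x y = B y x"
    and form_add: "x \<in> X \<Longrightarrow> y \<in> X \<Longrightarrow> z \<in> X \<Longrightarrow> B (x + y) z = B x z + B y z"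
    and form_scale: "x \<in> X \<Longrightarrow> z \<in> X \<Longrightarrow> B (a *\<^sub>R x) z = a * B x z"
begin

lemma carrier_closed [simp, intro]:
  "0 \<in> X" "x \<in> X \<Longrightarrow> y \<in> X \<Longrightarrow> x + y \<in> X" "x \<in> X \<Longrightarrow> y \<in> X \<Longrightarrow> x - y \<in> X" "x \<in> X \<Longrightarrow> a *\<^sub>R x \<in> X"
  "x \<in> X \<Longrightarrow> - x \<in> X"
  using subspace_carrier by (auto simp: subspace_0 subspace_add subspace_diff subspace_mul subspace_neg)

lemma carrier_sum [simp, intro]: "(\<And>i. i \<in> A \<Longrightarrow> V i \<in> X) \<Longrightarrow> (\<Sum>i\<in>A. c i *\<^sub>R V i) \<in> X"
  using subspace_carrier by (auto intro!: subspace_sum subspace_mul)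

lemma form_zero [simp]: "z \<in> X \<Longrightarrow> B 0 z = 0" "z \<in> X \<Longrightarrow> B z 0 = 0"
  using form_scale[of z z 0] form_sym[of 0 z] by auto

lemma form_add_right: "x \<in> X \<Longrightarrow> y \<in> X \<Longrightarrow> z \<in> X \<Longrightarrow> B z (x + y) = B z x + B z y"
  by (simp add: form_sym[of z] form_add)

lemma form_scale_right: "x \<in> X \<Longrightarrow> z \<in> X \<Longrightarrow> B z (a *\<^sub>R x) = a * B z x"
  by (simp add: form_sym[of z] form_scale)

lemma form_minus: "x \<in> X \<Longrightarrow> z \<in> X \<Longrightarrow> B (- x) z = - B x z"
    "x \<in> X \<Longrightarrow> z \<in> X \<Longrightarrow> B z (- x) = - B z x"
  using form_scale[of x z "-1"] form_scale_right[of x z "-1"] by auto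

lemma form_diff: "x \<in> X \<Longrightarrow> y \<in> X \<Longrightarrow> z \<in> X \<Longrightarrow> B (x - y) z = B x z - B y z"
    "x \<in> X \<Longrightarrow> y \<in> X \<Longrightarrow> z \<in> X \<Longrightarrow> B z (x - y) = B z x - B z y"
  using form_add[of x "- y" z] form_add_right[of x "- y" z] by (auto simp: form_minus)

lemmas form_simps = form_add form_add_right form_scale form_scale_right form_minus form_diff

lemma form_sum: 
  assumes "\<And>i. i \<in> A \<Longrightarrow> V i \<in> X" "z \<in> X"
  shows "B (\<Sum>i\<in>A. c i *\<^sub>R V i) z = (\<Sum>i\<in>A. c i * B (V i) z)"
proof (cases "finite A")
  case True
  then show ?thesis using assms
    by (induction A rule: finite_induct) (auto simp: form_simps)
qed (use assms in simp)

lemma form_sum_right: 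
  assumes "\<And>i. i \<in> A \<Longrightarrow> V i \<in> X" "z \<in> X"
  shows "B z (\<Sum>i\<in>A. c i *\<^sub>R V i) = (\<Sum>i\<in>A. c i * B z (V i))"
  using assms by (simp add: form_sym[of z] form_sum)

text \<open>More than \<open>m\<close> vectors have a nontrivial combination orthogonal to the
  \<open>m\<close> vectors of the certificate. The form is nonnegative there, which a negative
  family forbids.\<close>

lemma neg_fam_le_index:
  assumes idx: "has_index B W m" and W: "subspace W" "W \<subseteq> X" and V: "neg_fam B W k V"
  shows "k \<le> m"
proof (rule ccontr)
  assume "\<not> k \<le> m"
  then have mk: "m < k" by simp
  obtain F where F: "\<forall>i<m. F i \<in> W" "\<forall>v\<in>W. (\<forall>i<m. B v (F i) = 0) \<longrightarrow> 0 \<le> B v v"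
    using idx unfolding has_index_def by blast
  obtain c where c: "\<exists>i<k. c i \<noteq> 0" "\<forall>j<m. (\<Sum>i<k. c i * B (V i) (F j)) = 0"
    using underdetermined_system[OF mk, of "\<lambda>i j. B (V i) (F j)"] by blast
  let ?v = "\<Sum>i<k. c i *\<^sub>R V i"
  have VW: "V i \<in> W" if "i < k" for i using V that unfolding neg_fam_def by blast
  have vW: "?v \<in> W" using W VW by (auto intro!: subspace_sum subspace_mul)
  have "B ?v (F j) = 0" if "j < m" for j
    using form_sum[of "{..<k}" V "F j" c] VW W F c that by auto
  then have "0 \<le> B ?v ?v" using F vW by blast
  moreover have "B ?v ?v < 0" using V c unfolding neg_fam_def by blast
  ultimately show False by simp
qed

lemma orthonormal_neg_fam:
  assumes F: "\<forall>i<m. F i \<in> W" "\<forall>i<m. \<forall>j<m. B (F i) (F j) = (if i = j then - 1 else 0)"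
    and W: "W \<subseteq> X"
  shows "neg_fam B W m F"
  unfolding neg_fam_def
proof (intro conjI allI impI)
  fix c :: "nat \<Rightarrow> real" assume c: "\<exists>i<m. c i \<noteq> 0"
  let ?v = "\<Sum>i<m. c i *\<^sub>R F i"
  have FX: "F i \<in> X" if "i < m" for i using F W that by blast
  have 1: "B (F j) ?v = - c j" if "j < m" for j
  proof -
    have "B (F j) ?v = (\<Sum>i<m. c i * B (F j) (F i))"
      using FX that by (intro form_sum_right) auto
    also have "\<dots> = (\<Sum>i<m. if i = j then - c j else 0)"
      using F that by (intro sum.cong) auto
    finally show ?thesis using that by simp
  qed
  have "B ?v ?v = (\<Sum>i<m. c i * B (F i) ?v)"
    using FX by (intro form_sum) auto
  also have "\<dots> = - (\<Sum>i<m. c i * c i)"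
    using 1 by (simp add: sum_negf)
  also have "\<dots> < 0"
  proof -
    obtain i where i: "i < m" "c i \<noteq> 0" using c by blast
    have "0 < (\<Sum>i<m. c i * c i)"
    proof (rule sum_pos2[where i = i])
      show "0 < c i * c i" using i by (meson not_real_square_gt_zero)
    qed (use i in auto)
    then show ?thesis by simp
  qed
  finally show "B ?v ?v < 0" .
qed (use F in auto)

lemma has_index_imp_neg_fam: "has_index B W m \<Longrightarrow> W \<subseteq> X \<Longrightarrow> \<exists>V. neg_fam B W m V"
  unfolding has_index_def using orthonormal_neg_fam by blast

lemma neg_index_eq:
  assumes "has_index B W m" "subspace W" "W \<subseteq> X"
  shows "neg_index B W = enat m"
proof -
  have "Sup {enat k | k. \<exists>V. neg_fam B W k V} = enat m"
  proof (rule antisym)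
    show "Sup {enat k |k. \<exists>V. neg_fam B W k V} \<le> enat m"
      using neg_fam_le_index[OF assms] by (auto intro!: Sup_least)
    show "enat m \<le> Sup {enat k |k. \<exists>V. neg_fam B W k V}"
      using has_index_imp_neg_fam assms by (intro Sup_upper) blast
  qed
  then show ?thesis by (simp add: neg_index_alt)
qed

lemma has_index_unique:
  assumes "has_index B W m" "has_index B W m'" "subspace W" "W \<subseteq> X"
  shows "m = m'"
  using neg_index_eq[OF assms(1,3,4)] neg_index_eq[OF assms(2-4)] by simp

text \<open>Take an orthonormal negative family of greatest length. A negative vector orthogonal to
  it could be normalised and appended, so the form is nonnegative on the complement.\<close>

lemma has_index_bounded:
  assumes bd: "\<And>k V. neg_fam B W k V \<Longrightarrow> k \<le> m" and W: "subspace W" "W \<subseteq> X"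
  shows "\<exists>m'\<le>m. has_index B W m'"
proof -
  define Q where "Q k \<longleftrightarrow> (\<exists>F::nat \<Rightarrow> 'v. (\<forall>i<k. F i \<in> W) \<and>
     (\<forall>i<k. \<forall>j<k. B (F i) (F j) = (if i = j then - 1 else 0)))" for k
  have Qle: "k \<le> m" if "Q k" for k
    using that bd orthonormal_neg_fam W unfolding Q_def by blast
  have "Q 0" unfolding Q_def by simp
  define k where "k = (GREATEST k. Q k)"
  have Qk: "Q k" unfolding k_def using \<open>Q 0\<close> Qle by (rule GreatestI_nat)
  have kmax: "k' \<le> k" if "Q k'" for k'
    unfolding k_def using that Qle by (rule Greatest_le_nat)
  obtain F where F: "\<forall>i<k. F i \<in> W" "\<forall>i<k. \<forall>j<k. B (F i) (F j) = (if i = j then - 1 else 0)"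
    using Qk unfolding Q_def by blast
  have "0 \<le> B v v" if v: "v \<in> W" "\<forall>i<k. B v (F i) = 0" for v
  proof (rule ccontr)
    assume "\<not> 0 \<le> B v v"
    then have neg: "B v v < 0" by simp
    define w where "w = (1 / sqrt (- B v v)) *\<^sub>R v"
    have wW: "w \<in> W" using v W by (simp add: w_def subspace_mul)
    have vX: "v \<in> X" and FX: "F i \<in> X" if "i < k" for i using v W F that by auto
    then have vX: "v \<in> X" using v W by auto
    have "B w w = -1"
      using neg vX by (simp add: w_def form_simps field_simps)
    moreover have "B w (F i) = 0" "B (F i) w = 0" if "i < k" for i
      using v vX FX that form_sym[of "F i" v] by (simp_all add: w_def form_simps)
    ultimately have "Q (Suc k)"
      unfolding Q_def using F wW
      by (intro exI[of _ "F(k := w)"]) (auto simp: less_Suc_eq)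
    then show False using kmax by fastforce
  qed
  then have "has_index B W k" unfolding has_index_def using F by blast
  then show ?thesis using Qle[OF Qk] by blast
qed

lemma has_index_mono:
  assumes "has_index B W' m'" "subspace W'" "W' \<subseteq> X" "subspace W" "W \<subseteq> W'"
  shows "\<exists>m\<le>m'. has_index B W m"
proof (rule has_index_bounded)
  fix k V assume "neg_fam B W k V"
  then have "neg_fam B W' k V" using assms(5) unfolding neg_fam_def by blast
  then show "k \<le> m'" using neg_fam_le_index assms by blast
qed (use assms in auto)

text \<open>The two families are concatenated. A vector orthogonal to all of them splits into parts
  that are each orthogonal to their own family, since the cross terms vanish.\<close>

lemma has_index_orthogonal_sum:
  assumes U: "has_index B U m" and V: "has_index B V n"
    and UX: "U \<subseteq> X" "V \<subseteq> X"
    and orth: "\<And>u v. u \<in> U \<Longrightarrow> v \<in> V \<Longrightarrow> B u v = 0"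
    and W: "\<And>w. w \<in> W \<Longrightarrow> \<exists>u\<in>U. \<exists>v\<in>V. w = u + v" "U \<subseteq> W" "V \<subseteq> W"
  shows "has_index B W (m + n)"
proof -
  obtain F where F: "\<forall>i<m. F i \<in> U" "\<forall>i<m. \<forall>j<m. B (F i) (F j) = (if i = j then - 1 else 0)"
    "\<forall>v\<in>U. (\<forall>i<m. B v (F i) = 0) \<longrightarrow> 0 \<le> B v v"
    using U unfolding has_index_def by blast
  obtain G where G: "\<forall>i<n. G i \<in> V" "\<forall>i<n. \<forall>j<n. B (G i) (G j) = (if i = j then - 1 else 0)"
    "\<forall>v\<in>V. (\<forall>i<n. B v (G i) = 0) \<longrightarrow> 0 \<le> B v v"
    using V unfolding has_index_def by blast
  define H where "H i = (if i < m then F i else G (i - m))" for i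
  have orth': "B v u = 0" if "u \<in> U" "v \<in> V" for u v
    using orth[OF that] form_sym[of u v] that UX by auto
  have "\<forall>i<m + n. H i \<in> W" using F G W by (auto simp: H_def)
  moreover have "B (H i) (H j) = (if i = j then - 1 else 0)" if "i < m + n" "j < m + n" for i j
  proof -
    have "i - m < n" if "i \<ge> m" using that \<open>i < m + n\<close> by simp
    moreover have "j - m < n" if "j \<ge> m" using that \<open>j < m + n\<close> by simp
    moreover have "i - m = j - m \<longleftrightarrow> i = j" if "i \<ge> m" "j \<ge> m" using that by auto
    ultimately show ?thesis
      using F(1,2) G(1,2) orth orth' by (cases "i < m"; cases "j < m") (auto simp: H_def)
  qed
  moreover have "0 \<le> B w w" if w: "w \<in> W" "\<forall>i<m + n. B w (H i) = 0" for w
  proof -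
    obtain u v where uv: "u \<in> U" "v \<in> V" "w = u + v" using W(1) w by blast
    have "B u (F i) = 0" if "i < m" for i
    proof -
      have "B w (F i) = 0" using w(2)[rule_format, of i] that by (simp add: H_def)
      then show ?thesis using uv F(1) UX orth'[of "F i" v] that by (auto simp: form_add subsetD)
    qed
    then have 1: "0 \<le> B u u" using F(3) uv by blast
    have "B v (G i) = 0" if "i < n" for i
    proof -
      have "B w (G i) = 0" using w(2)[rule_format, of "i + m"] that by (simp add: H_def)
      then show ?thesis using uv G(1) UX orth[of u "G i"] that by (auto simp: form_add subsetD)
    qed
    then have 2: "0 \<le> B v v" using G(3) uv by blast
    have "B w w = B u u + B v v"
      using uv UX orth[of u v] orth'[of u v] by (auto simp: form_simps subsetD)
    then show ?thesis using 1 2 by simp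
  qed
  ultimately show ?thesis unfolding has_index_def by blast
qed

lemma has_index_nonneg: "(\<And>v. v \<in> W \<Longrightarrow> 0 \<le> B v v) \<Longrightarrow> has_index B W 0"
  unfolding has_index_def by auto

text \<open>The negative family and the nonnegative subspace may be oblique to each other; in the
  application the form is merely close to a diagonal one. A longer negative family would have a
  nontrivial combination without component along \<open>V\<close>, hence in
  \<open>T\<close>.\<close>

lemma has_index_decomposition:
  assumes V: "neg_fam B W m V" and W: "subspace W" "W \<subseteq> X"
    and T: "subspace T" "T \<subseteq> W" "\<And>t. t \<in> T \<Longrightarrow> 0 \<le> B t t"
    and dec: "\<And>w. w \<in> W \<Longrightarrow> \<exists>c. \<exists>t\<in>T. w = (\<Sum>i<m. c i *\<^sub>R V i) + t"
  shows "has_index B W m"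
proof -
  have "k \<le> m" if U: "neg_fam B W k U" for k U
  proof (rule ccontr)
    assume "\<not> k \<le> m"
    then have mk: "m < k" by simp
    have UW: "U i \<in> W" if "i < k" for i using U that unfolding neg_fam_def by blast
    have "\<forall>i. \<exists>c. \<exists>t. i < k \<longrightarrow> t \<in> T \<and> U i = (\<Sum>j<m. c j *\<^sub>R V j) + t"
      using dec UW by metis
    then obtain a t where at: "\<And>i. i < k \<Longrightarrow> t i \<in> T \<and> U i = (\<Sum>j<m. a i j *\<^sub>R V j) + t i"
      by metis
    obtain c where c: "\<exists>i<k. c i \<noteq> 0" "\<forall>j<m. (\<Sum>i<k. c i * a i j) = 0"
      using underdetermined_system[OF mk, of a] by blast
    have "(\<Sum>i<k. c i *\<^sub>R U i) = (\<Sum>i<k. c i *\<^sub>R (\<Sum>j<m. a i j *\<^sub>R V j) + c i *\<^sub>R t i)"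
      using at by (intro sum.cong) (auto simp: scaleR_add_right)
    also have "\<dots> = (\<Sum>i<k. \<Sum>j<m. (c i * a i j) *\<^sub>R V j) + (\<Sum>i<k. c i *\<^sub>R t i)"
      by (simp add: sum.distrib scaleR_sum_right)
    also have "(\<Sum>i<k. \<Sum>j<m. (c i * a i j) *\<^sub>R V j) = (\<Sum>j<m. (\<Sum>i<k. c i * a i j) *\<^sub>R V j)"
      by (subst sum.swap) (simp add: scaleR_sum_left)
    also have "\<dots> = 0" using c by simp
    finally have eq: "(\<Sum>i<k. c i *\<^sub>R U i) = (\<Sum>i<k. c i *\<^sub>R t i)" by simp
    have "(\<Sum>i<k. c i *\<^sub>R t i) \<in> T" using at T by (auto intro!: subspace_sum subspace_mul)
    then have "0 \<le> B (\<Sum>i<k. c i *\<^sub>R U i) (\<Sum>i<k. c i *\<^sub>R U i)" using eq T by simp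
    moreover have "B (\<Sum>i<k. c i *\<^sub>R U i) (\<Sum>i<k. c i *\<^sub>R U i) < 0"
      using U c unfolding neg_fam_def by blast
    ultimately show False by simp
  qed
  then obtain m' where m': "m' \<le> m" "has_index B W m'" using has_index_bounded W by blast
  moreover have "m \<le> m'" using neg_fam_le_index[OF m'(2) W V] .
  ultimately show ?thesis by simp
qed

text \<open>The vector w and the isotropic vector e span a hyperbolic plane; passing from the orthogonal
  complement of e to W adds exactly one negative direction.\<close>

lemma has_index_isotropic_step:
  assumes W: "subspace W" "W \<subseteq> X" and e: "e \<in> W" "B e e = 0" and w: "w \<in> W" "B w e = 1"
    and idx: "has_index B {v\<in>W. B v e = 0} m"
  shows "has_index B W (m + 1)"
proof -
  obtain F where F: "\<forall>i<m. F i \<in> W \<and> B (F i) e = 0"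
    "\<forall>i<m. \<forall>j<m. B (F i) (F j) = (if i = j then - 1 else 0)"
    "\<forall>v\<in>W. B v e = 0 \<longrightarrow> (\<forall>i<m. B v (F i) = 0) \<longrightarrow> 0 \<le> B v v"
    using idx unfolding has_index_def by auto
  have FW: "F i \<in> W" and FX: "F i \<in> X" and Fe: "B (F i) e = 0" "B e (F i) = 0" if "i < m" for i
    using F W e that form_sym[of e "F i"] by (auto simp: subsetD)
  have eX: "e \<in> X" and wX: "w \<in> X" using e w W by auto
  \<comment> \<open>\<open>F i\<close> has square -1, so adding these multiples removes the
    components of \<open>w\<close> along \<open>F\<close>.\<close>
  let ?s = "\<Sum>i<m. B w (F i) *\<^sub>R F i"
  have sW: "?s \<in> W" using FW W by (auto intro!: subspace_sum subspace_mul)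
  define w1 where "w1 = w + ?s"
  have w1W: "w1 \<in> W" using sW w W by (simp add: w1_def subspace_add)
  have sX: "?s \<in> X" and w1X: "w1 \<in> X" using sW w1W W by auto
  have "B ?s (F j) = - B w (F j)" if "j < m" for j
  proof -
    have "B ?s (F j) = (\<Sum>i<m. B w (F i) * B (F i) (F j))"
      using FX that by (intro form_sum) auto
    also have "\<dots> = (\<Sum>i<m. if i = j then - B w (F j) else 0)"
      using F that by (intro sum.cong) auto
    finally show ?thesis using that by simp
  qed
  then have w1F: "B w1 (F j) = 0" if "j < m" for j
    using that wX sX FX by (simp add: w1_def form_simps)
  have "B ?s e = 0" using form_sum[of "{..<m}" F e] FX eX Fe by simp
  then have w1e: "B w1 e = 1" using wX sX eX w by (simp add: w1_def form_simps)
  \<comment> \<open>The shift along \<open>e\<close> makes the partner isotropic: \<open>e\<close>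
    and \<open>z\<close> are a hyperbolic pair, and \<open>f\<close> below is a unit negative vector
    of their plane.\<close>
  define z where "z = w1 - (B w1 w1 / 2) *\<^sub>R e"
  have zW: "z \<in> W" using w1W e W by (simp add: z_def subspace_diff subspace_mul)
  have zX: "z \<in> X" using zW W by auto
  have ze: "B z e = 1" "B e z = 1"
    using w1e e w1X eX form_sym[of e w1] by (auto simp: z_def form_simps)
  have zz: "B z z = 0"
    using w1e e w1X eX form_sym[of e w1] by (simp add: z_def form_simps)
  have zF: "B z (F j) = 0" "B (F j) z = 0" if "j < m" for j
    using that w1F Fe w1X eX FX form_sym[of "F j" w1] by (simp_all add: z_def form_simps)
  define f where "f = (1 / sqrt 2) *\<^sub>R (e - z)"
  have fW: "f \<in> W" using zW e W by (simp add: f_def subspace_diff subspace_mul)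
  have fX: "f \<in> X" using fW W by auto
  have ff: "B f f = - 1"
    using ze zz e eX zX by (simp add: f_def form_simps)
  have fF: "B f (F j) = 0" "B (F j) f = 0" if "j < m" for j
    using that zF Fe zX eX FX by (simp_all add: f_def form_simps)
  have "0 \<le> B v v" if v: "v \<in> W" "\<forall>i<Suc m. B v ((F(m := f)) i) = 0" for v
  proof -
    have vX: "v \<in> X" using v W by auto
    have vF: "B v (F i) = 0" if "i < m" for i using v(2)[rule_format, of i] that by simp
    have "B v f = 0" using v(2)[rule_format, of m] by simp
    then have vez: "B v z = B v e" using vX zX eX by (simp add: f_def form_simps)
    define a where "a = B v e"
    \<comment> \<open>Orthogonality to \<open>f\<close> means equal pairing with \<open>e\<close>
      and \<open>z\<close>. Subtracting the projection on the positive vector \<open>e + z\<close>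
      leaves a vector orthogonal to \<open>e\<close>, to which the given certificate
      applies.\<close>
    define u where "u = v - a *\<^sub>R (e + z)"
    have uW: "u \<in> W" using v e zW W by (simp add: u_def subspace_diff subspace_mul subspace_add)
    have uX: "u \<in> X" using uW W by auto
    have "B u e = 0" using ze e vX eX zX by (simp add: u_def form_simps a_def)
    moreover have "B u (F i) = 0" if "i < m" for i
      using that vF Fe zF vX eX zX FX by (simp add: u_def form_simps)
    ultimately have "0 \<le> B u u" using F(3) uW by blast
    moreover have "B u u = B v v - 2 * a * a"
      using vez ze e zz vX eX zX form_sym[of e v] form_sym[of z v]
      by (simp add: u_def form_simps a_def algebra_simps)
    ultimately show ?thesis using zero_le_square[of a] by linarith
  qed
  moreover have "\<forall>i<Suc m. (F(m := f)) i \<in> W" using FW fW by (auto simp: less_Suc_eq)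
  moreover have "\<forall>i<Suc m. \<forall>j<Suc m. B ((F(m := f)) i) ((F(m := f)) j) = (if i = j then - 1 else 0)"
    using F(2) ff fF by (auto simp: less_Suc_eq)
  ultimately show ?thesis unfolding has_index_def by (intro exI[of _ "F(m := f)"]) simp
qed

lemma subspace_orthogonal_complement:
  assumes "subspace W" "W \<subseteq> X" "\<And>i. i \<in> A \<Longrightarrow> e i \<in> X"
  shows "subspace {v\<in>W. \<forall>i\<in>A. B v (e i) = 0}"
proof (rule subspaceI)
  show "0 \<in> {v\<in>W. \<forall>i\<in>A. B v (e i) = 0}" using assms by (auto simp: subspace_0)
qed (use assms in \<open>auto simp: subspace_add subspace_mul form_simps subsetD\<close>)

text \<open>Induction peels off the last pair: duality places \<open>e k\<close> and
  \<open>w k\<close> in the complement of the earlier isotropic vectors, so each step adds one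
  negative direction.\<close>

lemma has_index_isotropic:
  assumes W: "subspace W" "W \<subseteq> X"
    and e: "\<And>i. i < k \<Longrightarrow> e i \<in> W" "\<And>i j. i < k \<Longrightarrow> j < k \<Longrightarrow> B (e i) (e j) = 0"
    and w: "\<And>i. i < k \<Longrightarrow> w i \<in> W"
      "\<And>i j. i < k \<Longrightarrow> j < k \<Longrightarrow> B (w j) (e i) = (if i = j then 1 else 0)"
    and idx: "has_index B {v\<in>W. \<forall>i<k. B v (e i) = 0} m"
  shows "has_index B W (m + k)"
  using e w idx
proof (induction k arbitrary: m)
  case 0
  then show ?case by simp
next
  case (Suc k)
  let ?W = "{v\<in>W. \<forall>i<k. B v (e i) = 0}"
  have "subspace {v\<in>W. \<forall>i\<in>{..<k}. B v (e i) = 0}"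
    using W Suc.prems(1) by (intro subspace_orthogonal_complement) auto
  then have sub: "subspace ?W" by (simp add: Ball_def)
  have "{v\<in>?W. B v (e k) = 0} = {v\<in>W. \<forall>i<Suc k. B v (e i) = 0}" by (auto simp: less_Suc_eq)
  then have "has_index B {v\<in>?W. B v (e k) = 0} m" using Suc.prems(5) by simp
  then have "has_index B ?W (m + 1)"
    using Suc.prems(1-4) W by (intro has_index_isotropic_step[OF sub, of "e k" "w k"]) auto
  then have "has_index B W (m + 1 + k)"
    using Suc.prems by (intro Suc.IH) auto
  then show ?case by simp
qed

end

section \<open>Differentiation of indefinite integrals\<close>

lemma indefinite_integral_diff:
  fixes f :: "real \<Rightarrow> 'a::banach"
  assumes f: "f integrable_on {a..b}" and xy: "x \<in> {a..b}" "y \<in> {a..b}" "x \<le> y"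
  shows "integral {a..y} f - integral {a..x} f = integral {x..y} f"
proof -
  have "integral {a..x} f + integral {x..y} f = integral {a..y} f"
    using xy f by (intro Henstock_Kurzweil_Integration.integral_combine integrable_subinterval_real[OF f]) auto
  then show ?thesis by (simp add: algebra_simps)
qed

text \<open>By the Henstock lemma, disjoint intervals attached to bad points have small total length; the
  Vitali covering lemma bounds the measure of the bad set by that length.\<close>

lemma negligible_indefinite_integral_bad_set:
  fixes f :: "real \<Rightarrow> 'a::euclidean_space"
  assumes f: "f integrable_on {a..b}" and e: "0 < e"
    and S: "S \<subseteq> {a<..<b}"
    and bad: "\<And>x d. x \<in> S \<Longrightarrow> 0 < d \<Longrightarrow> \<exists>y\<in>{a..b}. 0 < \<bar>y - x\<bar> \<and> \<bar>y - x\<bar> < d \<and>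
      e * \<bar>y - x\<bar> < norm (integral {a..y} f - integral {a..x} f - (y - x) *\<^sub>R f x)"
  shows "negligible S"
unfolding negligible_outer_le
proof (intro allI impI)
  fix \<epsilon> :: real assume \<epsilon>: "0 < \<epsilon>"
  \<comment> \<open>Chosen for the final count: the enlarged balls \<open>cball i (5 * r i)\<close>
    have length \<open>10 * r i\<close>, and the Henstock bound keeps \<open>e\<close> times the sum
    of the radii below \<open>\<eta>\<close>.\<close>
  define \<eta> where "\<eta> = \<epsilon> * e / 10"
  have \<eta>: "\<eta> > 0" using \<epsilon> e by (simp add: \<eta>_def)
  obtain \<gamma> where \<gamma>: "gauge \<gamma>"
    and hen: "\<And>p. \<lbrakk>p tagged_partial_division_of (cbox a b); \<gamma> fine p\<rbrakk> \<Longrightarrow>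
             sum (\<lambda>(x,k). norm(measure lborel k *\<^sub>R f x - integral k f)) p < \<eta>"
    using Henstock_lemma[OF _ \<eta>, of f a b] f by auto
  have "\<forall>x\<in>S. \<exists>y. y \<in> {a..b} \<and> 0 < \<bar>y - x\<bar> \<and> \<bar>y - x\<bar> < 1 \<and> cball x \<bar>y - x\<bar> \<subseteq> \<gamma> x \<and>
    e * \<bar>y - x\<bar> < norm (integral {a..y} f - integral {a..x} f - (y - x) *\<^sub>R f x)"
  proof
    fix x assume x: "x \<in> S"
    obtain d where d: "d > 0" "ball x d \<subseteq> \<gamma> x"
      using \<gamma> unfolding gauge_def by (meson open_contains_ball)
    then have "min d 1 > 0" by simp
    then obtain y where "y \<in> {a..b}" "0 < \<bar>y - x\<bar>" "\<bar>y - x\<bar> < min d 1"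
      "e * \<bar>y - x\<bar> < norm (integral {a..y} f - integral {a..x} f - (y - x) *\<^sub>R f x)"
      using bad[OF x] by blast
    moreover from this have "cball x \<bar>y - x\<bar> \<subseteq> \<gamma> x" using d by (auto simp: subset_iff)
    ultimately show "\<exists>y. y \<in> {a..b} \<and> 0 < \<bar>y - x\<bar> \<and> \<bar>y - x\<bar> < 1 \<and> cball x \<bar>y - x\<bar> \<subseteq> \<gamma> x \<and>
        e * \<bar>y - x\<bar> < norm (integral {a..y} f - integral {a..x} f - (y - x) *\<^sub>R f x)"
      by auto
  qed
  from bchoice[OF this] obtain y where y0: "\<forall>x\<in>S. y x \<in> {a..b} \<and> 0 < \<bar>y x - x\<bar> \<and> \<bar>y x - x\<bar> < 1 \<and> cball x \<bar>y x - x\<bar> \<subseteq> \<gamma> x \<and>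
    e * \<bar>y x - x\<bar> < norm (integral {a..y x} f - integral {a..x} f - (y x - x) *\<^sub>R f x)" ..
  have y: "\<And>x. x \<in> S \<Longrightarrow> y x \<in> {a..b} \<and> 0 < \<bar>y x - x\<bar> \<and> \<bar>y x - x\<bar> < 1 \<and> cball x \<bar>y x - x\<bar> \<subseteq> \<gamma> x \<and>
    e * \<bar>y x - x\<bar> < norm (integral {a..y x} f - integral {a..x} f - (y x - x) *\<^sub>R f x)"
    by (rule y0[rule_format])
  define r where "r x = \<bar>y x - x\<bar>" for x
  have r: "\<And>x. x \<in> S \<Longrightarrow> 0 < r x \<and> r x \<le> 1" using y by (force simp: r_def)
  have "S \<subseteq> (\<Union>x\<in>S. cball x (r x))"
  proof
    fix x assume "x \<in> S"
    then show "x \<in> (\<Union>x\<in>S. cball x (r x))" using r[of x] by (intro UN_I[of x]) auto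
  qed
  then obtain C where C: "countable C" "C \<subseteq> S"
     "pairwise (\<lambda>i j. disjnt (cball i (r i)) (cball j (r j))) C"
     "S \<subseteq> (\<Union>i\<in>C. cball i (5 * r i))"
    using Vitali_covering_lemma_cballs[of S "\<lambda>x. x" r S 1] r by blast
  \<comment> \<open>The interval between \<open>x\<close> and \<open>y x\<close> lies in
    \<open>cball x (r x)\<close>. The selected intervals are therefore disjoint and, tagged by
    \<open>x\<close>, form a fine partial division.\<close>
  define K where "K x = {min x (y x)..max x (y x)}" for x
  have Kball: "K x \<subseteq> cball x (r x)" for x
    by (auto simp: K_def r_def dist_real_def)
  have fin: "(\<Sum>x\<in>D. 10 * r x) \<le> \<epsilon>" if D: "D \<subseteq> C" "finite D" for D
  proof -
    define p where "p = (\<lambda>x. (x, K x)) ` D"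
    have DS: "x \<in> S" if "x \<in> D" for x using that D C by blast
    have disj: "K x \<inter> K z = {}" if "x \<in> D" "z \<in> D" "x \<noteq> z" for x z
    proof -
      have "disjnt (cball x (r x)) (cball z (r z))"
        using C(3) that D unfolding pairwise_def by blast
      then show ?thesis using Kball[of x] Kball[of z] unfolding disjnt_def by blast
    qed
    have "p tagged_partial_division_of (cbox a b)"
      unfolding tagged_partial_division_of_def
    proof (intro conjI allI impI)
      show "finite p" using D by (simp add: p_def)
    next
      fix x k assume "(x, k) \<in> p"
      then have xk: "x \<in> D" "k = K x" by (auto simp: p_def)
      show "x \<in> k" using xk by (simp add: K_def)
      have "x \<in> {a..b}" "y x \<in> {a..b}" using DS[OF xk(1)] y S by auto
      then show "k \<subseteq> cbox a b" using xk by (auto simp: K_def)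
      show "\<exists>a b. k = cbox a b" using xk by (auto simp: K_def)
    next
      fix x1 k1 x2 k2 assume "(x1, k1) \<in> p \<and> (x2, k2) \<in> p \<and> (x1, k1) \<noteq> (x2, k2)"
      then have "k1 \<inter> k2 = {}" using disj by (auto simp: p_def)
      then show "interior k1 \<inter> interior k2 = {}" using interior_subset by blast
    qed
    moreover have "\<gamma> fine p"
      unfolding fine_def p_def using Kball y DS by (fastforce simp: r_def)
    ultimately have "sum (\<lambda>(x,k). norm(measure lborel k *\<^sub>R f x - integral k f)) p < \<eta>" by (rule hen)
    moreover have "sum (\<lambda>(x,k). norm(measure lborel k *\<^sub>R f x - integral k f)) p =
        (\<Sum>x\<in>D. norm (measure lborel (K x) *\<^sub>R f x - integral (K x) f))"
      unfolding p_def by (subst sum.reindex) (auto simp: inj_on_def)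
    moreover have "e * r x \<le> norm (measure lborel (K x) *\<^sub>R f x - integral (K x) f)" if "x \<in> D" for x
    proof -
      have xS: "x \<in> {a..b}" "y x \<in> {a..b}" using DS[OF that] y S by auto
      have "e * r x < norm (integral {a..y x} f - integral {a..x} f - (y x - x) *\<^sub>R f x)"
        using y[OF DS[OF that]] by (simp add: r_def)
      also have "\<dots> = norm (measure lborel (K x) *\<^sub>R f x - integral (K x) f)"
      proof (cases "x \<le> y x")
        case True
        then have "integral {a..y x} f - integral {a..x} f = integral (K x) f"
          using indefinite_integral_diff[OF f, of x "y x"] xS by (simp add: K_def)
        then show ?thesis using True by (simp add: K_def norm_minus_commute)
      next
        case False
        then have "integral {a..x} f - integral {a..y x} f = integral (K x) f"
          using indefinite_integral_diff[OF f, of "y x" x] xS by (simp add: K_def)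
        then have "integral {a..y x} f - integral {a..x} f = - integral (K x) f"
          by (metis minus_diff_eq)
        then have "integral {a..y x} f - integral {a..x} f - (y x - x) *\<^sub>R f x =
            (x - y x) *\<^sub>R f x - integral (K x) f" by (simp only: scaleR_diff_left) simp
        moreover have "measure lborel (K x) = x - y x" using False by (simp add: K_def)
        ultimately show ?thesis by simp
      qed
      finally show ?thesis by simp
    qed
    then have "(\<Sum>x\<in>D. e * r x) \<le> (\<Sum>x\<in>D. norm (measure lborel (K x) *\<^sub>R f x - integral (K x) f))"
      by (rule sum_mono)
    ultimately have "(\<Sum>x\<in>D. e * r x) < \<eta>" by simp
    then have "e * (\<Sum>x\<in>D. r x) < e * (\<epsilon> / 10)" by (simp add: sum_distrib_left \<eta>_def field_simps)
    then have "(\<Sum>x\<in>D. r x) < \<epsilon> / 10" using e by simp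
    then show ?thesis by (simp add: sum_distrib_left[symmetric])
  qed
  show "\<exists>T. S \<subseteq> T \<and> T \<in> lmeasurable \<and> measure lebesgue T \<le> \<epsilon>"
  proof (intro exI[of _ "\<Union>i\<in>C. cball i (5 * r i)"] conjI C(4))
    have bd: "measure lebesgue (\<Union>i\<in>I'. cball i (5 * r i)) \<le> \<epsilon>" if "I' \<subseteq> C" "finite I'" for I'
    proof -
      have "measure lebesgue (\<Union>i\<in>I'. cball i (5 * r i)) \<le> (\<Sum>i\<in>I'. measure lebesgue (cball i (5 * r i)))"
        using that by (intro measure_UNION_le) auto
      also have "\<dots> = (\<Sum>i\<in>I'. 10 * r i)"
      proof (rule sum.cong)
        fix i assume "i \<in> I'"
        then have "0 < r i" using r that C by blast
        then show "measure lebesgue (cball i (5 * r i)) = 10 * r i"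
          by (simp add: cball_eq_atLeastAtMost)
      qed simp
      finally show ?thesis using fin[OF that] by simp
    qed
    show "(\<Union>i\<in>C. cball i (5 * r i)) \<in> lmeasurable"
      by (rule fmeasurable_UN_bound[OF C(1) _ bd]) auto
    show "measure lebesgue (\<Union>i\<in>C. cball i (5 * r i)) \<le> \<epsilon>"
      by (rule measure_UN_bound[OF C(1) _ bd]) auto
  qed
qed

text \<open>Lebesgue differentiation for the gauge integral: where the derivative fails, the point
  is bad for some tolerance 1 / (n + 1), so the exceptional set is a countable union of null
  sets.\<close>

theorem indefinite_integral_has_vector_derivative_ae:
  fixes f :: "real \<Rightarrow> 'a::euclidean_space"
  assumes f: "f integrable_on {a..b}"
  obtains N where "negligible N"
    "\<And>x. x \<in> {a..b} - N \<Longrightarrow> ((\<lambda>t. integral {a..t} f) has_vector_derivative f x) (at x)"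
proof -
  define Bad where "Bad e = {x\<in>{a<..<b}. \<forall>d>0. \<exists>y\<in>{a..b}. 0 < \<bar>y - x\<bar> \<and> \<bar>y - x\<bar> < d \<and>
    e * \<bar>y - x\<bar> < norm (integral {a..y} f - integral {a..x} f - (y - x) *\<^sub>R f x)}" for e
  \<comment> \<open>The end points are discarded because the derivative is two-sided.\<close>
  define N where "N = (\<Union>n::nat. Bad (1 / real (Suc n))) \<union> {a, b}"
  have "negligible (Bad (1 / real (Suc n)))" for n
    by (rule negligible_indefinite_integral_bad_set[OF f, of "1 / real (Suc n)"]) (auto simp: Bad_def)
  then have "negligible N" unfolding N_def by (intro negligible_Un negligible_countable_Union) auto
  moreover have "((\<lambda>t. integral {a..t} f) has_vector_derivative f x) (at x)" if x: "x \<in> {a..b} - N" for x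
    unfolding has_vector_derivative_def has_derivative_at_alt
  proof (intro conjI allI impI bounded_linear_scaleR_left)
    fix e :: real assume "0 < e"
    then obtain n where n: "1 / real (Suc n) < e" using nat_approx_posE by blast
    have "x \<noteq> a" "x \<noteq> b" using x by (auto simp: N_def)
    then have xab: "x \<in> {a<..<b}" using x by auto
    have "x \<notin> Bad (1 / real (Suc n))" using x by (auto simp: N_def)
    then have "\<exists>d>0. \<forall>y\<in>{a..b}. \<not> (0 < \<bar>y - x\<bar> \<and> \<bar>y - x\<bar> < d \<and>
      1 / real (Suc n) * \<bar>y - x\<bar> < norm (integral {a..y} f - integral {a..x} f - (y - x) *\<^sub>R f x))"
      using xab unfolding Bad_def by blast
    then obtain d where d: "d > 0" "\<And>y. y \<in> {a..b} \<Longrightarrow> 0 < \<bar>y - x\<bar> \<Longrightarrow> \<bar>y - x\<bar> < d \<Longrightarrow>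
      norm (integral {a..y} f - integral {a..x} f - (y - x) *\<^sub>R f x) \<le> 1 / real (Suc n) * \<bar>y - x\<bar>"
      by (meson not_less)
    obtain d' where d': "d' > 0" "ball x d' \<subseteq> {a<..<b}"
      using xab open_greaterThanLessThan by (meson open_contains_ball)
    show "\<exists>d>0. \<forall>y. norm (y - x) < d \<longrightarrow>
        norm (integral {a..y} f - integral {a..x} f - (y - x) *\<^sub>R f x) \<le> e * norm (y - x)"
    proof (intro exI[of _ "min d d'"] conjI allI impI)
      show "0 < min d d'" using d d' by simp
      fix y assume y: "norm (y - x) < min d d'"
      show "norm (integral {a..y} f - integral {a..x} f - (y - x) *\<^sub>R f x) \<le> e * norm (y - x)"
      proof (cases "y = x")
        case False
        have "y \<in> ball x d'" using y by (simp add: dist_real_def abs_minus_commute)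
        then have "y \<in> {a..b}" using d' by force
        then have "norm (integral {a..y} f - integral {a..x} f - (y - x) *\<^sub>R f x) \<le> 1 / real (Suc n) * \<bar>y - x\<bar>"
          using d(2)[of y] y False by simp
        also have "\<dots> \<le> e * \<bar>y - x\<bar>" using n by (intro mult_right_mono) auto
        finally show ?thesis by simp
      qed simp
    qed
  qed
  ultimately show thesis using that by blast
qed

section \<open>Linear second-order equations\<close>

text \<open>Picard iteration written as a series: \<open>d k\<close> is the k-fold iterated integral
  applied to \<open>z0\<close>, of norm at most |z0| (M t)^k / k!. Hence the series and its termwise
  derivatives converge uniformly.\<close>

lemma linear_ode_exists:
  fixes A :: "real \<Rightarrow> 'b::banach \<Rightarrow>\<^sub>L 'b"
  assumes A: "continuous_on {0..1} A"
  shows "\<exists>z. z 0 = z0 \<and> (\<forall>t\<in>{0..1}. (z has_vector_derivative blinfun_apply (A t) (z t)) (at t within {0..1}))"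
proof -
  have "compact (A ` {0..1})" using A by (intro compact_continuous_image) auto
  then obtain M where M: "\<And>t. t \<in> {0..1} \<Longrightarrow> norm (A t) \<le> M" "M > 0"
    by (metis bounded_pos compact_imp_bounded image_eqI)
  define d where "d = rec_nat (\<lambda>_. z0) (\<lambda>_ f t. integral {0..t} (\<lambda>s. blinfun_apply (A s) (f s)))"
  have d0: "d 0 = (\<lambda>_. z0)" and dS: "d (Suc k) = (\<lambda>t. integral {0..t} (\<lambda>s. blinfun_apply (A s) (d k s)))" for k
    by (simp_all add: d_def)
  have cont: "continuous_on {0..1} (d k)" for k
  proof (induction k)
    case 0
    then show ?case by (simp add: d0)
  next
    case (Suc k)
    have "continuous_on {0..1} (\<lambda>s. blinfun_apply (A s) (d k s))"
      using A Suc by (intro continuous_intros)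
    then show ?case unfolding dS
      by (intro indefinite_integral_continuous_1 integrable_continuous_real)
  qed
  have contA: "continuous_on {0..1} (\<lambda>s. blinfun_apply (A s) (d k s))" for k
    using A cont by (intro continuous_intros)
  have deriv: "(d (Suc k) has_vector_derivative blinfun_apply (A t) (d k t)) (at t within {0..1})"
    if "t \<in> {0..1}" for k t
    unfolding dS by (rule integral_has_vector_derivative[OF contA that])
  have bound: "norm (d k t) \<le> norm z0 * (M * t) ^ k / fact k" if "t \<in> {0..1}" for k t
    using that
  proof (induction k arbitrary: t)
    case 0
    then show ?case by (simp add: d0)
  next
    case (Suc k)
    have "((\<lambda>s. s ^ Suc k / real (Suc k)) has_vector_derivative s ^ k) (at s within {0..t})" for s
    proof -
      have "((\<lambda>s. s ^ Suc k / real (Suc k)) has_real_derivative real (Suc k) * s ^ k / real (Suc k)) (at s within {0..t})"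
        by (auto intro!: derivative_eq_intros simp del: of_nat_Suc power_Suc)
      then show ?thesis by (simp add: has_real_derivative_iff_has_vector_derivative)
    qed
    then have "((\<lambda>s. s ^ k) has_integral (t ^ Suc k / real (Suc k) - 0 ^ Suc k / real (Suc k))) {0..t}"
      using Suc.prems by (intro fundamental_theorem_of_calculus) auto
    then have i1: "((\<lambda>s. (norm z0 * M * M ^ k / fact k) * s ^ k) has_integral
        (norm z0 * M * M ^ k / fact k) * (t ^ Suc k / real (Suc k))) {0..t}"
      by (intro has_integral_mult_right) simp
    have "norm (d (Suc k) t) \<le> (norm z0 * M * M ^ k / fact k) * (t ^ Suc k / real (Suc k))"
      unfolding dS
    proof (rule integral_norm_bound_integral[OF _ has_integral_integrable[OF i1], THEN order_trans])
      show "(\<lambda>s. blinfun_apply (A s) (d k s)) integrable_on {0..t}"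
        using Suc.prems by (intro integrable_continuous_real continuous_on_subset[OF contA]) auto
      show "norm (blinfun_apply (A s) (d k s)) \<le> (norm z0 * M * M ^ k / fact k) * s ^ k" if "s \<in> {0..t}" for s
      proof -
        have s: "s \<in> {0..1}" using that Suc.prems by auto
        have "norm (blinfun_apply (A s) (d k s)) \<le> norm (A s) * norm (d k s)" by (rule norm_blinfun)
        also have "\<dots> \<le> M * (norm z0 * (M * s) ^ k / fact k)"
          using M s by (intro mult_mono Suc.IH) auto
        finally show ?thesis by (simp add: power_mult_distrib mult_ac)
      qed
      show "integral {0..t} (\<lambda>s. (norm z0 * M * M ^ k / fact k) * s ^ k) \<le>
          (norm z0 * M * M ^ k / fact k) * (t ^ Suc k / real (Suc k))"
        unfolding integral_unique[OF i1] by simp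
    qed
    also have "\<dots> = norm z0 * (M * t) ^ Suc k / fact (Suc k)"
      by (simp add: power_mult_distrib field_simps)
    finally show ?case .
  qed
  have bound1: "norm (d k t) \<le> norm z0 * (M ^ k / fact k)" if "t \<in> {0..1}" for k t
  proof -
    have "(M * t) ^ k \<le> M ^ k" using that M by (intro power_mono) (auto simp: mult_left_le)
    then have "norm z0 * (M * t) ^ k / fact k \<le> norm z0 * (M ^ k / fact k)"
      by (simp add: divide_right_mono mult_left_mono)
    then show ?thesis using bound[OF that, of k] by simp
  qed
  have "summable (\<lambda>k. norm z0 * (M ^ k / fact k))"
    using summable_exp[of M] by (intro summable_mult) (simp add: field_simps)
  then have unif: "uniform_limit {0..1} (\<lambda>n t. \<Sum>i<n. d i t) (\<lambda>t. suminf (\<lambda>i. d i t)) sequentially"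
    using bound1 by (intro Weierstrass_m_test) auto
  define z where "z t = (\<Sum>i. d i t)" for t
  define f' where "f' i t h = h *\<^sub>R (case i of 0 \<Rightarrow> 0 | Suc k \<Rightarrow> blinfun_apply (A t) (d k t))" for i t h
  have sums: "(\<lambda>n. d n t) sums z t" if "t \<in> {0..1}" for t
    using tendsto_uniform_limitI[OF unif that] by (simp add: sums_def z_def)
  have "\<exists>g. \<forall>x\<in>{0..1}. (\<lambda>n. d n x) sums (g x) \<and>
      (g has_derivative (\<lambda>h. h *\<^sub>R blinfun_apply (A x) (z x))) (at x within {0..1})"
  proof (rule has_derivative_series[where f' = f'])
    show "convex {0..1::real}" by simp
    show "(d n has_derivative f' n x) (at x within {0..1})" if "x \<in> {0..1}" for n x
      using deriv[OF that] by (cases n) (auto simp: f'_def[abs_def] d0 has_vector_derivative_def)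
    show "\<forall>\<^sub>F n in sequentially. \<forall>x\<in>{0..1}. \<forall>h. norm (sum (\<lambda>i. f' i x h) {..<n} -
        h *\<^sub>R blinfun_apply (A x) (z x)) \<le> e * norm h" if e: "e > 0" for e
    proof -
      have "e / M > 0" using e M by simp
      \<comment> \<open>The derivative of \<open>d (Suc k)\<close> involves \<open>d k\<close> and
        that of \<open>d 0\<close> is zero, so n differentiated terms add up to \<open>A x\<close>
        applied to n - 1 terms of the series.\<close>
      from uniform_limitD[OF unif this]
      have "\<forall>\<^sub>F n in sequentially. \<forall>x\<in>{0..1}. dist (\<Sum>i<n - 1. d i x) (z x) < e / M"
        unfolding z_def by (rule eventually_compose_filterlim) real_asymp
      moreover have "\<forall>\<^sub>F n::nat in sequentially. 1 \<le> n" by (rule eventually_ge_at_top)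
      ultimately show ?thesis
      proof eventually_elim
        case (elim n)
        then obtain m where n: "n = Suc m" by (cases n) auto
        show ?case
        proof (intro ballI allI)
          fix x h :: real assume x: "x \<in> {0..1}"
          have "sum (\<lambda>i. f' i x h) {..<n} = h *\<^sub>R blinfun_apply (A x) (\<Sum>i<m. d i x)"
            unfolding n sum.lessThan_Suc_shift by (simp add: f'_def scaleR_sum_right blinfun.sum_right)
          then have eq: "norm (sum (\<lambda>i. f' i x h) {..<n} - h *\<^sub>R blinfun_apply (A x) (z x)) =
              \<bar>h\<bar> * norm (blinfun_apply (A x) ((\<Sum>i<m. d i x) - z x))"
            by (simp add: scaleR_diff_right[symmetric] blinfun.diff_right[symmetric])
          have "norm (blinfun_apply (A x) ((\<Sum>i<m. d i x) - z x)) \<le> M * (e / M)"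
          proof (rule order_trans[OF norm_blinfun])
            have "dist (\<Sum>i<m. d i x) (z x) < e / M" using elim(1) x n by auto
            then show "norm (A x) * norm ((\<Sum>i<m. d i x) - z x) \<le> M * (e / M)"
              using M x by (intro mult_mono) (auto simp: dist_norm)
          qed
          then have "\<bar>h\<bar> * norm (blinfun_apply (A x) ((\<Sum>i<m. d i x) - z x)) \<le> \<bar>h\<bar> * e"
            using M(2) by (intro mult_left_mono) auto
          then show "norm (sum (\<lambda>i. f' i x h) {..<n} - h *\<^sub>R blinfun_apply (A x) (z x)) \<le> e * norm h"
            unfolding eq by (simp add: mult.commute)
        qed
      qed
    qed
    show "(\<lambda>n. d n 0) sums z 0" using sums by simp
  qed simp
  then obtain g where g: "\<And>x. x \<in> {0..1} \<Longrightarrow> (\<lambda>n. d n x) sums (g x)"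
    "\<And>x. x \<in> {0..1} \<Longrightarrow> (g has_derivative (\<lambda>h. h *\<^sub>R blinfun_apply (A x) (z x))) (at x within {0..1})"
    by blast
  have gz: "g x = z x" if "x \<in> {0..1}" for x using g(1)[OF that] sums[OF that] by (rule sums_unique2)
  have "d i 0 = (if i = 0 then z0 else 0)" for i by (cases i) (simp_all add: d0 dS)
  then have "(\<lambda>i. d i 0) sums z0" using sums_single[of 0 "\<lambda>_. z0"] by simp
  then have "g 0 = z0" using g(1)[of 0] sums_unique2 by force
  moreover have "(g has_vector_derivative blinfun_apply (A t) (g t)) (at t within {0..1})" if "t \<in> {0..1}" for t
    using g(2)[OF that] gz[OF that] by (simp add: has_vector_derivative_def)
  ultimately show ?thesis by blast
qed

text \<open>The derivative is carried along explicitly because the Cauchy data (J t, J' t) are used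
  at many different t.\<close>

definition jac :: "(real \<Rightarrow> ('a::real_normed_vector \<Rightarrow>\<^sub>L 'a)) \<Rightarrow> (real \<Rightarrow> 'a) \<Rightarrow> (real \<Rightarrow> 'a) \<Rightarrow> bool" where
  "jac R J J' \<longleftrightarrow> (\<forall>t\<in>{0..1}.
      (J has_vector_derivative J' t) (at t within {0..1}) \<and>
      (J' has_vector_derivative blinfun_apply (R t) (J t)) (at t within {0..1}))"

lemma jacobi_sol_iff: "jacobi_sol R J \<longleftrightarrow> (\<exists>J'. jac R J J')"
  by (simp add: jacobi_sol_def jac_def)

lemma jacD:
  assumes "jac R J J'" "t \<in> {0..1}"
  shows "(J has_vector_derivative J' t) (at t within {0..1})"
    "(J' has_vector_derivative blinfun_apply (R t) (J t)) (at t within {0..1})"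
    "vector_derivative J (at t within {0..1}) = J' t"
  using assms by (auto simp: jac_def intro!: vector_derivative_within_cbox[of 0 1, simplified])

lemma jac_lin:
  assumes "jac R J J'" "jac R K K'"
  shows "jac R (\<lambda>t. a *\<^sub>R J t + b *\<^sub>R K t) (\<lambda>t. a *\<^sub>R J' t + b *\<^sub>R K' t)"
  using assms unfolding jac_def
  by (auto intro!: derivative_eq_intros simp: blinfun.add_right blinfun.scaleR_right)

lemma jac_continuous: 
  assumes "jac R J J'" shows "continuous_on {0..1} J" "continuous_on {0..1} J'"
  unfolding continuous_on_eq_continuous_within
  by (intro ballI has_vector_derivative_continuous[OF jacD(1)[OF assms]]
      has_vector_derivative_continuous[OF jacD(2)[OF assms]]; simp)+

section \<open>Cauchy data: growth estimates and the two-point problem\<close>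

locale jacobi_ode =
  fixes R :: "real \<Rightarrow> ('a::euclidean_space \<Rightarrow>\<^sub>L 'a)"
  assumes R_cont: "continuous_on {0..1} R"
begin

lemma R_bound: "\<exists>M>0. \<forall>t\<in>{0..1}. \<forall>x. norm (blinfun_apply (R t) x) \<le> M * norm x"
proof -
  have "compact (R ` {0..1})" using R_cont by (intro compact_continuous_image) auto
  then obtain M where M: "\<And>t. t \<in> {0..1} \<Longrightarrow> norm (R t) \<le> M" "M > 0"
    by (metis bounded_pos compact_imp_bounded image_eqI)
  have "norm (blinfun_apply (R t) x) \<le> M * norm x" if "t \<in> {0..1}" for t x
    using norm_blinfun[of "R t" x] M(1)[OF that] by (meson mult_right_mono norm_ge_zero order_trans)
  then show ?thesis using M(2) by blast
qed

lemma jac_exists: "\<exists>J J'. jac R J J' \<and> J 0 = x \<and> J' 0 = y"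
proof -
  define A where "A t = Blinfun (\<lambda>z::'a \<times> 'a. (snd z, blinfun_apply (R t) (fst z)))" for t
  have bl: "bounded_linear (\<lambda>z::'a \<times> 'a. (snd z, blinfun_apply (R t) (fst z)))" for t
    by (intro bounded_linear_Pair bounded_linear_snd bounded_linear_compose[OF blinfun.bounded_linear_right] bounded_linear_fst)
  have A: "blinfun_apply (A t) z = (snd z, blinfun_apply (R t) (fst z))" for t z
    unfolding A_def by (simp add: bounded_linear_Blinfun_apply[OF bl])
  have "continuous_on {0..1} A"
  proof (rule continuous_on_blinfun_componentwise)
    show "continuous_on {0..1} (\<lambda>t. blinfun_apply (A t) i)" for i
      unfolding A using R_cont by (intro continuous_intros)
  qed
  then obtain z where z: "z 0 = (x, y)"
    "\<And>t. t \<in> {0..1} \<Longrightarrow> (z has_vector_derivative blinfun_apply (A t) (z t)) (at t within {0..1})"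
    using linear_ode_exists[of A "(x, y)"] by blast
  have "jac R (\<lambda>t. fst (z t)) (\<lambda>t. snd (z t))"
    unfolding jac_def
  proof (intro ballI conjI)
    fix t :: real assume t: "t \<in> {0..1}"
    show "((\<lambda>t. fst (z t)) has_vector_derivative snd (z t)) (at t within {0..1})"
      using bounded_linear.has_vector_derivative[OF bounded_linear_fst z(2)[OF t]] by (simp add: A)
    show "((\<lambda>t. snd (z t)) has_vector_derivative blinfun_apply (R t) (fst (z t))) (at t within {0..1})"
      using bounded_linear.has_vector_derivative[OF bounded_linear_snd z(2)[OF t]] by (simp add: A)
  qed
  then show ?thesis using z(1) by fastforce
qed

text \<open>Gronwall: after multiplication by an exponential, the squared norm of the Cauchy data is monotone.\<close>

lemma jac_energy_bound:
  "\<exists>C>0. \<forall>J J' s t. jac R J J' \<longrightarrow> s \<in> {0..1} \<longrightarrow> t \<in> {0..1} \<longrightarrow>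
      (norm (J t))\<^sup>2 + (norm (J' t))\<^sup>2 \<le> C * ((norm (J s))\<^sup>2 + (norm (J' s))\<^sup>2)"
proof -
  obtain M where M: "M > 0" "\<And>t x. t \<in> {0..1} \<Longrightarrow> norm (blinfun_apply (R t) x) \<le> M * norm x"
    using R_bound by blast
  \<comment> \<open>The derivative of |J|^2 + |J'|^2 is at most 2 |J| |J'| (1 + M), hence at most 1
    + M times this sum of squares.\<close>
  define c where "c = 1 + M"
  have main: "(norm (J t))\<^sup>2 + (norm (J' t))\<^sup>2 \<le> exp c * ((norm (J s))\<^sup>2 + (norm (J' s))\<^sup>2)"
    if J: "jac R J J'" and st: "s \<in> {0..1}" "t \<in> {0..1}" for J J' s t
  proof -
    define n where "n t = J t \<bullet> J t + J' t \<bullet> J' t" for t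
    define n' where "n' t = 2 * (J t \<bullet> J' t + J' t \<bullet> blinfun_apply (R t) (J t))" for t
    have n_nonneg: "n t \<ge> 0" for t by (simp add: n_def)
    have J_diff: "(J has_vector_derivative J' t) (at t)"
        "(J' has_vector_derivative blinfun_apply (R t) (J t)) (at t)" if "0 < t" "t < 1" for t
      using jacD[OF J, of t] that at_within_interior[of t "{0..1}"] by auto
    have n_deriv: "(n has_real_derivative n' t) (at t)" if "0 < t" "t < 1" for t
      unfolding n_def n'_def has_real_derivative_iff_has_vector_derivative has_vector_derivative_def
      using J_diff[OF that, unfolded has_vector_derivative_def]
      by (auto intro!: derivative_eq_intros simp: inner_commute algebra_simps)
    have n_bound: "\<bar>n' t\<bar> \<le> c * n t" if "t \<in> {0..1}" for t
    proof -
      have y: "2 * (norm (J t) * norm (J' t)) \<le> n t"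
        using sum_squares_bound[of "norm (J t)" "norm (J' t)"]
        by (simp add: n_def power2_norm_eq_inner[symmetric])
      have 1: "\<bar>J t \<bullet> J' t\<bar> \<le> norm (J t) * norm (J' t)" by (rule Cauchy_Schwarz_ineq2)
      have "\<bar>J' t \<bullet> blinfun_apply (R t) (J t)\<bar> \<le> norm (J' t) * norm (blinfun_apply (R t) (J t))"
        by (rule Cauchy_Schwarz_ineq2)
      also have "\<dots> \<le> norm (J' t) * (M * norm (J t))" using M that by (intro mult_left_mono) auto
      finally have 2: "\<bar>J' t \<bullet> blinfun_apply (R t) (J t)\<bar> \<le> M * (norm (J t) * norm (J' t))"
        by (simp add: mult_ac)
      have "\<bar>n' t\<bar> \<le> 2 * (norm (J t) * norm (J' t)) + M * (2 * (norm (J t) * norm (J' t)))"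
        using 1 2 unfolding n'_def by (simp add: abs_le_iff)
      also have "\<dots> \<le> n t + M * n t" using y M by (intro add_mono mult_left_mono) auto
      finally show ?thesis by (simp add: c_def algebra_simps)
    qed
    have n_cont: "continuous_on {0..1} n"
      unfolding n_def using jac_continuous[OF J] by (intro continuous_intros)
    have cle: "c * (v - u) \<le> c" if "0 \<le> u" "v \<le> 1" for u v :: real
    proof -
      have "c * (v - u) \<le> c * 1" using that M by (intro mult_left_mono) (auto simp: c_def)
      then show ?thesis by simp
    qed
    have fwd: "n v \<le> exp c * n u" if uv: "0 \<le> u" "u \<le> v" "v \<le> 1" for u v
    proof -
      have "- (exp (- c * u) * n u) \<le> - (exp (- c * v) * n v)"
      proof (rule DERIV_nonneg_imp_increasing_open[OF uv(2)])
        fix x assume x: "u < x" "x < v"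
        have "((\<lambda>x. - (exp (- c * x) * n x)) has_real_derivative
            exp (- c * x) * (c * n x - n' x)) (at x)"
          using n_deriv[of x] x uv by (auto intro!: derivative_eq_intros simp: algebra_simps)
        moreover have "0 \<le> exp (- c * x) * (c * n x - n' x)"
          using n_bound[of x] x uv by auto
        ultimately show "\<exists>y. ((\<lambda>x. - (exp (- c * x) * n x)) has_real_derivative y) (at x) \<and> 0 \<le> y" by blast
      qed (use uv in \<open>auto intro!: continuous_intros continuous_on_subset[OF n_cont]\<close>)
      then have "exp (- c * v) * n v \<le> exp (- c * u) * n u" by simp
      then have "exp (c * v) * (exp (- c * v) * n v) \<le> exp (c * v) * (exp (- c * u) * n u)" by simp
      moreover have "exp (c * v) * exp (- c * v) = 1" "exp (c * v) * exp (- c * u) = exp (c * (v - u))"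
        by (simp_all add: exp_add[symmetric] right_diff_distrib)
      ultimately have "n v \<le> exp (c * (v - u)) * n u" by (simp only: mult.assoc[symmetric] mult_1_left)
      also have "\<dots> \<le> exp c * n u"
        using cle[of u v] uv n_nonneg by (intro mult_right_mono) auto
      finally show ?thesis .
    qed
    have bwd: "n u \<le> exp c * n v" if uv: "0 \<le> u" "u \<le> v" "v \<le> 1" for u v
    proof -
      have "exp (c * u) * n u \<le> exp (c * v) * n v"
      proof (rule DERIV_nonneg_imp_increasing_open[OF uv(2)])
        fix x assume x: "u < x" "x < v"
        have "((\<lambda>x. exp (c * x) * n x) has_real_derivative exp (c * x) * (c * n x + n' x)) (at x)"
          using n_deriv[of x] x uv by (auto intro!: derivative_eq_intros simp: algebra_simps)
        moreover have "0 \<le> exp (c * x) * (c * n x + n' x)"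
          using n_bound[of x] x uv by auto
        ultimately show "\<exists>y. ((\<lambda>x. exp (c * x) * n x) has_real_derivative y) (at x) \<and> 0 \<le> y" by blast
      qed (use uv in \<open>auto intro!: continuous_intros continuous_on_subset[OF n_cont]\<close>)
      then have "exp (- c * u) * (exp (c * u) * n u) \<le> exp (- c * u) * (exp (c * v) * n v)" by simp
      moreover have "exp (- c * u) * exp (c * u) = 1" "exp (- c * u) * exp (c * v) = exp (c * (v - u))"
        by (simp_all add: exp_add[symmetric] right_diff_distrib)
      ultimately have "n u \<le> exp (c * (v - u)) * n v" by (simp only: mult.assoc[symmetric] mult_1_left)
      also have "\<dots> \<le> exp c * n v"
        using cle[of u v] uv n_nonneg by (intro mult_right_mono) auto
      finally show ?thesis .
    qed
    have "n t \<le> exp c * n s" using fwd[of s t] bwd[of t s] st by (cases "s \<le> t") auto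
    then show ?thesis by (simp add: n_def power2_norm_eq_inner)
  qed
  then show ?thesis by (intro exI[of _ "exp c"]) auto
qed

text \<open>One constant serves all solutions and all pairs of times, so the bounds survive a moving
  end point. The last bound is Taylor's formula of first order, its remainder controlled through J''
  = R J.\<close>

lemma jac_estimates:
  "\<exists>C>0. \<forall>J J' s t. jac R J J' \<longrightarrow> s \<in> {0..1} \<longrightarrow> t \<in> {0..1} \<longrightarrow>
      norm (J t) + norm (J' t) \<le> C * (norm (J s) + norm (J' s)) \<and>
      norm (J t - J s) \<le> C * \<bar>t - s\<bar> * (norm (J s) + norm (J' s)) \<and>
      norm (J' t - J' s) \<le> C * \<bar>t - s\<bar> * (norm (J s) + norm (J' s)) \<and>
      norm (J t - J s - (t - s) *\<^sub>R J' s) \<le> C * (t - s)\<^sup>2 * (norm (J s) + norm (J' s))"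
proof -
  obtain M where M: "M > 0" "\<And>t x. t \<in> {0..1} \<Longrightarrow> norm (blinfun_apply (R t) x) \<le> M * norm x"
    using R_bound by blast
  obtain E where E: "E > 0" "\<And>J J' s t. jac R J J' \<Longrightarrow> s \<in> {0..1} \<Longrightarrow> t \<in> {0..1} \<Longrightarrow>
      (norm (J t))\<^sup>2 + (norm (J' t))\<^sup>2 \<le> E * ((norm (J s))\<^sup>2 + (norm (J' s))\<^sup>2)"
    using jac_energy_bound by blast
  define G where "G = 2 * sqrt E"
  have G: "G > 0" using E by (simp add: G_def)
  have b0: "norm (J t) + norm (J' t) \<le> G * (norm (J s) + norm (J' s))"
    if "jac R J J'" "s \<in> {0..1}" "t \<in> {0..1}" for J J' s t
  proof -
    let ?p = "norm (J s) + norm (J' s)"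
    have le: "(norm (J s))\<^sup>2 + (norm (J' s))\<^sup>2 \<le> ?p\<^sup>2" by (simp add: power2_sum)
    have "(norm (J t))\<^sup>2 + (norm (J' t))\<^sup>2 \<le> E * ?p\<^sup>2"
      using E(2)[OF that] mult_left_mono[OF le, of E] E(1) by linarith
    then have "(norm (J t))\<^sup>2 \<le> E * ?p\<^sup>2" "(norm (J' t))\<^sup>2 \<le> E * ?p\<^sup>2"
      using zero_le_power2[of "norm (J t)"] zero_le_power2[of "norm (J' t)"] by linarith+
    then have "(norm (J t))\<^sup>2 \<le> (sqrt E * ?p)\<^sup>2" "(norm (J' t))\<^sup>2 \<le> (sqrt E * ?p)\<^sup>2"
      using E(1) by (simp_all add: power_mult_distrib)
    then have "norm (J t) \<le> sqrt E * ?p" "norm (J' t) \<le> sqrt E * ?p"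
      using E(1) by (auto intro!: power2_le_imp_le)
    then show ?thesis by (simp add: G_def)
  qed
  have lip: "norm (f t - f s) \<le> B * \<bar>t - s\<bar>"
    if "\<And>x. x \<in> {0..1} \<Longrightarrow> (f has_vector_derivative f' x) (at x within {0..1})"
      "\<And>x. x \<in> {0..1} \<Longrightarrow> norm (f' x) \<le> B" "s \<in> {0..1}" "t \<in> {0..1}" for f f' :: "real \<Rightarrow> 'a" and B s t
  proof -
    have "norm (f t - f s) \<le> B * norm (t - s)"
    proof (rule differentiable_bound[of "{0..1}" f "\<lambda>x h. h *\<^sub>R f' x"])
      show "onorm (\<lambda>h. h *\<^sub>R f' x) \<le> B" if "x \<in> {0..1}" for x
      proof (rule onorm_bound)
        show "0 \<le> B" using \<open>\<And>x. x \<in> {0..1} \<Longrightarrow> norm (f' x) \<le> B\<close>[OF \<open>s \<in> {0..1}\<close>] norm_ge_zero order_trans by blast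
        show "norm (h *\<^sub>R f' x) \<le> B * norm h" for h
          using \<open>\<And>x. x \<in> {0..1} \<Longrightarrow> norm (f' x) \<le> B\<close>[OF \<open>x \<in> {0..1}\<close>]
          
          by (simp add: mult.commute[of B] mult_left_mono)
      qed
    qed (use that in \<open>auto simp: has_vector_derivative_def\<close>)
    then show ?thesis by simp
  qed
  have main: "norm (J t) + norm (J' t) \<le> C * (norm (J s) + norm (J' s)) \<and>
      norm (J t - J s) \<le> C * \<bar>t - s\<bar> * (norm (J s) + norm (J' s)) \<and>
      norm (J' t - J' s) \<le> C * \<bar>t - s\<bar> * (norm (J s) + norm (J' s)) \<and>
      norm (J t - J s - (t - s) *\<^sub>R J' s) \<le> C * (t - s)\<^sup>2 * (norm (J s) + norm (J' s))"
    if C: "C = G * (1 + M)" and J: "jac R J J'" and st: "s \<in> {0..1}" "t \<in> {0..1}" for J J' s t C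
  proof -
    let ?p = "norm (J s) + norm (J' s)"
    have p: "?p \<ge> 0" by simp
    have GC: "G \<le> C" "M * G \<le> C" using G M C by (auto simp: algebra_simps)
    have 1: "norm (J t) + norm (J' t) \<le> C * ?p"
      using b0[OF J st] mult_right_mono[OF GC(1) p] by linarith
    have J1: "norm (J x) \<le> G * ?p" "norm (J' x) \<le> G * ?p" if "x \<in> {0..1}" for x
      using b0[OF J st(1) that] by (smt (verit) norm_ge_zero)+
    have RJ: "norm (blinfun_apply (R x) (J x)) \<le> M * G * ?p" if "x \<in> {0..1}" for x
      using M(2)[OF that, of "J x"] mult_left_mono[OF J1(1)[OF that] less_imp_le[OF M(1)]] by (simp add: mult.assoc)
    have J'lip: "norm (J' x - J' s) \<le> (M * G * ?p) * \<bar>x - s\<bar>" if "x \<in> {0..1}" for x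
      by (rule lip[of J' "\<lambda>x. blinfun_apply (R x) (J x)"]) (use jacD[OF J] RJ st that in auto)
    have "norm (J t - J s) \<le> (G * ?p) * \<bar>t - s\<bar>"
      by (rule lip[of J J']) (use jacD[OF J] J1 st in auto)
    also have "\<dots> \<le> C * ?p * \<bar>t - s\<bar>" using GC p by (intro mult_right_mono) auto
    finally have 2: "norm (J t - J s) \<le> C * \<bar>t - s\<bar> * ?p" by (simp add: mult_ac)
    have "(M * G * ?p) * \<bar>t - s\<bar> \<le> C * ?p * \<bar>t - s\<bar>" using GC p by (intro mult_right_mono) auto
    then have 3: "norm (J' t - J' s) \<le> C * \<bar>t - s\<bar> * ?p" using J'lip[OF st(2)] by (simp add: mult_ac)
    have seg: "closed_segment s t \<subseteq> {0..1}" using st by (auto simp: closed_segment_eq_real_ivl)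
    have "norm (J t - J s - (t - s) *\<^sub>R J' s) \<le> norm (t - s) * (M * G * ?p * \<bar>t - s\<bar>)"
    proof (rule vector_differentiable_bound_linearization[of "closed_segment s t"])
      show "(J has_vector_derivative J' x) (at x within closed_segment s t)" if "x \<in> closed_segment s t" for x
        using jacD(1)[OF J] seg that by (meson has_vector_derivative_within_subset subsetD)
      show "norm (J' x - J' s) \<le> M * G * ?p * \<bar>t - s\<bar>" if "x \<in> closed_segment s t" for x
      proof -
        have "\<bar>x - s\<bar> \<le> \<bar>t - s\<bar>" using that by (auto simp: closed_segment_eq_real_ivl split: if_splits)
        then have "M * G * ?p * \<bar>x - s\<bar> \<le> M * G * ?p * \<bar>t - s\<bar>" using M G by (intro mult_left_mono) auto
        then show ?thesis using J'lip[of x] that seg by force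
      qed
    qed auto
    also have "\<dots> = (M * G) * ((t - s)\<^sup>2 * ?p)"
      by (simp add: power2_eq_square abs_mult_self_eq[symmetric, of "t - s"] mult_ac del: abs_mult_self_eq)
    also have "\<dots> \<le> C * ((t - s)\<^sup>2 * ?p)" using GC p by (intro mult_right_mono) auto
    finally show ?thesis using 1 2 3 by (simp add: mult_ac)
  qed
  have "G * (1 + M) > 0" using G M by simp
  then show ?thesis using main[OF refl] by blast
qed

lemma jac_zero:
  assumes "jac R J J'" "s \<in> {0..1}" "J s = 0" "J' s = 0" "t \<in> {0..1}"
  shows "J t = 0" "J' t = 0"
proof -
  obtain C where "C > 0" and C: "\<And>J J' s t. jac R J J' \<Longrightarrow> s \<in> {0..1} \<Longrightarrow> t \<in> {0..1} \<Longrightarrow>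
      (norm (J t))\<^sup>2 + (norm (J' t))\<^sup>2 \<le> C * ((norm (J s))\<^sup>2 + (norm (J' s))\<^sup>2)"
    using jac_energy_bound by blast
  have "(norm (J t))\<^sup>2 + (norm (J' t))\<^sup>2 \<le> 0" using C[OF assms(1,2,5)] assms(3,4) by simp
  then have "(norm (J t))\<^sup>2 = 0 \<and> (norm (J' t))\<^sup>2 = 0"
    by (metis add_nonneg_eq_0_iff antisym sum_power2_ge_zero zero_le_power2)
  then show "J t = 0" "J' t = 0" by auto
qed

lemma jac_unique:
  assumes "jac R J J'" "jac R K K'" "s \<in> {0..1}" "J s = K s" "J' s = K' s" "t \<in> {0..1}"
  shows "J t = K t" "J' t = K' t"
  using jac_zero[OF jac_lin[OF assms(1,2), of 1 "-1"] assms(3) _ _ assms(6)] assms(4,5) by auto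

text \<open>Choosing one solution for each pair of initial data identifies solutions on [0, 1] with
  a finite-dimensional space, where injective linear maps are onto. Values outside [0, 1] are
  arbitrary, hence the restriction on \<open>t\<close> in \<open>linear_fl\<close>.\<close>

definition flow :: "'a \<times> 'a \<Rightarrow> (real \<Rightarrow> 'a) \<times> (real \<Rightarrow> 'a)" where
  "flow z = (SOME (J, J'). jac R J J' \<and> J 0 = fst z \<and> J' 0 = snd z)"

definition fl :: "'a \<times> 'a \<Rightarrow> real \<Rightarrow> 'a" where "fl z = fst (flow z)"
definition fl' :: "'a \<times> 'a \<Rightarrow> real \<Rightarrow> 'a" where "fl' z = snd (flow z)"

lemma fl: "jac R (fl z) (fl' z)" "fl z 0 = fst z" "fl' z 0 = snd z"
proof -
  have "\<exists>p. case p of (J, J') \<Rightarrow> jac R J J' \<and> J 0 = fst z \<and> J' 0 = snd z"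
    using jac_exists[of "fst z" "snd z"] by auto
  then have "case flow z of (J, J') \<Rightarrow> jac R J J' \<and> J 0 = fst z \<and> J' 0 = snd z"
    unfolding flow_def by (rule someI_ex)
  then show "jac R (fl z) (fl' z)" "fl z 0 = fst z" "fl' z 0 = snd z"
    by (auto simp: fl_def fl'_def split: prod.splits)
qed

lemma fl_eq: "jac R J J' \<Longrightarrow> t \<in> {0..1} \<Longrightarrow> J t = fl (J 0, J' 0) t \<and> J' t = fl' (J 0, J' 0) t"
  using jac_unique[OF _ fl(1), of J J' 0 "(J 0, J' 0)" t] fl(2,3) by auto

lemma linear_fl:
  assumes t: "t \<in> {0..1}"
  shows "linear (\<lambda>z. fl z t)" "linear (\<lambda>z. fl' z t)"
proof -
  have *: "fl (a *\<^sub>R z + b *\<^sub>R w) t = a *\<^sub>R fl z t + b *\<^sub>R fl w t \<and>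
      fl' (a *\<^sub>R z + b *\<^sub>R w) t = a *\<^sub>R fl' z t + b *\<^sub>R fl' w t" for a b z w
  proof -
    have "(a *\<^sub>R fst z + b *\<^sub>R fst w, a *\<^sub>R snd z + b *\<^sub>R snd w) = a *\<^sub>R z + b *\<^sub>R w"
      by (simp add: prod_eq_iff)
    then show ?thesis
      using fl_eq[OF jac_lin[OF fl(1)[of z] fl(1)[of w], of a b] t] by (simp only: fl)
  qed
  show "linear (\<lambda>z. fl z t)"
    using *[of 1 _ 1] *[of _ _ 0] by (intro linearI) auto
  show "linear (\<lambda>z. fl' z t)"
    using *[of 1 _ 1] *[of _ _ 0] by (intro linearI) auto
qed

text \<open>For Z b = 0, Taylor's formula at a puts (b - a) Z' a close to - Z a. In particular a
  solution vanishing at both ends is zero, so evaluation at a and b is injective on initial data and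
  therefore onto.\<close>

lemma boundary_value_problem:
  "\<exists>\<delta>>0. \<exists>C>0. \<forall>a b. 0 \<le> a \<longrightarrow> a < b \<longrightarrow> b \<le> 1 \<longrightarrow> b - a < \<delta> \<longrightarrow>
     (\<forall>Z Z'. jac R Z Z' \<longrightarrow> Z b = 0 \<longrightarrow> norm ((b - a) *\<^sub>R Z' a + Z a) \<le> C * (b - a) * norm (Z a)) \<and>
     (\<forall>x y. \<exists>Z Z'. jac R Z Z' \<and> Z a = x \<and> Z b = y)"
proof -
  obtain C where C: "C > 0" "\<And>J J' s t. jac R J J' \<Longrightarrow> s \<in> {0..1} \<Longrightarrow> t \<in> {0..1} \<Longrightarrow>
      norm (J t - J s - (t - s) *\<^sub>R J' s) \<le> C * (t - s)\<^sup>2 * (norm (J s) + norm (J' s))"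
    using jac_estimates by blast
  \<comment> \<open>With h = b - a at most 1 and C h at most 1/2 the term in Z' a can be absorbed: h
    |Z' a| is at most 3 |Z a|, and 1 + 3 gives the constant 4 C.\<close>
  define \<delta> where "\<delta> = min 1 (1 / (2 * C))"
  have est: "norm ((b - a) *\<^sub>R Z' a + Z a) \<le> (4 * C) * (b - a) * norm (Z a)"
    if ab: "0 \<le> a" "a < b" "b \<le> 1" "b - a < \<delta>" and Z: "jac R Z Z'" "Z b = 0" for a b Z Z'
  proof -
    let ?h = "b - a"
    have h: "0 < ?h" "?h < 1" "C * ?h \<le> 1 / 2"
      using ab C(1) by (auto simp: \<delta>_def field_simps)
    have "norm (Z b - Z a - ?h *\<^sub>R Z' a) \<le> C * ?h\<^sup>2 * (norm (Z a) + norm (Z' a))"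
      using C(2)[OF Z(1), of a b] ab by auto
    then have 1: "norm (?h *\<^sub>R Z' a + Z a) \<le> C * ?h\<^sup>2 * (norm (Z a) + norm (Z' a))"
      using Z(2) norm_minus_cancel[of "?h *\<^sub>R Z' a + Z a"] by (simp add: algebra_simps)
    have n1: "C * ?h\<^sup>2 * norm (Z' a) = (C * ?h) * (?h * norm (Z' a))" by (simp add: power2_eq_square)
    have n2: "C * ?h\<^sup>2 * norm (Z a) = (C * ?h) * (?h * norm (Z a))" by (simp add: power2_eq_square)
    have n3: "?h * norm (Z a) \<le> norm (Z a)" using h by (simp add: mult_left_le_one_le)
    have n4: "(C * ?h) * (?h * norm (Z' a)) \<le> 1 / 2 * (?h * norm (Z' a))"
      using h by (intro mult_right_mono) auto
    have n5: "(C * ?h) * (?h * norm (Z a)) \<le> 1 / 2 * norm (Z a)"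
      using h n3 C(1) by (intro mult_mono) auto
    have "?h * norm (Z' a) \<le> norm (?h *\<^sub>R Z' a + Z a) + norm (Z a)"
      using norm_triangle_ineq4[of "?h *\<^sub>R Z' a + Z a" "Z a"] h by simp
    also have "\<dots> \<le> 1 / 2 * (?h * norm (Z' a)) + 1 / 2 * norm (Z a) + norm (Z a)"
      using 1 n1 n2 n4 n5 by (simp add: distrib_left)
    finally have "?h * norm (Z' a) \<le> 3 * norm (Z a)" by simp
    then have "(C * ?h) * (?h * norm (Z' a)) \<le> (C * ?h) * (3 * norm (Z a))"
      using h C(1) by (intro mult_left_mono) auto
    moreover have "(C * ?h) * (?h * norm (Z a)) \<le> (C * ?h) * norm (Z a)"
      using n3 h C(1) by (intro mult_left_mono) auto
    ultimately show ?thesis using 1 n1 n2 by (simp add: distrib_left)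
  qed
  have solve: "\<exists>Z Z'. jac R Z Z' \<and> Z a = x \<and> Z b = y"
    if ab: "0 \<le> a" "a < b" "b \<le> 1" "b - a < \<delta>" for a b x y
  proof -
    have a: "a \<in> {0..1}" and b: "b \<in> {0..1}" using ab by auto
    let ?L = "\<lambda>z. (fl z a, fl z b)"
    have lin: "linear ?L"
      using linear_fl(1)[OF a] linear_fl(1)[OF b] 
      unfolding linear_conv_bounded_linear by (rule bounded_linear_Pair)
    have "inj ?L" unfolding linear_injective_0[OF lin]
    proof (intro allI impI)
      fix z assume "(fl z a, fl z b) = 0"
      then have z: "fl z a = 0" "fl z b = 0" by (auto simp: zero_prod_def)
      have "norm ((b - a) *\<^sub>R fl' z a + fl z a) \<le> (4 * C) * (b - a) * norm (fl z a)"
        using est[OF ab fl(1) z(2)] .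
      then have "(b - a) * norm (fl' z a) \<le> 0" using z ab by simp
      then have "fl' z a = 0" using ab(2) by (simp add: mult_le_0_iff)
      then have "fl z 0 = 0" "fl' z 0 = 0" using jac_zero[OF fl(1) a z(1), of 0] by auto
      then show "z = 0" by (simp add: fl prod_eq_iff)
    qed
    then have "surj ?L" by (rule linear_inj_imp_surj[OF lin])
    then obtain z where "(x, y) = ?L z" by (rule surjE)
    then show ?thesis using fl(1)[of z] by (intro exI[of _ "fl z"] exI[of _ "fl' z"]) simp
  qed
  have "0 < \<delta>" "0 < 4 * C" using C(1) by (auto simp: \<delta>_def)
  then show ?thesis
    by (intro exI[of _ \<delta>] exI[of _ "4 * C"] conjI allI impI) (assumption | rule est solve | simp)+
qed

end

lemma (in jacobi_ode) boundary_value_solvable: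
  "\<exists>\<delta>>0. \<forall>a b x y. 0 \<le> a \<longrightarrow> a < b \<longrightarrow> b \<le> 1 \<longrightarrow> b - a < \<delta> \<longrightarrow> (\<exists>Z Z'. jac R Z Z' \<and> Z a = x \<and> Z b = y)"
proof -
  obtain \<delta> C where d: "\<delta> > 0" and "C > 0" and *: "\<forall>a b. 0 \<le> a \<longrightarrow> a < b \<longrightarrow> b \<le> 1 \<longrightarrow> b - a < \<delta> \<longrightarrow>
     (\<forall>Z Z'. jac R Z Z' \<longrightarrow> Z b = 0 \<longrightarrow> norm ((b - a) *\<^sub>R Z' a + Z a) \<le> C * (b - a) * norm (Z a)) \<and>
     (\<forall>x y. \<exists>Z Z'. jac R Z Z' \<and> Z a = x \<and> Z b = y)"
    using boundary_value_problem by (elim exE conjE) (rule that)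
  show ?thesis
    by (intro exI[of _ \<delta>] conjI d allI impI, rule *[rule_format, THEN conjunct2, rule_format])
qed

section \<open>Nondegenerate symmetric forms\<close>

locale sym_form =
  fixes g :: "'a::euclidean_space \<Rightarrow> 'a \<Rightarrow> real"
  assumes g_bilinear: "bilinear g" and g_sym: "g x y = g y x"
begin

sublocale bb: bounded_bilinear g
  using g_bilinear by (simp add: bilinear_conv_bounded_bilinear)

sublocale form_on UNIV g
  by unfold_locales (simp add: bb.add_left bb.scaleR_left | rule g_sym)+

sublocale neg: form_on UNIV "\<lambda>x y. - g x y"
  by unfold_locales (simp add: bb.add_left bb.scaleR_left | subst g_sym, rule refl)+

lemmas g_simps = bb.add_left bb.add_right bb.diff_left bb.diff_right bb.scaleR_left bb.scaleR_right
  bb.minus_left bb.minus_right bb.zero_left bb.zero_right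

lemma g_bound: "\<exists>K>0. \<forall>x y. \<bar>g x y\<bar> \<le> K * norm x * norm y"
  using bb.pos_bounded by (auto simp: mult_ac)

lemma neg_fam_bounded: "neg_fam g W k V \<Longrightarrow> k \<le> DIM('a)"
proof (rule ccontr)
  assume V: "neg_fam g W k V" and "\<not> k \<le> DIM('a)"
  then have *: "DIM('a) < k" by simp
  obtain h :: "nat \<Rightarrow> 'a" where h: "bij_betw h {0..<DIM('a)} Basis"
    using ex_bij_betw_nat_finite[OF finite_Basis] by blast
  obtain c where c: "\<exists>i<k. c i \<noteq> 0" "\<forall>j<DIM('a). (\<Sum>i<k. c i * (V i \<bullet> h j)) = 0"
    using underdetermined_system[OF *, of "\<lambda>i j. V i \<bullet> h j"] by blast
  have *: "(\<Sum>i<k. c i *\<^sub>R V i) \<bullet> b = 0" if "b \<in> Basis" for b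
  proof -
    have "b \<in> h ` {0..<DIM('a)}" using h \<open>b \<in> Basis\<close> by (simp add: bij_betw_def)
    then obtain j where "j < DIM('a)" "b = h j" by auto
    then show ?thesis using c by (simp add: inner_sum_left)
  qed
  have "(\<Sum>i<k. c i *\<^sub>R V i) = 0"
    by (rule euclidean_eqI) (simp only: * inner_zero_left)
  moreover have "g (\<Sum>i<k. c i *\<^sub>R V i) (\<Sum>i<k. c i *\<^sub>R V i) < 0"
    using V c(1) unfolding neg_fam_def by blast
  ultimately show False by (simp add: bb.zero_left)
qed

lemma has_index_exists: "subspace W \<Longrightarrow> \<exists>k. has_index g W k"
  using has_index_bounded[of W "DIM('a)"] neg_fam_bounded by auto

lemma sym_form_uminus: "sym_form (\<lambda>x y. - g x y)"
proof
  show "bilinear (\<lambda>x y. - g x y)"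
    using g_bilinear by (auto simp: bilinear_def intro: linear_compose_neg)
  show "- g x y = - g y x" for x y by (subst g_sym) (rule refl)
qed

text \<open>A Sylvester basis: \<open>k\<close> negative unit vectors, then \<open>l\<close>
  positive ones. Spanning is expressed by the expansion in dual coordinates, so the coefficients are
  explicit and can be estimated.\<close>

definition sig_basis :: "'a set \<Rightarrow> nat \<Rightarrow> nat \<Rightarrow> (nat \<Rightarrow> 'a) \<Rightarrow> bool" where
  "sig_basis C k l u \<longleftrightarrow> (\<forall>i<k+l. u i \<in> C) \<and>
     (\<forall>i<k+l. \<forall>j<k+l. g (u i) (u j) = (if i = j then (if i < k then - 1 else 1) else 0)) \<and>
     (\<forall>x\<in>C. x = (\<Sum>i<k+l. ((if i < k then - 1 else 1) * g x (u i)) *\<^sub>R u i))"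

lemma semidefinite_radical:
  assumes T: "subspace T" "\<And>t. t \<in> T \<Longrightarrow> 0 \<le> g t t" and r: "r \<in> T" "g r r = 0" and t: "t \<in> T"
  shows "g r t = 0"
proof (rule ccontr)
  assume n: "g r t \<noteq> 0"
  \<comment> \<open>The value of the form at \<open>t + a *\<^sub>R r\<close> is affine in
    \<open>a\<close>; this choice makes it -1.\<close>
  define a where "a = - (g t t + 1) / (2 * g r t)"
  have "t + a *\<^sub>R r \<in> T" using T r t by (simp add: subspace_add subspace_mul)
  then have "0 \<le> g (t + a *\<^sub>R r) (t + a *\<^sub>R r)" using T by blast
  also have "\<dots> = g t t + 2 * a * g r t" using r g_sym[of t r] by (simp add: g_simps algebra_simps)
  also have "2 * a * g r t = - (g t t + 1)" using n by (simp add: a_def)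
  finally show False by simp
qed

text \<open>Certificates for g on \<open>C\<close>, and then for - g on the complement
  \<open>T\<close> of the negative part, give the two halves. What is orthogonal to both is
  isotropic in the semidefinite space \<open>T\<close>, hence in the radical of \<open>C\<close>,
  which is zero.\<close>

lemma sig_basis_exists:
  assumes C: "subspace C" "nondeg_on g C"
  obtains k l u where "sig_basis C k l u" "has_index g C k" "has_index (\<lambda>x y. - g x y) C l"
proof -
  obtain k where k: "has_index g C k" using has_index_exists C by blast
  then obtain F where F: "\<forall>i<k. F i \<in> C" "\<forall>i<k. \<forall>j<k. g (F i) (F j) = (if i = j then - 1 else 0)"
    "\<forall>v\<in>C. (\<forall>i<k. g v (F i) = 0) \<longrightarrow> 0 \<le> g v v"
    unfolding has_index_def by blast
  define T where "T = {v\<in>C. \<forall>i\<in>{..<k}. g v (F i) = 0}"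
  have subT: "subspace T" unfolding T_def using C by (intro subspace_orthogonal_complement) auto
  interpret m: sym_form "\<lambda>x y. - g x y" by (rule sym_form_uminus)
  obtain l where "has_index (\<lambda>x y. - g x y) T l" using m.has_index_exists subT by blast
  then obtain G where G: "\<forall>i<l. G i \<in> T" "\<forall>i<l. \<forall>j<l. - g (G i) (G j) = (if i = j then - 1 else 0)"
    "\<forall>v\<in>T. (\<forall>i<l. - g v (G i) = 0) \<longrightarrow> 0 \<le> - g v v"
    unfolding has_index_def by blast
  define u where "u i = (if i < k then F i else G (i - k))" for i
  have GT: "G i \<in> C" "g (G i) (F j) = 0" "g (F j) (G i) = 0" if "i < l" "j < k" for i j
    using G(1) that g_sym unfolding T_def by auto
  have uC: "u i \<in> C" if "i < k + l" for i using F(1) G(1) that by (auto simp: u_def T_def)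
  have uu: "g (u i) (u j) = (if i = j then (if i < k then - 1 else 1) else 0)" if "i < k + l" "j < k + l" for i j
  proof -
    have "g (G i) (G j) = (if i = j then 1 else 0)" if "i < l" "j < l" for i j
      using G(2) that by (metis minus_equation_iff neg_equal_0_iff_equal)
    moreover have "i - k = j - k \<longleftrightarrow> i = j" if "i \<ge> k" "j \<ge> k" using that by auto
    moreover have "i - k < l" if "i \<ge> k" using that \<open>i < k + l\<close> by simp
    moreover have "j - k < l" if "j \<ge> k" using that \<open>j < k + l\<close> by simp
    ultimately show ?thesis
      using F(2) GT by (cases "i < k"; cases "j < k") (auto simp: u_def)
  qed
  have expand: "x = (\<Sum>i<k+l. ((if i < k then - 1 else 1) * g x (u i)) *\<^sub>R u i)" if x: "x \<in> C" for x
  proof -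
    let ?s = "\<Sum>i<k+l. ((if i < k then - 1 else 1) * g x (u i)) *\<^sub>R u i"
    define r where "r = x - ?s"
    have "?s \<in> C" using C uC by (intro subspace_sum subspace_mul) auto
    then have rC: "r \<in> C" using x C by (simp add: r_def subspace_diff)
    have ru: "g r (u j) = 0" if "j < k + l" for j
    proof -
      have "g ?s (u j) = (\<Sum>i<k+l. ((if i < k then - 1 else 1) * g x (u i)) * g (u i) (u j))"
        by (rule form_sum) auto
      also have "\<dots> = (\<Sum>i<k+l. if i = j then g x (u j) else 0)"
        using uu that by (intro sum.cong) auto
      finally show ?thesis using that by (simp add: r_def g_simps)
    qed
    have rF: "g r (F i) = 0" if "i < k" for i using ru[of i] that by (simp add: u_def)
    have rT: "r \<in> T" using rC rF by (simp add: T_def)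
    have "g r (G i) = 0" if "i < l" for i using ru[of "i + k"] that by (simp add: u_def)
    then have "g r r = 0" using G(3) F(3) rT unfolding T_def by force
    have rad: "g r t = 0" if "t \<in> T" for t
      by (rule semidefinite_radical[OF subT _ rT \<open>g r r = 0\<close> that]) (use F(3) in \<open>auto simp: T_def\<close>)
    have "g r y = 0" if y: "y \<in> C" for y
    proof -
      define f where "f = (\<Sum>i<k. (- g y (F i)) *\<^sub>R F i)"
      have "f \<in> C" using C F(1) unfolding f_def by (intro subspace_sum subspace_mul) auto
      have "g f (F j) = g y (F j)" if "j < k" for j
      proof -
        have "g f (F j) = (\<Sum>i<k. (- g y (F i)) * g (F i) (F j))"
          unfolding f_def by (rule form_sum) auto
        also have "\<dots> = (\<Sum>i<k. if i = j then g y (F j) else 0)"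
          using F(2) that by (intro sum.cong) auto
        finally show ?thesis using that by simp
      qed
      then have "y - f \<in> T" using y \<open>f \<in> C\<close> C by (auto simp: T_def subspace_diff g_simps)
      then have "g r (y - f) = 0" by (rule rad)
      moreover have "g r f = (\<Sum>i<k. (- g y (F i)) * g r (F i))"
        unfolding f_def by (rule form_sum_right) auto
      moreover have "\<dots> = 0" using rF by (intro sum.neutral) auto
      ultimately show ?thesis by (simp add: g_simps)
    qed
    then have "r = 0" using C(2) rC unfolding nondeg_on_def by blast
    then show ?thesis by (simp add: r_def)
  qed
  have "has_index (\<lambda>x y. - g x y) C l"
    unfolding has_index_def
  proof (intro exI[of _ G] conjI ballI impI)
    fix v assume v: "v \<in> C" "\<forall>i<l. - g v (G i) = 0"
    have vu: "g v (u i) = 0" if "i < k + l" "\<not> i < k" for i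
      using v(2) that by (auto simp: u_def)
    have "g v v = (\<Sum>i<k+l. ((if i < k then - 1 else 1) * g v (u i)) * g v (u i))"
      using form_sum_right[of "{..<k+l}" u v "\<lambda>i. (if i < k then - 1 else 1) * g v (u i)"] expand[OF v(1)] by simp
    also have "\<dots> \<le> 0"
    proof (rule sum_nonpos)
      fix i assume "i \<in> {..<k+l}"
      then show "((if i < k then - 1 else 1) * g v (u i)) * g v (u i) \<le> 0"
        using vu[of i] by auto
    qed
    finally show "0 \<le> - g v v" by simp
  qed (use G(1,2) in \<open>auto simp: T_def\<close>)
  moreover have "sig_basis C k l u" unfolding sig_basis_def using uC uu expand by blast
  ultimately show thesis using that k by blast
qed

lemma subspace_gorth: "subspace (gorth g W)"
  by (auto simp: subspace_def gorth_def g_simps)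

lemma sig_basis_projection:
  assumes "sig_basis C k l u" "subspace C"
  defines "p \<equiv> \<lambda>v. \<Sum>i<k+l. ((if i < k then - 1 else 1) * g v (u i)) *\<^sub>R u i"
  shows "p v \<in> C" "v - p v \<in> gorth g C"
proof -
  have u: "\<And>i. i < k + l \<Longrightarrow> u i \<in> C"
    "\<And>i j. i < k + l \<Longrightarrow> j < k + l \<Longrightarrow> g (u i) (u j) = (if i = j then (if i < k then - 1 else 1) else 0)"
    "\<And>x. x \<in> C \<Longrightarrow> x = (\<Sum>i<k+l. ((if i < k then - 1 else 1) * g x (u i)) *\<^sub>R u i)"
    using assms(1) unfolding sig_basis_def by auto
  show "p v \<in> C" unfolding p_def using assms(2) u(1) by (intro subspace_sum subspace_mul) auto
  have *: "g (v - p v) (u j) = 0" if "j < k + l" for j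
  proof -
    have "g (p v) (u j) = (\<Sum>i<k+l. ((if i < k then - 1 else 1) * g v (u i)) * g (u i) (u j))"
      unfolding p_def by (rule form_sum) auto
    also have "\<dots> = (\<Sum>i<k+l. if i = j then g v (u j) else 0)"
      using u(2) that by (intro sum.cong) auto
    finally show ?thesis using that by (simp add: g_simps)
  qed
  show "v - p v \<in> gorth g C" unfolding gorth_def
  proof (intro CollectI ballI)
    fix w assume w: "w \<in> C"
    have "g (v - p v) w = (\<Sum>i<k+l. ((if i < k then - 1 else 1) * g w (u i)) * g (v - p v) (u i))"
      by (subst u(3)[OF w], rule form_sum_right) auto
    also have "\<dots> = 0" using * by (intro sum.neutral) auto
    finally show "g (v - p v) w = 0" .
  qed
qed

lemma orthogonal_splitting:
  assumes "subspace C" "nondeg_on g C"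
  shows "\<exists>c\<in>C. v - c \<in> gorth g C"
proof -
  obtain k l u where "sig_basis C k l u" using sig_basis_exists[OF assms] .
  then show ?thesis using sig_basis_projection[of C k l u v] assms by blast
qed

end

locale nondeg_sym_form = sym_form +
  assumes g_nondeg: "nondeg_on g UNIV"
begin

text \<open>A vector of the double complement minus its component in \<open>C\<close> is orthogonal
  to \<open>C\<close> and to its complement, hence to everything, and so vanishes.\<close>

lemma gorth_gorth:
  assumes C: "subspace C" "nondeg_on g C"
  shows "gorth g (gorth g C) = C"
proof
  show "C \<subseteq> gorth g (gorth g C)" by (auto simp: gorth_def g_sym)
  show "gorth g (gorth g C) \<subseteq> C"
  proof
    fix v assume v: "v \<in> gorth g (gorth g C)"
    obtain c where c: "c \<in> C" "v - c \<in> gorth g C" using orthogonal_splitting[OF C] by blast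
    have "g (v - c) w = 0" for w
    proof -
      obtain d where d: "d \<in> C" "w - d \<in> gorth g C" using orthogonal_splitting[OF C] by blast
      have "g (v - c) d = 0" using c d by (auto simp: gorth_def)
      moreover have "g v (w - d) = 0" using v d by (auto simp: gorth_def)
      moreover have "g c (w - d) = 0" using c d g_sym by (auto simp: gorth_def)
      ultimately show ?thesis by (simp add: g_simps)
    qed
    then have "v - c = 0" using g_nondeg unfolding nondeg_on_def by blast
    then show "v \<in> C" using c by simp
  qed
qed

lemma nondeg_on_gorth:
  assumes C: "subspace C" "nondeg_on g C"
  shows "nondeg_on g (gorth g C)"
  unfolding nondeg_on_def
proof (intro ballI impI)
  fix x assume x: "x \<in> gorth g C" "\<forall>y\<in>gorth g C. g x y = 0"
  then have "x \<in> C" using gorth_gorth[OF C] by (auto simp: gorth_def)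
  moreover have "\<forall>y\<in>C. g x y = 0" using x by (auto simp: gorth_def)
  ultimately show "x = 0" using C(2) unfolding nondeg_on_def by blast
qed

lemma gorth_UNIV: "gorth g UNIV = {0}"
  using g_nondeg by (auto simp: gorth_def nondeg_on_def g_simps)

text \<open>For \<open>n\<close> = 1 this is the identity k + nu = 1 that converts an index on the
  values of the fields J into one on their orthogonal complement.\<close>

lemma index_complement:
  assumes C: "subspace C" "nondeg_on g C" and k: "has_index g C k" and m: "has_index g (gorth g C) m"
    and n: "has_index g UNIV n"
  shows "k + m = n"
proof -
  have "has_index g UNIV (k + m)"
  proof (rule has_index_orthogonal_sum[OF k m])
    show "g u v = 0" if "u \<in> C" "v \<in> gorth g C" for u v using that g_sym by (auto simp: gorth_def)
    show "\<exists>u\<in>C. \<exists>v\<in>gorth g C. w = u + v" for w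
    proof -
      obtain c where "c \<in> C" "w - c \<in> gorth g C" using orthogonal_splitting[OF C] by blast
      then show ?thesis by (intro bexI[of _ c] bexI[of _ "w - c"]) auto
    qed
  qed auto
  then show ?thesis using has_index_unique[OF _ n] by auto
qed

end

section \<open>Sobolev functions on the unit interval\<close>

definition L2 :: "(real \<Rightarrow> 'a::euclidean_space) \<Rightarrow> bool" where
  "L2 W \<longleftrightarrow> W absolutely_integrable_on {0..1} \<and> (\<lambda>s. (norm (W s))\<^sup>2) integrable_on {0..1}"

lemma L2_measurable: "L2 W \<Longrightarrow> W \<in> borel_measurable (lebesgue_on {0..1})"
  unfolding L2_def using integrable_imp_measurable set_lebesgue_integral_eq_integral(1) by blast

lemma L2_imp_integrable: "L2 W \<Longrightarrow> W integrable_on {0..1}"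
  unfolding L2_def using set_lebesgue_integral_eq_integral(1) by blast

lemma L2_norm_integrable: "L2 W \<Longrightarrow> (\<lambda>s. norm (W s)) integrable_on {0..1}"
  unfolding L2_def using absolutely_integrable_on_def by blast

lemma L2_prod:
  fixes h :: "'a::euclidean_space \<Rightarrow> 'b::euclidean_space \<Rightarrow> 'c::euclidean_space"
  assumes h: "bounded_bilinear h" and V: "L2 V" and W: "L2 W"
  shows "(\<lambda>s. h (V s) (W s)) absolutely_integrable_on {0..1}"
proof -
  obtain K where K: "K > 0" "\<And>a b. norm (h a b) \<le> norm a * norm b * K"
    using bounded_bilinear.pos_bounded[OF h] by blast
  show ?thesis
  proof (rule measurable_bounded_by_integrable_imp_absolutely_integrable)
    have "continuous_on UNIV (\<lambda>x. h (fst x) (snd x))"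
      by (intro bounded_bilinear.continuous_on[OF h] continuous_intros)
    then show "(\<lambda>s. h (V s) (W s)) \<in> borel_measurable (lebesgue_on {0..1})"
      by (rule borel_measurable_continuous_Pair[OF L2_measurable[OF V] L2_measurable[OF W]])
    show "(\<lambda>s. K * ((norm (V s))\<^sup>2 + (norm (W s))\<^sup>2)) integrable_on {0..1}"
    proof -
      have 1: "(\<lambda>s. (norm (V s))\<^sup>2) integrable_on {0..1}" and 2: "(\<lambda>s. (norm (W s))\<^sup>2) integrable_on {0..1}"
        using V W unfolding L2_def by auto
      show ?thesis by (rule integrable_on_mult_right[OF integrable_add[OF 1 2]])
    qed
    fix s :: real
    have "2 * (norm (V s) * norm (W s)) \<le> (norm (V s))\<^sup>2 + (norm (W s))\<^sup>2"
      using sum_squares_bound[of "norm (V s)" "norm (W s)"] by simp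
    moreover have "0 \<le> norm (V s) * norm (W s)" by simp
    ultimately have "norm (V s) * norm (W s) \<le> (norm (V s))\<^sup>2 + (norm (W s))\<^sup>2" by linarith
    then have "norm (V s) * norm (W s) * K \<le> K * ((norm (V s))\<^sup>2 + (norm (W s))\<^sup>2)"
      using K(1) by (simp add: mult.commute)
    then show "norm (h (V s) (W s)) \<le> K * ((norm (V s))\<^sup>2 + (norm (W s))\<^sup>2)"
      using K(2)[of "V s" "W s"] by linarith
  qed simp
qed

lemma L2_prod_integrable:
  fixes h :: "'a::euclidean_space \<Rightarrow> 'b::euclidean_space \<Rightarrow> 'c::euclidean_space"
  assumes "bounded_bilinear h" "L2 V" "L2 W"
  shows "(\<lambda>s. h (V s) (W s)) integrable_on {0..1}"
  using L2_prod[OF assms] set_lebesgue_integral_eq_integral(1) by blast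

lemma L2_lin:
  assumes V: "L2 V" and W: "L2 W"
  shows "L2 (\<lambda>s. a *\<^sub>R V s + b *\<^sub>R W s)"
  unfolding L2_def
proof
  show "(\<lambda>s. a *\<^sub>R V s + b *\<^sub>R W s) absolutely_integrable_on {0..1}"
    using V W unfolding L2_def by (intro set_integral_add absolutely_integrable_scaleR_left) auto
  note p = L2_prod_integrable[OF bounded_bilinear_inner]
  have "(\<lambda>s. a\<^sup>2 * (V s \<bullet> V s) + (2 * a * b * (V s \<bullet> W s) + b\<^sup>2 * (W s \<bullet> W s))) integrable_on {0..1}"
    by (intro integrable_add integrable_on_mult_right p V W)
  moreover have "(norm (a *\<^sub>R V s + b *\<^sub>R W s))\<^sup>2 =
      a\<^sup>2 * (V s \<bullet> V s) + (2 * a * b * (V s \<bullet> W s) + b\<^sup>2 * (W s \<bullet> W s))" for s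
  proof -
    have c: "W s \<bullet> V s = V s \<bullet> W s" by (rule inner_commute)
    show ?thesis
      unfolding power2_norm_eq_inner inner_add_left inner_add_right inner_scaleR_left inner_scaleR_right c
      by (simp add: power2_eq_square distrib_left mult_ac)
  qed
  ultimately show "(\<lambda>s. (norm (a *\<^sub>R V s + b *\<^sub>R W s))\<^sup>2) integrable_on {0..1}" by simp
qed

lemma L2_continuous: "continuous_on {0..1} W \<Longrightarrow> L2 W"
  unfolding L2_def
  by (intro conjI absolutely_integrable_continuous_real integrable_continuous_real continuous_intros)

lemma L2_cut:
  assumes W: "L2 W"
  shows "L2 (\<lambda>s. if s \<le> a then W s else 0)"
  unfolding L2_def
proof
  have m: "(\<lambda>s. if s \<le> a then W s else 0) \<in> borel_measurable (lebesgue_on {0..1})"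
  proof (rule measurable_If[OF L2_measurable[OF W]])
    have "{s \<in> space (lebesgue_on {0..1}). s \<le> a} = {0..1} \<inter> {..a}" by auto
    then show "{s \<in> space (lebesgue_on {0..1}). s \<le> a} \<in> sets (lebesgue_on {0..1})"
      by (auto simp: sets_restrict_space)
  qed simp
  show "(\<lambda>s. if s \<le> a then W s else 0) absolutely_integrable_on {0..1}"
    by (rule measurable_bounded_by_integrable_imp_absolutely_integrable[OF m _ L2_norm_integrable[OF W]]) auto
  have "(\<lambda>s. norm (if s \<le> a then W s else 0) ^ 2) absolutely_integrable_on {0..1}"
  proof (rule measurable_bounded_by_integrable_imp_absolutely_integrable)
    show "(\<lambda>s. norm (if s \<le> a then W s else 0) ^ 2) \<in> borel_measurable (lebesgue_on {0..1})"
      using m by measurable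
    show "(\<lambda>s. norm (W s) ^ 2) integrable_on {0..1}" using W unfolding L2_def by blast
  qed auto
  then show "(\<lambda>s. (norm (if s \<le> a then W s else 0))\<^sup>2) integrable_on {0..1}"
    using set_lebesgue_integral_eq_integral(1) by blast
qed

text \<open>W is the weak derivative of V on the unit interval; values of V and W outside it play no role.\<close>

definition wd :: "(real \<Rightarrow> 'a::euclidean_space) \<Rightarrow> (real \<Rightarrow> 'a) \<Rightarrow> bool" where
  "wd V W \<longleftrightarrow> L2 W \<and> (\<forall>t\<in>{0..1}. (W has_integral (V t - V 0)) {0..t})"

lemma H1_iff: "V \<in> H1 \<longleftrightarrow> (\<exists>W. wd V W)"
  unfolding H1_def wd_def L2_def by blast

lemma wd_lin:
  assumes "wd V W" "wd V' W'"
  shows "wd (\<lambda>t. a *\<^sub>R V t + b *\<^sub>R V' t) (\<lambda>t. a *\<^sub>R W t + b *\<^sub>R W' t)"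
  unfolding wd_def
proof (intro conjI ballI)
  show "L2 (\<lambda>t. a *\<^sub>R W t + b *\<^sub>R W' t)" using assms L2_lin unfolding wd_def by blast
  fix t :: real assume t: "t \<in> {0..1}"
  have "((\<lambda>t. a *\<^sub>R W t + b *\<^sub>R W' t) has_integral (a *\<^sub>R (V t - V 0) + b *\<^sub>R (V' t - V' 0))) {0..t}"
    using assms t unfolding wd_def by (intro has_integral_add has_integral_cmul) auto
  then show "((\<lambda>t. a *\<^sub>R W t + b *\<^sub>R W' t) has_integral (a *\<^sub>R V t + b *\<^sub>R V' t - (a *\<^sub>R V 0 + b *\<^sub>R V' 0))) {0..t}"
    by (simp add: algebra_simps)
qed

lemma wd_cong:
  assumes "wd V W" "\<And>t. t \<in> {0..1} \<Longrightarrow> V' t = V t" "\<And>t. t \<in> {0..1} \<Longrightarrow> W' t = W t"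
  shows "wd V' W'"
proof -
  have "(W' has_integral x) {0..t} \<longleftrightarrow> (W has_integral x) {0..t}" if "t \<in> {0..1}" for x t
    using assms(3) that by (intro has_integral_cong) auto
  moreover have "W' absolutely_integrable_on {0..1}"
    using assms(1,3) unfolding wd_def L2_def by (metis (no_types, lifting) set_integrable_cong)
  moreover have "(\<lambda>s. (norm (W' s))\<^sup>2) integrable_on {0..1}"
    using assms(1,3) unfolding wd_def L2_def by (metis (no_types, lifting) integrable_cong)
  ultimately show ?thesis using assms unfolding wd_def L2_def by auto
qed

lemma wd_C1:
  assumes "\<And>t. t \<in> {0..1} \<Longrightarrow> (V has_vector_derivative W t) (at t within {0..1})" "continuous_on {0..1} W"
  shows "wd V W"
  unfolding wd_def
proof (intro conjI ballI L2_continuous assms(2))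
  fix t :: real assume t: "t \<in> {0..1}"
  show "(W has_integral (V t - V 0)) {0..t}"
  proof (rule fundamental_theorem_of_calculus)
    show "(V has_vector_derivative W x) (at x within {0..t})" if "x \<in> {0..t}" for x
      using assms(1)[of x] that t by (auto intro: has_vector_derivative_within_subset)
  qed (use t in auto)
qed

lemma wd_interval:
  assumes V: "wd V W" and pq: "0 \<le> p" "p \<le> q" "q \<le> 1"
  shows "(W has_integral (V q - V p)) {p..q}"
proof -
  have W: "W integrable_on {0..1}" using V L2_imp_integrable unfolding wd_def by blast
  have "integral {0..p} W = V p - V 0" "integral {0..q} W = V q - V 0"
    using V pq unfolding wd_def by (auto intro!: integral_unique)
  then have "integral {p..q} W = V q - V p"
    using indefinite_integral_diff[OF W, of p q] pq by auto
  moreover have "W integrable_on {p..q}" using integrable_subinterval_real[OF W] pq by auto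
  ultimately show ?thesis by (metis integrable_integral)
qed

lemma wd_continuous:
  assumes V: "wd V W" shows "continuous_on {0..1} V"
proof -
  have W: "W integrable_on {0..1}" using V L2_imp_integrable unfolding wd_def by blast
  have "continuous_on {0..1} (\<lambda>t. V 0 + integral {0..t} W)"
    by (intro continuous_intros indefinite_integral_continuous_1 W)
  moreover have "V t = V 0 + integral {0..t} W" if "t \<in> {0..1}" for t
  proof -
    have "integral {0..t} W = V t - V 0" using V that unfolding wd_def by (blast intro: integral_unique)
    then show ?thesis by simp
  qed
  ultimately show ?thesis by (metis (no_types, lifting) continuous_on_cong)
qed

text \<open>Because V a = 0, cutting creates no jump and the truncated derivative is still the weak
  derivative.\<close>

lemma wd_cut:
  assumes V: "wd V W" and a: "0 \<le> a" "a \<le> 1" "V a = 0"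
  shows "wd (\<lambda>t. if t \<le> a then V t else 0) (\<lambda>t. if t \<le> a then W t else 0)"
  unfolding wd_def
proof (intro conjI ballI)
  show "L2 (\<lambda>t. if t \<le> a then W t else 0)" using V L2_cut unfolding wd_def by blast
  fix t :: real assume t: "t \<in> {0..1}"
  show "((\<lambda>t. if t \<le> a then W t else 0) has_integral (if t \<le> a then V t else 0) - (if 0 \<le> a then V 0 else 0)) {0..t}"
  proof (cases "t \<le> a")
    case True
    have "((\<lambda>t. if t \<le> a then W t else 0) has_integral (V t - V 0)) {0..t} \<longleftrightarrow> (W has_integral (V t - V 0)) {0..t}"
      using True by (intro has_integral_cong) auto
    then show ?thesis using V t True a unfolding wd_def by auto
  next
    case False
    have "((\<lambda>t. if t \<le> a then W t else 0) has_integral (V a - V 0)) {0..a} \<longleftrightarrow> (W has_integral (V a - V 0)) {0..a}"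
      by (intro has_integral_cong) auto
    then have 1: "((\<lambda>t. if t \<le> a then W t else 0) has_integral (V a - V 0)) {0..a}"
      using V a unfolding wd_def by (metis atLeastAtMost_iff)
    have 2: "((\<lambda>t. if t \<le> a then W t else 0) has_integral 0) {a..t}"
      by (rule has_integral_spike[of "{a}" _ _ "\<lambda>_. 0"]) auto
    show ?thesis using has_integral_combine[OF _ _ 1 2] a t False by simp
  qed
qed

text \<open>\<open>I1\<close> and \<open>Kspace\<close> are written with the pointwise
  \<open>vector_derivative\<close>. The differentiation theorem identifies it with the weak
  derivative off a null set, after which representatives may be chosen freely.\<close>

lemma wd_ae:
  assumes V: "wd V W"
  shows "\<exists>N. negligible N \<and> (\<forall>s\<in>{0..1} - N. vector_derivative V (at s) = W s)"
proof -
  have W: "W integrable_on {0..1}" using V L2_imp_integrable unfolding wd_def by blast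
  obtain N where N: "negligible N"
    "\<And>x. x \<in> {0..1} - N \<Longrightarrow> ((\<lambda>t. integral {0..t} W) has_vector_derivative W x) (at x)"
    using indefinite_integral_has_vector_derivative_ae[OF W] by blast
  \<comment> \<open>The end points are excluded because \<open>V\<close> is arbitrary outside
    [0, 1].\<close>
  show ?thesis
  proof (intro exI[of _ "N \<union> {0, 1}"] conjI ballI)
    show "negligible (N \<union> {0, 1})" using N(1) by (intro negligible_Un) auto
    fix s :: real assume s: "s \<in> {0..1} - (N \<union> {0, 1})"
    then have s01: "s \<in> {0<..<1}" by auto
    have "((\<lambda>t. V 0 + integral {0..t} W) has_vector_derivative 0 + W s) (at s)"
      using N(2)[of s] s by (intro has_vector_derivative_add) auto
    then have "((\<lambda>t. V 0 + integral {0..t} W) has_vector_derivative W s) (at s)" by simp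
    then have "(V has_vector_derivative W s) (at s)"
    proof (rule has_vector_derivative_transform_within_open[OF _ _ s01])
      show "V 0 + integral {0..t} W = V t" if "t \<in> {0<..<1}" for t
      proof -
        have "t \<in> {0..1}" using that by auto
        then have "integral {0..t} W = V t - V 0" using V unfolding wd_def by (blast intro: integral_unique)
        then show ?thesis by simp
      qed
    qed simp
    then show "vector_derivative V (at s) = W s" by (rule vector_derivative_at)
  qed
qed

lemma wd_unique_ae:
  assumes "wd V W" "wd V W'"
  shows "\<exists>N. negligible N \<and> (\<forall>s\<in>{0..1} - N. W' s = W s)"
proof -
  obtain N where "negligible N" "\<forall>s\<in>{0..1} - N. vector_derivative V (at s) = W s" using wd_ae[OF assms(1)] by blast
  moreover obtain N' where "negligible N'" "\<forall>s\<in>{0..1} - N'. vector_derivative V (at s) = W' s" using wd_ae[OF assms(2)] by blast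
  ultimately show ?thesis by (intro exI[of _ "N \<union> N'"]) (metis DiffD1 DiffD2 DiffI UnCI negligible_Un)
qed

section \<open>Integration by parts against a continuously differentiable field\<close>

context sym_form
begin

text \<open>The difference G of the two sides, as a function of the endpoint, changes over [u, v] by at most
  a constant times (v - u) times the integral of the norm of W over [u, v]. Hence its derivative
  vanishes everywhere, although W is only integrable.\<close>

lemma wd_by_parts:
  assumes V: "wd V W"
    and \<phi>: "\<And>t. t \<in> {0..1} \<Longrightarrow> (\<phi> has_vector_derivative \<phi>' t) (at t within {0..1})" "continuous_on {0..1} \<phi>'"
    and pq: "0 \<le> p" "p \<le> q" "q \<le> 1"
  shows "((\<lambda>s. g (W s) (\<phi> s) + g (V s) (\<phi>' s)) has_integral (g (V q) (\<phi> q) - g (V p) (\<phi> p))) {p..q}"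
proof -
  define k where "k s = g (W s) (\<phi> s) + g (V s) (\<phi>' s)" for s
  have \<phi>w: "wd \<phi> \<phi>'" by (rule wd_C1) (use \<phi> in auto)
  have cV: "continuous_on {0..1} V" and c\<phi>: "continuous_on {0..1} \<phi>" using wd_continuous V \<phi>w by auto
  have LW: "L2 W" using V unfolding wd_def by blast
  have k_int: "k integrable_on {0..1}" unfolding k_def
    by (intro integrable_add L2_prod_integrable[OF bb.bounded_bilinear_axioms] LW L2_continuous cV c\<phi> \<phi>(2))
  define G where "G t = integral {0..t} k - g (V t) (\<phi> t)" for t
  have nW: "(\<lambda>s. norm (W s)) integrable_on {0..1}" by (rule L2_norm_integrable[OF LW])
  have "compact (\<phi>' ` {0..1})" using \<phi>(2) by (intro compact_continuous_image) auto
  then obtain L where L: "\<And>t. t \<in> {0..1} \<Longrightarrow> norm (\<phi>' t) \<le> L" "L > 0"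
    by (metis bounded_pos compact_imp_bounded image_eqI)
  obtain K where K: "K > 0" "\<And>x y. \<bar>g x y\<bar> \<le> K * norm x * norm y" using g_bound by blast
  define N where "N t = integral {0..t} (\<lambda>s. norm (W s))" for t
  have key: "\<bar>G v - G u\<bar> \<le> 2 * K * L * (v - u) * (N v - N u)" if uv: "0 \<le> u" "u \<le> v" "v \<le> 1" for u v
  proof -
    have Ndiff: "N v - N u = integral {u..v} (\<lambda>s. norm (W s))"
      unfolding N_def using indefinite_integral_diff[OF nW, of u v] uv by auto
    have nWuv: "(\<lambda>s. norm (W s)) integrable_on {u..v}" using integrable_subinterval_real[OF nW] uv by auto
    have Vd: "norm (V s - V u) \<le> N v - N u" if s: "s \<in> {u..v}" for s
    proof -
      have "norm (V s - V u) = norm (integral {u..s} W)"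
        using wd_interval[OF V, of u s] uv s by (auto simp: integral_unique)
      also have "\<dots> \<le> integral {u..s} (\<lambda>s. norm (W s))"
        using wd_interval[OF V, of u s] uv s integrable_subinterval_real[OF nW, of u s]
        by (intro integral_norm_bound_integral) auto
      also have "\<dots> \<le> integral {u..v} (\<lambda>s. norm (W s))"
        using uv s by (intro integral_subset_le integrable_subinterval_real[OF nW]) auto
      finally show ?thesis using Ndiff by simp
    qed
    have \<phi>d: "norm (\<phi> s - \<phi> v) \<le> L * (v - u)" if s: "s \<in> {u..v}" for s
    proof -
      have "norm (\<phi> v - \<phi> s) \<le> L * measure lborel (cbox s v)"
        using wd_interval[OF \<phi>w, of s v] uv s L by (intro has_integral_bound) auto
      also have "\<dots> \<le> L * (v - u)" using s L by (intro mult_left_mono) auto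
      finally show ?thesis by (simp add: norm_minus_commute)
    qed
    have i1: "((\<lambda>s. g (W s) (\<phi> v)) has_integral g (V v - V u) (\<phi> v)) {u..v}"
      using has_integral_linear[OF wd_interval[OF V uv] bb.bounded_linear_left[of "\<phi> v"]] by (simp add: o_def)
    have i2: "((\<lambda>s. g (V u) (\<phi>' s)) has_integral g (V u) (\<phi> v - \<phi> u)) {u..v}"
      using has_integral_linear[OF wd_interval[OF \<phi>w uv] bb.bounded_linear_right[of "V u"]] by (simp add: o_def)
    have i3: "(k has_integral integral {u..v} k) {u..v}"
      using integrable_subinterval_real[OF k_int] uv by (intro integrable_integral) auto
    \<comment> \<open>The subtracted integrals add up to the exact increment of g(V, \<phi>),
      written as g(V v - V u, \<phi> v) + g(V u, \<phi> v - \<phi> u). The integrand that remains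
      pairs differences over [u, v] with derivatives.\<close>
    have "((\<lambda>s. k s - (g (W s) (\<phi> v) + g (V u) (\<phi>' s))) has_integral
        integral {u..v} k - (g (V v - V u) (\<phi> v) + g (V u) (\<phi> v - \<phi> u))) {u..v}"
      by (intro has_integral_diff has_integral_add i1 i2 i3)
    moreover have "integral {u..v} k - (g (V v - V u) (\<phi> v) + g (V u) (\<phi> v - \<phi> u)) = G v - G u"
      using indefinite_integral_diff[OF k_int, of u v] uv by (simp add: G_def g_simps)
    moreover have "k s - (g (W s) (\<phi> v) + g (V u) (\<phi>' s)) = g (W s) (\<phi> s - \<phi> v) + g (V s - V u) (\<phi>' s)" for s
      by (simp add: k_def g_simps)
    ultimately have i4: "((\<lambda>s. g (W s) (\<phi> s - \<phi> v) + g (V s - V u) (\<phi>' s)) has_integral G v - G u) {u..v}"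
      by simp
    have i5: "((\<lambda>s. K * L * (v - u) * norm (W s) + K * L * (N v - N u)) has_integral
        K * L * (v - u) * (N v - N u) + (v - u) * (K * L * (N v - N u))) {u..v}"
      using integrable_integral[OF nWuv] Ndiff uv has_integral_const_real[of "K * L * (N v - N u)" u v]
      by (intro has_integral_add has_integral_mult_right) auto
    have "norm (integral {u..v} (\<lambda>s. g (W s) (\<phi> s - \<phi> v) + g (V s - V u) (\<phi>' s))) \<le>
        integral {u..v} (\<lambda>s. K * L * (v - u) * norm (W s) + K * L * (N v - N u))"
    proof (rule integral_norm_bound_integral[OF has_integral_integrable[OF i4] has_integral_integrable[OF i5]])
      fix s assume s: "s \<in> {u..v}"
      have "\<bar>g (W s) (\<phi> s - \<phi> v)\<bar> \<le> K * norm (W s) * norm (\<phi> s - \<phi> v)" by (rule K)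
      also have "\<dots> \<le> K * norm (W s) * (L * (v - u))" using \<phi>d[OF s] K by (intro mult_left_mono) auto
      finally have 1: "\<bar>g (W s) (\<phi> s - \<phi> v)\<bar> \<le> K * L * (v - u) * norm (W s)" by (simp add: mult_ac)
      have "\<bar>g (V s - V u) (\<phi>' s)\<bar> \<le> K * norm (V s - V u) * norm (\<phi>' s)" by (rule K)
      also have "\<dots> \<le> K * (N v - N u) * L"
      proof -
        have "0 \<le> N v - N u" using Vd[OF s] norm_ge_zero order_trans by blast
        then show ?thesis using Vd[OF s] L(1)[of s] s uv K(1) by (intro mult_mono) auto
      qed
      finally have 2: "\<bar>g (V s - V u) (\<phi>' s)\<bar> \<le> K * L * (N v - N u)" by (simp add: mult_ac)
      show "norm (g (W s) (\<phi> s - \<phi> v) + g (V s - V u) (\<phi>' s)) \<le> K * L * (v - u) * norm (W s) + K * L * (N v - N u)"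
        using 1 2 by simp
    qed
    then show ?thesis unfolding integral_unique[OF i4] integral_unique[OF i5] by (simp add: algebra_simps)
  qed
  have contN: "continuous_on {0..1} N" unfolding N_def by (rule indefinite_integral_continuous_1[OF nW])
  have "(G has_derivative (\<lambda>h. 0)) (at t within {0..1})" if t: "t \<in> {0..1}" for t
    unfolding has_derivative_within_alt
  proof (intro conjI allI impI)
    fix e :: real assume e: "0 < e"
    have "e / (2 * K * L) > 0" using e K L by simp
    then obtain d where d: "d > 0" "\<And>y. y \<in> {0..1} \<Longrightarrow> dist y t < d \<Longrightarrow> dist (N y) (N t) < e / (2 * K * L)"
      using contN t unfolding continuous_on_iff by blast
    show "\<exists>d>0. \<forall>y\<in>{0..1}. norm (y - t) < d \<longrightarrow> norm (G y - G t - 0) \<le> e * norm (y - t)"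
    proof (intro exI[of _ d] conjI ballI impI d(1))
      fix y assume y: "y \<in> {0..1}" "norm (y - t) < d"
      then have "\<bar>N y - N t\<bar> < e / (2 * K * L)" using d(2)[of y] by (simp add: dist_norm)
      then have small: "2 * K * L * \<bar>N y - N t\<bar> \<le> e" using K L by (simp add: field_simps)
      have "\<bar>G y - G t\<bar> \<le> 2 * K * L * \<bar>y - t\<bar> * \<bar>N y - N t\<bar>"
      proof (cases "t \<le> y")
        case True
        then have "\<bar>G y - G t\<bar> \<le> 2 * K * L * (y - t) * (N y - N t)" using key[of t y] t y by auto
        also have "\<dots> \<le> \<bar>2 * K * L * (y - t) * (N y - N t)\<bar>" by (rule abs_ge_self)
        also have "\<dots> = 2 * K * L * \<bar>y - t\<bar> * \<bar>N y - N t\<bar>" using K L by (simp add: abs_mult)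
        finally show ?thesis .
      next
        case False
        then have "\<bar>G t - G y\<bar> \<le> 2 * K * L * (t - y) * (N t - N y)" using key[of y t] t y by auto
        also have "\<dots> \<le> \<bar>2 * K * L * (t - y) * (N t - N y)\<bar>" by (rule abs_ge_self)
        also have "\<dots> = 2 * K * L * \<bar>y - t\<bar> * \<bar>N y - N t\<bar>"
          using K L by (simp add: abs_mult abs_minus_commute)
        finally show ?thesis by (simp add: abs_minus_commute)
      qed
      also have "\<dots> = (2 * K * L * \<bar>N y - N t\<bar>) * \<bar>y - t\<bar>" by (simp add: mult_ac)
      also have "\<dots> \<le> e * \<bar>y - t\<bar>" using small by (intro mult_right_mono) auto
      finally show "norm (G y - G t - 0) \<le> e * norm (y - t)" by simp
    qed
  qed simp
  then obtain c where c: "\<And>t. t \<in> {0..1} \<Longrightarrow> G t = c"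
    using has_derivative_zero_constant[of "{0..1}" G] by auto
  have "G q = G p" using c pq by auto
  then have "integral {p..q} k = g (V q) (\<phi> q) - g (V p) (\<phi> p)"
    using indefinite_integral_diff[OF k_int, of p q] pq by (auto simp: G_def)
  moreover have "k integrable_on {p..q}" using integrable_subinterval_real[OF k_int] pq by auto
  ultimately have "(k has_integral g (V q) (\<phi> q) - g (V p) (\<phi> p)) {p..q}" by (metis integrable_integral)
  then show ?thesis by (simp add: k_def[abs_def])
qed

end

definition glue :: "real \<Rightarrow> real \<Rightarrow> (real \<Rightarrow> 'a::real_vector) \<Rightarrow> (real \<Rightarrow> 'a) \<Rightarrow> real \<Rightarrow> 'a" where
  "glue a b A Z t = (if t \<le> a then A t else if t \<le> b then Z t else 0)"

text \<open>The glued field is A - Z cut off at a plus Z cut off at b, and both vanish where they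
  are cut.\<close>

lemma wd_glue:
  assumes A: "wd A A'" and Z: "wd Z Z'" and ab: "0 \<le> a" "a \<le> b" "b \<le> 1" and eq: "A a = Z a" "Z b = 0"
  shows "wd (glue a b A Z) (glue a b A' Z')"
proof -
  have "wd (\<lambda>t. 1 *\<^sub>R A t + (- 1) *\<^sub>R Z t) (\<lambda>t. 1 *\<^sub>R A' t + (- 1) *\<^sub>R Z' t)" by (rule wd_lin[OF A Z])
  then have "wd (\<lambda>t. if t \<le> a then 1 *\<^sub>R A t + (- 1) *\<^sub>R Z t else 0) (\<lambda>t. if t \<le> a then 1 *\<^sub>R A' t + (- 1) *\<^sub>R Z' t else 0)"
    using ab eq by (intro wd_cut) auto
  moreover have "wd (\<lambda>t. if t \<le> b then Z t else 0) (\<lambda>t. if t \<le> b then Z' t else 0)"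
    using ab eq Z by (intro wd_cut) auto
  ultimately have "wd (\<lambda>t. 1 *\<^sub>R (if t \<le> a then 1 *\<^sub>R A t + (- 1) *\<^sub>R Z t else 0) + 1 *\<^sub>R (if t \<le> b then Z t else 0))
     (\<lambda>t. 1 *\<^sub>R (if t \<le> a then 1 *\<^sub>R A' t + (- 1) *\<^sub>R Z' t else 0) + 1 *\<^sub>R (if t \<le> b then Z' t else 0))"
    by (rule wd_lin)
  then show ?thesis by (rule wd_cong) (use ab in \<open>auto simp: glue_def\<close>)
qed

section \<open>The index form\<close>

text \<open>With functions as a real vector space, the abstract index theory of
  \<open>form_on\<close> applies to fields directly.\<close>

instantiation "fun" :: (type, real_vector) real_vector
begin

definition scaleR_fun :: "real \<Rightarrow> ('a \<Rightarrow> 'b) \<Rightarrow> 'a \<Rightarrow> 'b" where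
  "scaleR_fun c f = (\<lambda>x. c *\<^sub>R f x)"

instance
  by standard (simp_all add: scaleR_fun_def fun_eq_iff scaleR_add_right scaleR_add_left)

end

lemma wd_add: "wd V W \<Longrightarrow> wd V' W' \<Longrightarrow> wd (V + V') (\<lambda>t. W t + W' t)"
  using wd_lin[of V W V' W' 1 1] by (simp add: plus_fun_def)

lemma wd_scale: "wd V W \<Longrightarrow> wd (c *\<^sub>R V) (\<lambda>t. c *\<^sub>R W t)"
  using wd_lin[of V W V W c 0] by (simp add: scaleR_fun_def)

lemma wd_zero: "wd 0 (\<lambda>t. 0)"
  by (rule wd_C1) (auto simp: zero_fun_def)

lemma wd_diff: "wd V W \<Longrightarrow> wd V' W' \<Longrightarrow> wd (V - V') (\<lambda>t. W t - W' t)"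
  using wd_lin[of V W V' W' 1 "-1"] by (simp add: fun_diff_def)

lemma wd_support:
  assumes V: "wd V W" and ab: "0 \<le> a" "a \<le> b" "b \<le> 1"
    and z: "\<And>t. t \<in> {0..a} \<union> {b..1} \<Longrightarrow> V t = 0"
  shows "wd V (\<lambda>s. if a < s \<and> s \<le> b then W s else 0)"
proof -
  have "wd (\<lambda>t. 1 *\<^sub>R (if t \<le> b then V t else 0) + (- 1) *\<^sub>R (if t \<le> a then V t else 0))
      (\<lambda>t. 1 *\<^sub>R (if t \<le> b then W t else 0) + (- 1) *\<^sub>R (if t \<le> a then W t else 0))"
    using V ab z by (intro wd_lin wd_cut) auto
  then show ?thesis by (rule wd_cong) (use ab z in auto)
qed

locale morse_sturm = nondeg_sym_form g + jacobi_ode R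
  for g :: "'a::euclidean_space \<Rightarrow> 'a \<Rightarrow> real" and R :: "real \<Rightarrow> ('a \<Rightarrow>\<^sub>L 'a)" +
  fixes P :: "'a set" and S :: "'a \<Rightarrow> 'a" and Y Y' :: "real \<Rightarrow> 'a"
  assumes index_g: "has_index g UNIV 1"
    and R_sym: "t \<in> {0..1} \<Longrightarrow> g (blinfun_apply (R t) x) y = g x (blinfun_apply (R t) y)"
    and P: "subspace P" "nondeg_on g P"
    and S_in: "x \<in> P \<Longrightarrow> S x \<in> P"
    and S_lin: "x \<in> P \<Longrightarrow> y \<in> P \<Longrightarrow> S (a *\<^sub>R x + b *\<^sub>R y) = a *\<^sub>R S x + b *\<^sub>R S y"
    and S_sym: "x \<in> P \<Longrightarrow> y \<in> P \<Longrightarrow> g (S x) y = g x (S y)"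
    and Y_jac: "jac R Y Y'"
    and Y_neg: "t \<in> {0..1} \<Longrightarrow> g (Y t) (Y t) < 0"
    and J_nondeg: "t \<in> {0..1} \<Longrightarrow> nondeg_on g (JJt g R P S t)"
begin

abbreviation "II \<equiv> I1 g R S"

text \<open>The integrand of \<open>I1\<close> with both weak derivatives passed explicitly, so that
  representatives adapted to cut and glued fields can be inserted.\<close>

definition FF :: "(real \<Rightarrow> 'a) \<Rightarrow> (real \<Rightarrow> 'a) \<Rightarrow> (real \<Rightarrow> 'a) \<Rightarrow> (real \<Rightarrow> 'a) \<Rightarrow> real \<Rightarrow> real" where
  "FF W V A' A s = g (W s) (A' s) + g (blinfun_apply (R s) (V s)) (A s)"

lemma FF_integrable:
  assumes "wd V W" "wd A A'" shows "FF W V A' A integrable_on {0..1}"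
proof -
  have "continuous_on {0..1} (\<lambda>s. blinfun_apply (R s) (V s))"
    using wd_continuous[OF assms(1)] R_cont by (intro continuous_intros)
  moreover have "L2 W" "L2 A'" using assms unfolding wd_def by auto
  ultimately show ?thesis unfolding FF_def[abs_def]
    by (intro integrable_add L2_prod_integrable[OF bb.bounded_bilinear_axioms])
      (auto intro: L2_continuous wd_continuous[OF assms(2)])
qed

lemma I1_wd:
  assumes "wd V W" "wd A A'"
  shows "II V A = integral {0..1} (FF W V A' A) - g (S (V 0)) (A 0)"
proof -
  obtain N where N: "negligible N" "\<forall>s\<in>{0..1} - N. vector_derivative V (at s) = W s" using wd_ae[OF assms(1)] by blast
  obtain N' where N': "negligible N'" "\<forall>s\<in>{0..1} - N'. vector_derivative A (at s) = A' s" using wd_ae[OF assms(2)] by blast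
  have "integral {0..1} (FF W V A' A) = integral {0..1} (\<lambda>s. g (vector_derivative V (at s)) (vector_derivative A (at s))
        + g (blinfun_apply (R s) (V s)) (A s))"
    by (rule integral_spike[of "N \<union> N'"]) (use N N' in \<open>auto simp: FF_def negligible_Un\<close>)
  then show ?thesis by (simp add: I1_def)
qed

lemma H1P_iff: "V \<in> H1P P \<longleftrightarrow> (\<exists>W. wd V W) \<and> V 0 \<in> P \<and> V 1 = 0"
  by (auto simp: H1P_def H1_iff)

lemma S_add: "x \<in> P \<Longrightarrow> y \<in> P \<Longrightarrow> S (x + y) = S x + S y"
  using S_lin[of x y 1 1] by simp

lemma S_scale: "x \<in> P \<Longrightarrow> S (c *\<^sub>R x) = c *\<^sub>R S x"
  using S_lin[of x x c 0] by simp

lemma S_zero: "S 0 = 0"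
  using S_scale[of 0 0] subspace_0[OF P(1)] by simp

lemma subspace_H1P: "subspace (H1P P)"
proof (rule subspaceI)
  show "0 \<in> H1P P" using wd_zero subspace_0[OF P(1)] by (auto simp: H1P_iff)
  show "x + y \<in> H1P P" if "x \<in> H1P P" "y \<in> H1P P" for x y
    using that wd_add[of x _ y] subspace_add[OF P(1)] by (fastforce simp: H1P_iff)
  show "c *\<^sub>R x \<in> H1P P" if "x \<in> H1P P" for x c
    using that wd_scale[of x] subspace_mul[OF P(1)] by (fastforce simp: H1P_iff scaleR_fun_def)
qed

sublocale H: form_on "H1P P" II
proof
  show "subspace (H1P P)" by (rule subspace_H1P)
next
  fix x y assume x: "x \<in> H1P P" and y: "y \<in> H1P P"
  obtain x' y' where d: "wd x x'" "wd y y'" using x y by (auto simp: H1P_iff)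
  have "integral {0..1} (FF x' x y' y) = integral {0..1} (FF y' y x' x)"
    by (rule integral_cong) (simp add: FF_def R_sym g_sym[of "x' _"] g_sym[of "x _"])
  moreover have "g (S (x 0)) (y 0) = g (S (y 0)) (x 0)"
    using S_sym[of "x 0" "y 0"] x y g_sym[of "x 0"] by (simp add: H1P_iff)
  ultimately show "II x y = II y x" using I1_wd d by simp
next
  fix x y z assume x: "x \<in> H1P P" and y: "y \<in> H1P P" and z: "z \<in> H1P P"
  obtain x' y' z' where d: "wd x x'" "wd y y'" "wd z z'" using x y z by (auto simp: H1P_iff)
  have "integral {0..1} (FF (\<lambda>t. x' t + y' t) (x + y) z' z) =
      integral {0..1} (\<lambda>s. FF x' x z' z s + FF y' y z' z s)"
    by (rule integral_cong) (simp add: FF_def g_simps blinfun.add_right)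
  also have "\<dots> = integral {0..1} (FF x' x z' z) + integral {0..1} (FF y' y z' z)"
    by (intro integral_add FF_integrable d)
  finally show "II (x + y) z = II x z + II y z"
    using I1_wd[OF wd_add[OF d(1,2)] d(3)] I1_wd[OF d(1,3)] I1_wd[OF d(2,3)] x y
    by (simp add: H1P_iff S_add g_simps)
next
  fix x z a assume x: "x \<in> H1P P" and z: "z \<in> H1P P"
  obtain x' z' where d: "wd x x'" "wd z z'" using x z by (auto simp: H1P_iff)
  have "integral {0..1} (FF (\<lambda>t. a *\<^sub>R x' t) (a *\<^sub>R x) z' z) =
      integral {0..1} (\<lambda>s. a * FF x' x z' z s)"
    by (rule integral_cong) (simp add: FF_def g_simps blinfun.scaleR_right scaleR_fun_def distrib_left)
  also have "\<dots> = a * integral {0..1} (FF x' x z' z)" by simp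
  finally show "II (a *\<^sub>R x) z = a * II x z"
    using I1_wd[OF wd_scale[OF d(1)] d(2)] I1_wd[OF d] x
    by (simp add: H1P_iff S_scale g_simps scaleR_fun_def right_diff_distrib)
qed

lemma I_glue:
  assumes V: "wd V W" and A: "wd A A'" and Z: "wd Z Z'"
    and ab: "0 \<le> a" "a \<le> b" "b \<le> 1" and eq: "A a = Z a" "Z b = 0"
  shows "II V (glue a b A Z) = integral {0..a} (FF W V A' A) + integral {a..b} (FF W V Z' Z) - g (S (V 0)) (A 0)"
proof -
  let ?G = "glue a b A Z" and ?G' = "glue a b A' Z'"
  have G: "wd ?G ?G'" by (rule wd_glue[OF A Z ab eq])
  have int: "FF W V ?G' ?G integrable_on {0..1}" by (rule FF_integrable[OF V G])
  have "integral {0..b} (FF W V ?G' ?G) + integral {b..1} (FF W V ?G' ?G) = integral {0..1} (FF W V ?G' ?G)"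
    using ab int by (intro Henstock_Kurzweil_Integration.integral_combine) auto
  moreover have "integral {0..a} (FF W V ?G' ?G) + integral {a..b} (FF W V ?G' ?G) = integral {0..b} (FF W V ?G' ?G)"
    using ab integrable_subinterval_real[OF int]
    by (intro Henstock_Kurzweil_Integration.integral_combine) auto
  moreover have "integral {0..a} (FF W V ?G' ?G) = integral {0..a} (FF W V A' A)"
    by (rule integral_cong) (simp add: FF_def glue_def)
  moreover have "integral {a..b} (FF W V Z' Z) = integral {a..b} (FF W V ?G' ?G)"
    by (rule integral_spike[of "{a}"]) (use ab in \<open>auto simp: FF_def glue_def\<close>)
  moreover have "integral {b..1} (\<lambda>_. 0) = integral {b..1} (FF W V ?G' ?G)"
    by (rule integral_spike[of "{b}"]) (use ab in \<open>auto simp: FF_def glue_def g_simps\<close>)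
  ultimately show ?thesis using I1_wd[OF V G] ab by (simp add: glue_def)
qed

lemma wd_jac: "jac R J J' \<Longrightarrow> wd J J'"
  using jacD jac_continuous by (intro wd_C1) auto

text \<open>By symmetry of \<open>R\<close> the integrand is the derivative of g(V, J'), so only
  boundary values remain.\<close>

lemma FF_jacobi:
  assumes V: "wd V W" and J: "jac R J J'" and pq: "0 \<le> p" "p \<le> q" "q \<le> 1"
  shows "integral {p..q} (FF W V J' J) = g (V q) (J' q) - g (V p) (J' p)"
proof -
  have "continuous_on {0..1} (\<lambda>s. blinfun_apply (R s) (J s))"
    using jac_continuous[OF J] R_cont by (intro continuous_intros)
  then have "((\<lambda>s. g (W s) (J' s) + g (V s) (blinfun_apply (R s) (J s))) has_integral
      (g (V q) (J' q) - g (V p) (J' p))) {p..q}"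
    using jacD(2)[OF J] by (intro wd_by_parts V pq)
  then have "integral {p..q} (\<lambda>s. g (W s) (J' s) + g (V s) (blinfun_apply (R s) (J s))) =
      g (V q) (J' q) - g (V p) (J' p)" by (rule integral_unique)
  moreover have "integral {p..q} (FF W V J' J) =
      integral {p..q} (\<lambda>s. g (W s) (J' s) + g (V s) (blinfun_apply (R s) (J s)))"
    using pq by (intro integral_cong) (simp add: FF_def R_sym)
  ultimately show ?thesis by simp
qed

text \<open>The constant is attached to an interval because it may differ on the two sides of a
  node, and it is prescribed almost everywhere because weak derivatives are determined only up to
  null sets.\<close>

definition con :: "(real \<Rightarrow> 'a) \<Rightarrow> (real \<Rightarrow> 'a) \<Rightarrow> real \<Rightarrow> real \<Rightarrow> real \<Rightarrow> bool" where
  "con W V p q c \<longleftrightarrow> (\<exists>N. negligible N \<and> (\<forall>s\<in>{p..q} - N. g (W s) (Y s) - g (V s) (Y' s) = c))"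

lemma con_lin:
  assumes "con W V p q c" "con W' V' p q c'"
  shows "con (\<lambda>t. a *\<^sub>R W t + b *\<^sub>R W' t) (\<lambda>t. a *\<^sub>R V t + b *\<^sub>R V' t) p q (a * c + b * c')"
proof -
  obtain N N' where "negligible N" "\<forall>s\<in>{p..q} - N. g (W s) (Y s) - g (V s) (Y' s) = c"
    "negligible N'" "\<forall>s\<in>{p..q} - N'. g (W' s) (Y s) - g (V' s) (Y' s) = c'"
    using assms unfolding con_def by blast
  then show ?thesis unfolding con_def
    by (intro exI[of _ "N \<union> N'"]) (auto simp: negligible_Un g_simps algebra_simps)
qed

lemma con_subinterval: "con W V p q c \<Longrightarrow> p \<le> p' \<Longrightarrow> q' \<le> q \<Longrightarrow> con W V p' q' c"
  unfolding con_def by fastforce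

lemma con_ae:
  assumes "con W V p q c" "negligible N" "\<And>s. s \<in> {p..q} - N \<Longrightarrow> W' s = W s \<and> V' s = V s"
  shows "con W' V' p q c"
proof -
  obtain N' where "negligible N'" "\<forall>s\<in>{p..q} - N'. g (W s) (Y s) - g (V s) (Y' s) = c"
    using assms(1) unfolding con_def by blast
  then show ?thesis unfolding con_def using assms(2,3)
    by (intro exI[of _ "N \<union> N'"]) (auto simp: negligible_Un)
qed

lemma con_unique_derivative:
  assumes "con W V p q c" "wd V W" "wd V W'" "0 \<le> p" "q \<le> 1"
  shows "con W' V p q c"
proof -
  obtain N where "negligible N" "\<forall>s\<in>{0..1} - N. W' s = W s" using wd_unique_ae[OF assms(2,3)] by blast
  then show ?thesis using assms by (intro con_ae[OF assms(1), of N]) auto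
qed

text \<open>Substituting g(W, Y) = c + g(V, Y') turns the integrand into c f' plus the derivative of
  f g(V, Y'). A multiple of Y thus sees a constrained field only through its constant and its
  boundary values.\<close>

lemma FF_Y:
  assumes V: "wd V W" and con: "con W V p q c"
    and f: "\<And>t. t \<in> {0..1} \<Longrightarrow> (f has_vector_derivative f' t) (at t within {0..1})" "continuous_on {0..1} f'"
    and pq: "0 \<le> p" "p \<le> q" "q \<le> 1"
  shows "integral {p..q} (FF W V (\<lambda>s. f' s *\<^sub>R Y s + f s *\<^sub>R Y' s) (\<lambda>s. f s *\<^sub>R Y s)) =
     c * (f q - f p) + f q * g (V q) (Y' q) - f p * g (V p) (Y' p)"
proof -
  let ?RY = "\<lambda>s. blinfun_apply (R s) (Y s)"
  have cY: "continuous_on {0..1} Y" "continuous_on {0..1} Y'" using jac_continuous[OF Y_jac] by auto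
  have cf: "continuous_on {0..1} f"
    using f(1) has_vector_derivative_continuous unfolding continuous_on_eq_continuous_within by blast
  have "((\<lambda>s. g (W s) (f s *\<^sub>R Y' s) + g (V s) (f s *\<^sub>R ?RY s + f' s *\<^sub>R Y' s)) has_integral
      (g (V q) (f q *\<^sub>R Y' q) - g (V p) (f p *\<^sub>R Y' p))) {p..q}"
  proof (rule wd_by_parts[OF V _ _ pq])
    show "((\<lambda>s. f s *\<^sub>R Y' s) has_vector_derivative (f t *\<^sub>R ?RY t + f' t *\<^sub>R Y' t)) (at t within {0..1})"
      if "t \<in> {0..1}" for t
      using f(1)[OF that] jacD(2)[OF Y_jac that]
      by (auto intro!: derivative_eq_intros simp: has_real_derivative_iff_has_vector_derivative)
    show "continuous_on {0..1} (\<lambda>s. f s *\<^sub>R ?RY s + f' s *\<^sub>R Y' s)"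
      using cf f(2) cY R_cont by (intro continuous_intros)
  qed
  moreover have "((\<lambda>s. c * f' s) has_integral c * (f q - f p)) {p..q}"
    using pq by (intro has_integral_mult_right fundamental_theorem_of_calculus
        has_vector_derivative_within_subset[OF f(1)]) auto
  ultimately have i: "((\<lambda>s. (g (W s) (f s *\<^sub>R Y' s) + g (V s) (f s *\<^sub>R ?RY s + f' s *\<^sub>R Y' s)) + c * f' s) has_integral
      ((g (V q) (f q *\<^sub>R Y' q) - g (V p) (f p *\<^sub>R Y' p)) + c * (f q - f p))) {p..q}"
    by (rule has_integral_add)
  obtain N where N: "negligible N" "\<And>s. s \<in> {p..q} - N \<Longrightarrow> g (W s) (Y s) - g (V s) (Y' s) = c"
    using con unfolding con_def by blast
  have "((FF W V (\<lambda>s. f' s *\<^sub>R Y s + f s *\<^sub>R Y' s) (\<lambda>s. f s *\<^sub>R Y s)) has_integral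
      ((g (V q) (f q *\<^sub>R Y' q) - g (V p) (f p *\<^sub>R Y' p)) + c * (f q - f p))) {p..q}"
  proof (rule has_integral_spike[OF N(1) _ i])
    fix s assume s: "s \<in> {p..q} - N"
    have r: "g (blinfun_apply (R s) (V s)) (Y s) = g (V s) (?RY s)" using s pq by (intro R_sym) auto
    have ceq: "c = g (W s) (Y s) - g (V s) (Y' s)" using N(2)[OF s] by simp
    show "FF W V (\<lambda>s. f' s *\<^sub>R Y s + f s *\<^sub>R Y' s) (\<lambda>s. f s *\<^sub>R Y s) s =
        (g (W s) (f s *\<^sub>R Y' s) + g (V s) (f s *\<^sub>R ?RY s + f' s *\<^sub>R Y' s)) + c * f' s"
      unfolding FF_def g_simps r ceq by (simp add: algebra_simps)
  qed
  then show ?thesis by (simp add: integral_unique g_simps)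
qed

lemma wronskian:
  assumes J: "jac R J J'" and K: "jac R K K'" and st: "s \<in> {0..1}" "t \<in> {0..1}"
  shows "g (J' s) (K s) - g (J s) (K' s) = g (J' t) (K t) - g (J t) (K' t)"
proof -
  define w where "w s = g (J' s) (K s) - g (J s) (K' s)" for s
  have "(w has_vector_derivative 0) (at t within {0..1})" if t: "t \<in> {0..1}" for t
  proof -
    have "(w has_vector_derivative (g (J' t) (K' t) + g (blinfun_apply (R t) (J t)) (K t)) -
        (g (J t) (blinfun_apply (R t) (K t)) + g (J' t) (K' t))) (at t within {0..1})"
      unfolding w_def using jacD(1,2)[OF J t] jacD(1,2)[OF K t]
      by (intro has_vector_derivative_diff bb.has_vector_derivative)
    then show ?thesis using R_sym[OF t, of "J t" "K t"] by simp
  qed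
  then obtain c where "\<And>t. t \<in> {0..1} \<Longrightarrow> w t = c"
    using has_derivative_zero_constant[of "{0..1}" w] by (auto simp: has_vector_derivative_def)
  then show ?thesis using st by (simp add: w_def)
qed

text \<open>The quantity is the Wronskian of J and Y, so every solution of the equation meets the
  constraint.\<close>

lemma con_jacobi:
  assumes "jac R J J'"
  shows "\<exists>c. con J' J 0 1 c"
  unfolding con_def
proof (intro exI conjI ballI)
  fix s :: real assume "s \<in> {0..1} - {}"
  then show "g (J' s) (Y s) - g (J s) (Y' s) = g (J' 0) (Y 0) - g (J 0) (Y' 0)"
    using wronskian[OF assms Y_jac, of s 0] by simp
qed simp

text \<open>The index is 1 and \<open>y\<close> already uses the negative direction: a negative
  vector orthogonal to \<open>y\<close> would produce a negative plane. A null \<open>z\<close>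
  would lie in the radical of the semidefinite complement of \<open>y\<close>, hence be orthogonal
  to everything.\<close>

lemma lorentz_positive:
  assumes y: "g y y < 0" and z: "g z y = 0" "z \<noteq> 0"
  shows "0 < g z z"
proof -
  have semi: "0 \<le> g w w" if w: "g w y = 0" for w
  proof (rule ccontr)
    assume n: "\<not> 0 \<le> g w w"
    have fam: "neg_fam g UNIV 2 (\<lambda>i. if i = 0 then y else w)"
      unfolding neg_fam_def
    proof (intro conjI allI impI)
      fix c :: "nat \<Rightarrow> real" assume c: "\<exists>i<2. c i \<noteq> 0"
      have yw: "g y w = 0" using w g_sym by simp
      have "(\<Sum>i<2. c i *\<^sub>R (if i = 0 then y else w)) = c 0 *\<^sub>R y + c 1 *\<^sub>R w"
        by (simp add: numeral_2_eq_2)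
      then have eq: "g (\<Sum>i<2. c i *\<^sub>R (if i = 0 then y else w)) (\<Sum>i<2. c i *\<^sub>R (if i = 0 then y else w)) =
          (c 0)\<^sup>2 * g y y + (c 1)\<^sup>2 * g w w"
        using w yw by (simp add: g_simps power2_eq_square)
      have le: "(c 0)\<^sup>2 * g y y \<le> 0" "(c 1)\<^sup>2 * g w w \<le> 0"
        using y n by (auto simp: mult_le_0_iff)
      have "c 0 \<noteq> 0 \<or> c 1 \<noteq> 0" using c by (auto simp: less_2_cases_iff)
      then have "(c 0)\<^sup>2 * g y y < 0 \<or> (c 1)\<^sup>2 * g w w < 0"
        using y n by (auto simp: mult_less_0_iff)
      then show "g (\<Sum>i<2. c i *\<^sub>R (if i = 0 then y else w)) (\<Sum>i<2. c i *\<^sub>R (if i = 0 then y else w)) < 0"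
        unfolding eq using le by linarith
    qed simp
    have "2 \<le> (1::nat)" by (rule neg_fam_le_index[OF index_g _ _ fam]) auto
    then show False by simp
  qed
  moreover have "g z z \<noteq> 0"
  proof
    assume zz: "g z z = 0"
    have sub: "subspace {w. g w y = 0}" by (auto simp: subspace_def g_simps)
    have "g z w = 0" for w
    proof -
      define a where "a = g w y / g y y"
      have "g (w - a *\<^sub>R y) y = 0" using y by (simp add: a_def g_simps)
      then have "g z (w - a *\<^sub>R y) = 0"
        using semidefinite_radical[OF sub _ _ zz, of "w - a *\<^sub>R y"] semi z(1) by auto
      then show ?thesis using z(1) by (simp add: g_simps)
    qed
    then show False using g_nondeg z(2) unfolding nondeg_on_def by blast
  qed
  ultimately show ?thesis using z(1) by (metis less_eq_real_def)
qed

text \<open>Reversing the sign of g along Y yields a positive definite form.\<close>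

lemma uniform_positivity:
  "\<exists>\<kappa>>0. \<forall>s\<in>{0..1}. \<forall>x. \<kappa> * (norm x)\<^sup>2 \<le> g x x - 2 * (g x (Y s))\<^sup>2 / g (Y s) (Y s)"
proof -
  define h where "h s x = g x x - 2 * (g x (Y s))\<^sup>2 / g (Y s) (Y s)" for s x
  have pos: "0 < h s x" if s: "s \<in> {0..1}" and x: "x \<noteq> 0" for s x
  proof -
    let ?y = "Y s"
    have y: "g ?y ?y < 0" using Y_neg[OF s] .
    define a where "a = g x ?y / g ?y ?y"
    define z where "z = x - a *\<^sub>R ?y"
    have zy: "g z ?y = 0" "g ?y z = 0" using y g_sym[of ?y z] by (simp_all add: z_def a_def g_simps)
    have xz: "x = a *\<^sub>R ?y + z" by (simp add: z_def)
    have gxx: "g x x = a\<^sup>2 * g ?y ?y + g z z"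
      using zy by (simp add: xz g_simps power2_eq_square)
    have gxy: "g x ?y = a * g ?y ?y" using y by (simp add: a_def)
    have h: "h s x = - (a\<^sup>2 * g ?y ?y) + g z z"
      unfolding h_def gxx gxy using y by (simp add: power2_eq_square)
    show ?thesis
    proof (cases "z = 0")
      case True
      then have "a \<noteq> 0" using x xz by auto
      then have "a\<^sup>2 * g ?y ?y < 0" using y by (simp add: mult_less_0_iff)
      then show ?thesis using h True by (simp add: g_simps)
    next
      case False
      then have "0 < g z z" using lorentz_positive[OF y zy(1)] by blast
      moreover have "a\<^sup>2 * g ?y ?y \<le> 0" using y by (simp add: mult_le_0_iff)
      ultimately show ?thesis using h by linarith
    qed
  qed
  \<comment> \<open>\<open>h\<close> is quadratic in its vector argument, so its minimum over times
    and unit vectors is the desired constant; it is attained by compactness and therefore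
    positive.\<close>
  define D where "D = {0..1::real} \<times> sphere (0::'a) 1"
  have "compact D" unfolding D_def by (intro compact_Times compact_sphere) auto
  moreover have "D \<noteq> {}"
  proof -
    obtain b :: 'a where "b \<in> Basis" using nonempty_Basis by blast
    then have "(0, b) \<in> D" by (simp add: D_def)
    then show ?thesis by blast
  qed
  moreover have "continuous_on D (\<lambda>p. h (fst p) (snd p))"
  proof -
    have cY: "continuous_on D (\<lambda>p. Y (fst p))"
      by (rule continuous_on_compose2[OF jac_continuous(1)[OF Y_jac]]) (auto simp: D_def intro: continuous_intros)
    have "g (Y (fst p)) (Y (fst p)) \<noteq> 0" if "p \<in> D" for p using Y_neg[of "fst p"] that by (auto simp: D_def)
    then show ?thesis unfolding h_def
      using cY by (intro continuous_intros bb.continuous_on) auto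
  qed
  ultimately obtain p where p: "p \<in> D" "\<And>q. q \<in> D \<Longrightarrow> h (fst p) (snd p) \<le> h (fst q) (snd q)"
    using continuous_attains_inf[of D "\<lambda>p. h (fst p) (snd p)"] by blast
  define \<kappa> where "\<kappa> = h (fst p) (snd p)"
  have "\<kappa> > 0" unfolding \<kappa>_def using p(1) by (intro pos) (auto simp: D_def)
  moreover have "\<kappa> * (norm x)\<^sup>2 \<le> h s x" if s: "s \<in> {0..1}" for s x
  proof (cases "x = 0")
    case True
    then show ?thesis by (simp add: h_def g_simps)
  next
    case False
    define u where "u = x /\<^sub>R norm x"
    have "(s, u) \<in> D" using s False by (simp add: D_def u_def)
    then have "\<kappa> \<le> h s u" using p(2) unfolding \<kappa>_def by fastforce
    then have "\<kappa> * (norm x)\<^sup>2 \<le> h s u * (norm x)\<^sup>2" by (intro mult_right_mono) auto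
    also have "h s u * (norm x)\<^sup>2 = h s (norm x *\<^sub>R u)"
      by (simp add: h_def g_simps power2_eq_square algebra_simps)
    also have "norm x *\<^sub>R u = x" using False by (simp add: u_def)
    finally show ?thesis .
  qed
  ultimately show ?thesis unfolding h_def by blast
qed

text \<open>The elements of the constrained space that are supported in [a, b] with zero boundary values.\<close>

definition K0 :: "real \<Rightarrow> real \<Rightarrow> (real \<Rightarrow> 'a) set" where
  "K0 a b = {V \<in> H1P P. (\<forall>t\<in>{0..a} \<union> {b..1}. V t = 0) \<and> (\<exists>W. wd V W \<and> (\<exists>c. con W V a b c))}"

text \<open>The constant c and hence g(V', Y) are controlled by the integral of the norm of V', which on short
  intervals is small compared with the norm of V' in the space of square integrable functions.\<close>

lemma K0_nonneg:
  "\<exists>\<delta>>0. \<forall>a b V. 0 \<le> a \<longrightarrow> a < b \<longrightarrow> b \<le> 1 \<longrightarrow> b - a < \<delta> \<longrightarrow> V \<in> K0 a b \<longrightarrow> 0 \<le> II V V"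
proof -
  obtain \<kappa> where \<kappa>: "\<kappa> > 0"
    "\<And>s x. s \<in> {0..1} \<Longrightarrow> \<kappa> * (norm x)\<^sup>2 \<le> g x x - 2 * (g x (Y s))\<^sup>2 / g (Y s) (Y s)"
    using uniform_positivity by blast
  obtain M where M: "M > 0" "\<And>t x. t \<in> {0..1} \<Longrightarrow> norm (blinfun_apply (R t) x) \<le> M * norm x"
    using R_bound by blast
  obtain K where K: "K > 0" "\<And>x y. \<bar>g x y\<bar> \<le> K * norm x * norm y" using g_bound by blast
  have "compact (Y' ` {0..1})" using jac_continuous[OF Y_jac] by (intro compact_continuous_image) auto
  then obtain L where L: "\<And>t. t \<in> {0..1} \<Longrightarrow> norm (Y' t) \<le> L" "L > 0"
    by (metis bounded_pos compact_imp_bounded image_eqI)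
  have "continuous_on {0..1} (\<lambda>s. g (Y s) (Y s))"
    using jac_continuous[OF Y_jac] by (intro bb.continuous_on)
  then obtain s0 where s0: "s0 \<in> {0..1}" "\<And>s. s \<in> {0..1} \<Longrightarrow> g (Y s) (Y s) \<le> g (Y s0) (Y s0)"
    using continuous_attains_sup[of "{0..1::real}" "\<lambda>s. g (Y s) (Y s)"] by auto
  define \<beta> where "\<beta> = - g (Y s0) (Y s0)"
  have \<beta>: "\<beta> > 0" "\<And>s. s \<in> {0..1} \<Longrightarrow> \<beta> \<le> - g (Y s) (Y s)"
    using Y_neg[OF s0(1)] s0(2) by (auto simp: \<beta>_def)
  \<comment> \<open>Used in \<open>lower\<close>: |g(W, Y)| is at most |c| + |g(V, Y')|, hence at
    most 3 K L n1. The two summands bound the term correcting the sign along Y and the term with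
    \<open>R\<close>, both relative to n1^2.\<close>
  define C where "C = 2 * (3 * K * L)\<^sup>2 / \<beta> + K * M"
  have C: "C > 0" using K M \<beta> by (simp add: C_def add_nonneg_pos)
  define \<delta> where "\<delta> = min 1 (\<kappa> / C)"
  have main: "0 \<le> II V V" if ab: "0 \<le> a" "a < b" "b \<le> 1" "b - a < \<delta>" and V: "V \<in> K0 a b" for a b V
  proof -
    obtain W1 c where W1: "wd V W1" "con W1 V a b c" and Vz: "\<And>t. t \<in> {0..a} \<union> {b..1} \<Longrightarrow> V t = 0"
      and VX: "V \<in> H1P P"
      using V unfolding K0_def by blast
    define W where "W s = (if a < s \<and> s \<le> b then W1 s else 0)" for s
    have W: "wd V W" unfolding W_def using ab by (intro wd_support[OF W1(1) _ _ _ Vz]) auto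
    obtain N where N: "negligible N" "\<And>s. s \<in> {a..b} - N \<Longrightarrow> g (W s) (Y s) - g (V s) (Y' s) = c"
      using con_unique_derivative[OF W1(2,1) W] ab unfolding con_def by auto
    let ?h = "b - a"
    have h: "0 < ?h" "?h < 1" "C * ?h < \<kappa>" using ab C by (auto simp: \<delta>_def field_simps)
    have sub: "{a..b} \<subseteq> {0..1}" using ab by auto
    have LW: "L2 W" using W unfolding wd_def by blast
    have iW: "(\<lambda>s. norm (W s)) integrable_on {a..b}" "(\<lambda>s. (norm (W s))\<^sup>2) integrable_on {a..b}"
      using L2_norm_integrable[OF LW] LW sub unfolding L2_def
      by (auto intro: integrable_subinterval_real)
    define n1 where "n1 = integral {a..b} (\<lambda>s. norm (W s))"
    define n2 where "n2 = integral {a..b} (\<lambda>s. (norm (W s))\<^sup>2)"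
    have n1: "0 \<le> n1" unfolding n1_def by (rule integral_nonneg[OF iW(1)]) simp
    \<comment> \<open>Cauchy-Schwarz, obtained by integrating (|W| - m)^2 with m the mean of |W|
      over [a, b].\<close>
    have n12: "n1\<^sup>2 \<le> ?h * n2"
    proof -
      define m where "m = n1 / ?h"
      have "((\<lambda>s. (norm (W s))\<^sup>2 + ((- 2 * m) * norm (W s) + m\<^sup>2)) has_integral
          (n2 + ((- 2 * m) * n1 + ?h * m\<^sup>2))) {a..b}"
        unfolding n1_def n2_def using has_integral_const_real[of "m\<^sup>2" a b] ab
        by (intro has_integral_add has_integral_mult_right integrable_integral iW) auto
      then have "0 \<le> n2 + ((- 2 * m) * n1 + ?h * m\<^sup>2)"
      proof (rule has_integral_nonneg)
        show "0 \<le> (norm (W s))\<^sup>2 + ((- 2 * m) * norm (W s) + m\<^sup>2)" for s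
          using zero_le_power2[of "norm (W s) - m"] by (simp add: power2_diff algebra_simps)
      qed
      moreover have mh: "?h * m = n1" using h by (simp add: m_def)
      then have "?h * m\<^sup>2 = m * n1" by (simp add: power2_eq_square mult.left_commute)
      ultimately have "m * n1 \<le> n2" by simp
      then have "?h * (m * n1) \<le> ?h * n2" using h by (intro mult_left_mono) auto
      moreover have "?h * (m * n1) = n1\<^sup>2" using mh by (simp add: power2_eq_square mult.assoc[symmetric])
      ultimately show ?thesis by simp
    qed
    have Va: "V a = 0" "V b = 0" using Vz ab by auto
    have Vn: "norm (V s) \<le> n1" if s: "s \<in> {a..b}" for s
    proof -
      have i: "(W has_integral V s - V a) {a..s}" using s ab by (intro wd_interval[OF W]) auto
      have "norm (V s) = norm (integral {a..s} W)" using i Va by (simp add: integral_unique)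
      also have "\<dots> \<le> integral {a..s} (\<lambda>s. norm (W s))"
        using i s integrable_subinterval_real[OF iW(1), of a s]
        by (intro integral_norm_bound_integral) auto
      also have "\<dots> \<le> n1" unfolding n1_def
        using s by (intro integral_subset_le integrable_subinterval_real[OF iW(1)] iW(1)) auto
      finally show ?thesis .
    qed
    have VY: "\<bar>g (V s) (Y' s)\<bar> \<le> K * L * n1" if s: "s \<in> {a..b}" for s
    proof -
      have "\<bar>g (V s) (Y' s)\<bar> \<le> K * norm (V s) * norm (Y' s)" by (rule K)
      also have "\<dots> \<le> K * n1 * L" using Vn[OF s] L(1)[of s] s sub K(1) n1 by (intro mult_mono) auto
      finally show ?thesis by (simp add: mult_ac)
    qed
    \<comment> \<open>The derivative of g(V, Y) is g(W, Y) + g(V, Y') = c + 2 g(V, Y'), and g(V, Y)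
      vanishes at both ends. So c is minus twice the mean of g(V, Y').\<close>
    have c_bound: "\<bar>c\<bar> \<le> 2 * K * L * n1"
    proof -
      have "((\<lambda>s. g (W s) (Y s) + g (V s) (Y' s)) has_integral (g (V b) (Y b) - g (V a) (Y a))) {a..b}"
        using jacD(1)[OF Y_jac] jac_continuous(2)[OF Y_jac] ab by (intro wd_by_parts[OF W]) auto
      then have i0: "((\<lambda>s. g (W s) (Y s) + g (V s) (Y' s)) has_integral 0) {a..b}" by (simp add: Va g_simps)
      have "((\<lambda>s. c + 2 * g (V s) (Y' s)) has_integral 0) {a..b}"
        by (rule has_integral_spike[OF N(1) _ i0]) (use N(2) in force)
      then have "norm (0 - ?h *\<^sub>R c) \<le> (2 * K * L * n1) * measure lborel (cbox a b)"
      proof (intro has_integral_bound)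
        have "((\<lambda>s. c + 2 * g (V s) (Y' s) - c) has_integral (0 - ?h *\<^sub>R c)) {a..b}"
          using \<open>((\<lambda>s. c + 2 * g (V s) (Y' s)) has_integral 0) {a..b}\<close> has_integral_const_real[of c a b] ab
          by (intro has_integral_diff) auto
        then show "((\<lambda>s. 2 * g (V s) (Y' s)) has_integral (0 - ?h *\<^sub>R c)) (cbox a b)" by simp
        show "norm (2 * g (V s) (Y' s)) \<le> 2 * K * L * n1" if "s \<in> cbox a b" for s
          using VY[of s] that by (simp add: abs_mult)
      qed (use K L n1 in auto)
      then have "?h * \<bar>c\<bar> \<le> ?h * (2 * K * L * n1)" using ab by (simp add: abs_mult mult_ac)
      then show ?thesis using h by simp
    qed
    have lower: "\<kappa> * (norm (W s))\<^sup>2 - C * n1\<^sup>2 \<le> FF W V W V s" if s: "s \<in> {a..b} - N" for s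
    proof -
      have s01: "s \<in> {0..1}" and sab: "s \<in> {a..b}" using s sub by auto
      have "\<bar>g (W s) (Y s)\<bar> \<le> 3 * K * L * n1"
        using N(2)[OF s] VY[OF sab] c_bound by linarith
      then have "(g (W s) (Y s))\<^sup>2 \<le> (3 * K * L * n1)\<^sup>2"
        using K L n1 by (intro power2_le_iff_abs_le[THEN iffD2]) auto
      then have "2 * (g (W s) (Y s))\<^sup>2 / (- g (Y s) (Y s)) \<le> 2 * (3 * K * L * n1)\<^sup>2 / \<beta>"
        using \<beta>(1) \<beta>(2)[OF s01] by (intro frac_le) auto
      then have "g (W s) (W s) \<ge> \<kappa> * (norm (W s))\<^sup>2 - 2 * (3 * K * L * n1)\<^sup>2 / \<beta>"
        using \<kappa>(2)[OF s01, of "W s"] by simp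
      moreover have "\<bar>g (blinfun_apply (R s) (V s)) (V s)\<bar> \<le> K * (M * n1) * n1"
      proof -
        have "norm (blinfun_apply (R s) (V s)) \<le> M * n1"
          using M(2)[OF s01, of "V s"] mult_left_mono[OF Vn[OF sab], of M] M(1) by linarith
        then have "K * norm (blinfun_apply (R s) (V s)) * norm (V s) \<le> K * (M * n1) * n1"
          using K(1) M(1) n1 Vn[OF sab] by (intro mult_mono) auto
        then show ?thesis using K(2)[of "blinfun_apply (R s) (V s)" "V s"] by linarith
      qed
      moreover have "C * n1\<^sup>2 = 2 * (3 * K * L * n1)\<^sup>2 / \<beta> + K * (M * n1) * n1"
        by (simp add: C_def power_mult_distrib power2_eq_square algebra_simps)
      ultimately show ?thesis unfolding FF_def by linarith
    qed
    have iF: "FF W V W V integrable_on {0..1}" by (rule FF_integrable[OF W W])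
    have iFab: "FF W V W V integrable_on {a..b}" using integrable_subinterval_real[OF iF sub] .
    have "integral {a..b} (\<lambda>s. \<kappa> * (norm (W s))\<^sup>2 - C * n1\<^sup>2) = \<kappa> * n2 - ?h * (C * n1\<^sup>2)"
    proof (rule integral_unique)
      show "((\<lambda>s. \<kappa> * (norm (W s))\<^sup>2 - C * n1\<^sup>2) has_integral \<kappa> * n2 - ?h * (C * n1\<^sup>2)) {a..b}"
        unfolding n2_def using has_integral_const_real[of "C * n1\<^sup>2" a b] ab
        by (intro has_integral_diff has_integral_mult_right integrable_integral iW) auto
    qed
    \<comment> \<open>On the null set \<open>N\<close> the lower bound is replaced by the integrand
      itself, so that the comparison holds at every point.\<close>
    moreover have "integral {a..b} (\<lambda>s. if s \<in> N then FF W V W V s else \<kappa> * (norm (W s))\<^sup>2 - C * n1\<^sup>2)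
        \<le> integral {a..b} (FF W V W V)"
    proof (rule integral_le)
      have "(\<lambda>s. \<kappa> * (norm (W s))\<^sup>2 - C * n1\<^sup>2) integrable_on {a..b}"
        by (intro integrable_diff integrable_on_mult_right iW) auto
      then show "(\<lambda>s. if s \<in> N then FF W V W V s else \<kappa> * (norm (W s))\<^sup>2 - C * n1\<^sup>2) integrable_on {a..b}"
        by (rule integrable_spike[OF _ N(1)]) auto
      show "(if s \<in> N then FF W V W V s else \<kappa> * (norm (W s))\<^sup>2 - C * n1\<^sup>2) \<le> FF W V W V s"
        if "s \<in> {a..b}" for s using lower[of s] that by auto
    qed (rule iFab)
    moreover have "integral {a..b} (\<lambda>s. \<kappa> * (norm (W s))\<^sup>2 - C * n1\<^sup>2) =
        integral {a..b} (\<lambda>s. if s \<in> N then FF W V W V s else \<kappa> * (norm (W s))\<^sup>2 - C * n1\<^sup>2)"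
      by (rule integral_spike[OF N(1)]) auto
    ultimately have 1: "\<kappa> * n2 - ?h * (C * n1\<^sup>2) \<le> integral {a..b} (FF W V W V)" by simp
    have n2: "0 \<le> n2" unfolding n2_def by (rule integral_nonneg[OF iW(2)]) simp
    have "?h * (C * n1\<^sup>2) \<le> ?h * (C * (?h * n2))" using n12 C h by (intro mult_left_mono) auto
    also have "\<dots> \<le> 1 * (C * (?h * n2))" using h C n2 by (intro mult_right_mono) auto
    also have "\<dots> = (C * ?h) * n2" by simp
    also have "\<dots> \<le> \<kappa> * n2" using h n2 by (intro mult_right_mono) auto
    finally have 2: "0 \<le> integral {a..b} (FF W V W V)" using 1 by linarith
    have z: "FF W V W V s = 0" if "s \<in> {0..1} - {a..b}" for s
    proof -
      have "W s = 0" "V s = 0" using that Vz[of s] by (auto simp: W_def)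
      then show ?thesis by (simp add: FF_def g_simps)
    qed
    have "integral {0..1} (FF W V W V) = integral {a..b} (FF W V W V)"
    proof (rule integral_spike_set)
      have "{s \<in> {0..1} - {a..b}. FF W V W V s \<noteq> 0} = {}" using z by blast
      then show "negligible {s \<in> {0..1} - {a..b}. FF W V W V s \<noteq> 0}" by (simp only: negligible_empty)
      have "{s \<in> {a..b} - {0..1}. FF W V W V s \<noteq> 0} = {}" using sub by blast
      then show "negligible {s \<in> {a..b} - {0..1}. FF W V W V s \<noteq> 0}" by (simp only: negligible_empty)
    qed
    moreover have "V 0 = 0" using Vz ab by auto
    ultimately show "0 \<le> II V V" using I1_wd[OF W W] 2 by (simp add: g_simps)
  qed
  have "\<delta> > 0" using \<kappa> C by (simp add: \<delta>_def)
  then show ?thesis using main by blast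
qed

end

section \<open>Focal instants and broken Jacobi fields\<close>

lemma jac_zero_field: "jac R (\<lambda>_. 0) (\<lambda>_. 0)"
  by (auto simp: jac_def blinfun.zero_right)

lemma jac_sum:
  assumes "\<And>i. i < k \<Longrightarrow> jac R (J i) (J' i)"
  shows "jac R (\<lambda>t. \<Sum>i<(k::nat). c i *\<^sub>R J i t) (\<lambda>t. \<Sum>i<k. c i *\<^sub>R J' i t)"
  using assms
proof (induction k)
  case 0
  then show ?case by (simp add: jac_zero_field)
next
  case (Suc k)
  then show ?case using jac_lin[OF Suc.IH Suc.prems[of k], of 1 "c k"] by simp
qed

lemma sum_apply_fun:
  fixes f :: "'i \<Rightarrow> 'x \<Rightarrow> 'b::comm_monoid_add"
  shows "(\<Sum>i\<in>A. f i) t = (\<Sum>i\<in>A. f i t)"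
  by (induction A rule: infinite_finite_induct) auto

lemma glue_lin:
  "a' *\<^sub>R glue a b J Z + b' *\<^sub>R glue a b K T = glue a b (\<lambda>t. a' *\<^sub>R J t + b' *\<^sub>R K t) (\<lambda>t. a' *\<^sub>R Z t + b' *\<^sub>R T t)"
  by (auto simp: glue_def fun_eq_iff scaleR_fun_def)

lemma glue_sum:
  "(\<Sum>i<(k::nat). c i *\<^sub>R glue a b (J i) (Z i)) = glue a b (\<lambda>t. \<Sum>i<k. c i *\<^sub>R J i t) (\<lambda>t. \<Sum>i<k. c i *\<^sub>R Z i t)"
  unfolding fun_eq_iff sum_apply_fun by (simp add: glue_def scaleR_fun_def)

lemma (in jacobi_ode) jac_exists_at:
  assumes t: "t \<in> {0..1}"
  shows "\<exists>J J'. jac R J J' \<and> J t = x \<and> J' t = y"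
proof -
  let ?L = "\<lambda>z. (fl z t, fl' z t)"
  have lin: "linear ?L"
    using linear_fl[OF t] unfolding linear_conv_bounded_linear by (intro bounded_linear_Pair)
  have "inj ?L" unfolding linear_injective_0[OF lin]
  proof (intro allI impI)
    fix z assume "(fl z t, fl' z t) = 0"
    then have "fl z t = 0" "fl' z t = 0" by (auto simp: zero_prod_def)
    then have "fl z 0 = 0" "fl' z 0 = 0" using jac_zero[OF fl(1) t, of z 0] by auto
    then show "z = 0" by (simp add: fl prod_eq_iff)
  qed
  then have "surj ?L" by (rule linear_inj_imp_surj[OF lin])
  then obtain z where "(x, y) = ?L z" by (rule surjE)
  then show ?thesis using fl(1)[of z] by (intro exI[of _ "fl z"] exI[of _ "fl' z"]) simp
qed

context morse_sturm
begin

definition JP :: "(real \<Rightarrow> 'a) \<Rightarrow> (real \<Rightarrow> 'a) \<Rightarrow> bool" where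
  "JP J J' \<longleftrightarrow> jac R J J' \<and> J 0 \<in> P \<and> J' 0 + S (J 0) \<in> gorth g P"

abbreviation "Jt \<equiv> JJt g R P S"

lemma JJ_iff: "J \<in> JJ g R P S \<longleftrightarrow> (\<exists>J'. JP J J')"
  unfolding JJ_def JP_def jacobi_sol_iff using jacD(3)[of R J _ 0] by fastforce

lemma Jt_iff: "x \<in> Jt t \<longleftrightarrow> (\<exists>J J'. JP J J' \<and> J t = x)"
  unfolding JJt_def using JJ_iff by blast

lemma JP_jac: "JP J J' \<Longrightarrow> jac R J J'"
  by (simp add: JP_def)

lemma JP_lin:
  assumes "JP J J'" "JP K K'"
  shows "JP (\<lambda>t. a *\<^sub>R J t + b *\<^sub>R K t) (\<lambda>t. a *\<^sub>R J' t + b *\<^sub>R K' t)"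
proof -
  have "(a *\<^sub>R J' 0 + b *\<^sub>R K' 0) + S (a *\<^sub>R J 0 + b *\<^sub>R K 0) =
      a *\<^sub>R (J' 0 + S (J 0)) + b *\<^sub>R (K' 0 + S (K 0))"
    using assms S_lin[of "J 0" "K 0" a b] by (simp add: JP_def algebra_simps)
  moreover have "a *\<^sub>R (J' 0 + S (J 0)) + b *\<^sub>R (K' 0 + S (K 0)) \<in> gorth g P"
  proof -
    have "J' 0 + S (J 0) \<in> gorth g P" "K' 0 + S (K 0) \<in> gorth g P" using assms by (auto simp: JP_def)
    then show ?thesis by (metis subspace_gorth subspace_add subspace_mul)
  qed
  ultimately show ?thesis
    using assms P(1) jac_lin[of R J J' K K' a b] by (simp add: JP_def subspace_add subspace_mul)
qed

lemma JP_zero: "JP (\<lambda>_. 0) (\<lambda>_. 0)"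
  using jac_zero_field subspace_0[OF P(1)] subspace_0[OF subspace_gorth[of P]]
  by (simp add: JP_def S_zero)

lemma JP_sum:
  assumes "\<And>i. i < k \<Longrightarrow> JP (J i) (J' i)"
  shows "JP (\<lambda>t. \<Sum>i<(k::nat). c i *\<^sub>R J i t) (\<lambda>t. \<Sum>i<k. c i *\<^sub>R J' i t)"
  using assms
proof (induction k)
  case 0
  then show ?case by (simp add: JP_zero)
next
  case (Suc k)
  then show ?case using JP_lin[OF Suc.IH Suc.prems[of k], of 1 "c k"] by simp
qed

lemma JP_diff:
  assumes "JP J J'" "JP K K'"
  shows "JP (\<lambda>t. J t - K t) (\<lambda>t. J' t - K' t)"
  using JP_lin[OF assms, of 1 "-1"] by simp

lemma subspace_Jt: "subspace (Jt t)"
proof (rule subspaceI)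
  show "0 \<in> Jt t" using JP_zero unfolding Jt_iff by blast
  show "x + y \<in> Jt t" if xy: "x \<in> Jt t" "y \<in> Jt t" for x y
  proof -
    obtain J J' K K' where "JP J J'" "J t = x" "JP K K'" "K t = y" using xy unfolding Jt_iff by blast
    then show ?thesis using JP_lin[of J J' K K' 1 1] unfolding Jt_iff by fastforce
  qed
  show "c *\<^sub>R x \<in> Jt t" if x: "x \<in> Jt t" for x c
  proof -
    obtain J J' where "JP J J'" "J t = x" using x unfolding Jt_iff by blast
    then show ?thesis using JP_lin[of J J' J J' c 0] unfolding Jt_iff by fastforce
  qed
qed

lemma JP_initial:
  assumes "p \<in> P" "q \<in> gorth g P"
  shows "\<exists>J J'. JP J J' \<and> J 0 = p \<and> J' 0 = q - S p"
proof -
  obtain J J' where "jac R J J'" "J 0 = p" "J' 0 = q - S p" using jac_exists by blast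
  then show ?thesis using assms by (intro exI[of _ J] exI[of _ J']) (simp add: JP_def)
qed

lemma Jt_0: "Jt 0 = P"
proof
  show "Jt 0 \<subseteq> P" by (auto simp: Jt_iff JP_def)
  show "P \<subseteq> Jt 0" using JP_initial[of _ 0] subspace_0[OF subspace_gorth[of P]] by (fastforce simp: Jt_iff)
qed

text \<open>The initial conditions and the symmetry of \<open>S\<close> make the Wronskian vanish at
  0, and it is constant.\<close>

lemma lagrangian:
  assumes J: "JP J J'" and K: "JP K K'" and t: "t \<in> {0..1}"
  shows "g (J' t) (K t) = g (J t) (K' t)"
proof -
  have 0: "J 0 \<in> P" "K 0 \<in> P" using J K by (auto simp: JP_def)
  have "g (J' 0 + S (J 0)) (K 0) = 0" using J 0 by (auto simp: JP_def gorth_def)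
  moreover have "g (J 0) (K' 0 + S (K 0)) = 0" using K 0 g_sym[of "J 0"] by (auto simp: JP_def gorth_def)
  ultimately have "g (J' 0) (K 0) - g (J 0) (K' 0) = 0" using S_sym[OF 0] by (simp add: g_simps)
  then show ?thesis using wronskian[OF JP_jac[OF J] JP_jac[OF K] t, of 0] by simp
qed

text \<open>The initial conditions defining the fields J form a Lagrangian subspace; maximality shows that the
  solution with data (0, y) at t satisfies them.\<close>

lemma kernel_field:
  assumes t: "t \<in> {0..1}" and y: "y \<in> gorth g (Jt t)"
  shows "\<exists>N N'. JP N N' \<and> N t = 0 \<and> N' t = y"
proof -
  obtain N N' where N: "jac R N N'" "N t = 0" "N' t = y" using jac_exists_at[OF t] by blast
  have w: "g (N' 0) (J 0) = g (N 0) (J' 0)" if J: "JP J J'" for J J'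
  proof -
    have "J t \<in> Jt t" using J Jt_iff by blast
    then have "g (N' t) (J t) - g (N t) (J' t) = 0" using y N by (simp add: gorth_def g_simps)
    then show ?thesis using wronskian[OF N(1) JP_jac[OF J] t, of 0] by simp
  qed
  have "N 0 \<in> gorth g (gorth g P)"
    unfolding gorth_def[of g "gorth g P"]
  proof (intro CollectI ballI)
    fix q assume q: "q \<in> gorth g P"
    obtain J J' where "JP J J'" "J 0 = 0" "J' 0 = q - S 0"
      using JP_initial[OF subspace_0[OF P(1)] q] by blast
    then show "g (N 0) q = 0" using w[of J J'] by (simp add: S_zero g_simps)
  qed
  then have N0: "N 0 \<in> P" using gorth_gorth[OF P] by simp
  have "N' 0 + S (N 0) \<in> gorth g P" unfolding gorth_def
  proof (intro CollectI ballI)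
    fix p assume p: "p \<in> P"
    obtain J J' where "JP J J'" "J 0 = p" "J' 0 = 0 - S p"
      using JP_initial[OF p subspace_0[OF subspace_gorth]] by blast
    then show "g (N' 0 + S (N 0)) p = 0" using w[of J J'] S_sym[OF N0 p] by (simp add: g_simps)
  qed
  then have "JP N N'" using N(1) N0 by (simp add: JP_def)
  then show ?thesis using N by blast
qed

text \<open>A controlled right inverse of evaluation at \<open>t\<close>, built on a Sylvester basis
  of \<open>Jt t\<close>. It supplies a field with the same value as J at \<open>t\<close> whose
  derivative there is bounded by |J t|, which J itself need not satisfy.\<close>

lemma field_section:
  assumes t: "t \<in> {0..1}"
  shows "\<exists>E E'. \<exists>D>0. \<forall>x\<in>Jt t. JP (E x) (E' x) \<and> E x t = x \<and> norm (E' x t) \<le> D * norm x"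
proof -
  obtain k l u where u: "sig_basis (Jt t) k l u" using sig_basis_exists[OF subspace_Jt J_nondeg[OF t]] .
  obtain K where K: "K > 0" "\<And>x y. \<bar>g x y\<bar> \<le> K * norm x * norm y" using g_bound by blast
  have "\<exists>J J'. i < k + l \<longrightarrow> JP J J' \<and> J t = u i" for i
    using u unfolding sig_basis_def Jt_iff by blast
  then obtain J J' where J: "\<And>i. i < k + l \<Longrightarrow> JP (J i) (J' i) \<and> J i t = u i" by metis
  define c where "c x i = (if i < k then - 1 else 1) * g x (u i)" for x i
  define D where "D = 1 + (\<Sum>i<k+l. K * norm (u i) * norm (J' i t))"
  have D: "D > 0" using K unfolding D_def by (intro add_pos_nonneg sum_nonneg) auto
  have "JP (\<lambda>s. \<Sum>i<k+l. c x i *\<^sub>R J i s) (\<lambda>s. \<Sum>i<k+l. c x i *\<^sub>R J' i s)" for x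
    using J by (intro JP_sum) auto
  moreover have "(\<Sum>i<k+l. c x i *\<^sub>R J i t) = x" if "x \<in> Jt t" for x
    using u that J unfolding sig_basis_def c_def by auto
  moreover have "norm (\<Sum>i<k+l. c x i *\<^sub>R J' i t) \<le> D * norm x" for x
  proof -
    have "norm (\<Sum>i<k+l. c x i *\<^sub>R J' i t) \<le> (\<Sum>i<k+l. (K * norm (u i) * norm (J' i t)) * norm x)"
    proof (rule sum_norm_le)
      fix i
      have "norm (c x i *\<^sub>R J' i t) = \<bar>g x (u i)\<bar> * norm (J' i t)" by (simp add: c_def)
      also have "\<dots> \<le> (K * norm x * norm (u i)) * norm (J' i t)" using K by (intro mult_right_mono) auto
      finally show "norm (c x i *\<^sub>R J' i t) \<le> (K * norm (u i) * norm (J' i t)) * norm x" by (simp add: mult_ac)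
    qed
    also have "\<dots> \<le> D * norm x" by (simp add: D_def sum_distrib_right[symmetric] mult_right_mono)
    finally show ?thesis .
  qed
  ultimately show ?thesis using D
    by (intro exI[of _ "\<lambda>x s. \<Sum>i<k+l. c x i *\<^sub>R J i s"] exI[of _ "\<lambda>x s. \<Sum>i<k+l. c x i *\<^sub>R J' i s"] exI[of _ D]) auto
qed

text \<open>As \<open>y\<close> is orthogonal to \<open>C\<close>, the Sylvester coordinates of
  \<open>x\<close> are pairings with \<open>x + y\<close>; hence both projections are
  bounded.\<close>

lemma splitting_bound:
  assumes C: "subspace C" "nondeg_on g C"
  shows "\<exists>D>0. \<forall>x\<in>C. \<forall>y\<in>gorth g C. norm x + norm y \<le> D * norm (x + y)"
proof -
  obtain k l u where u: "sig_basis C k l u" using sig_basis_exists[OF C] .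
  obtain K where K: "K > 0" "\<And>x y. \<bar>g x y\<bar> \<le> K * norm x * norm y" using g_bound by blast
  define D where "D = (\<Sum>i<k+l. K * norm (u i) * norm (u i))"
  have D: "D \<ge> 0" using K unfolding D_def by (intro sum_nonneg) auto
  have "norm x + norm y \<le> (2 * D + 1) * norm (x + y)" if x: "x \<in> C" and y: "y \<in> gorth g C" for x y
  proof -
    have gy: "g x (u i) = g (x + y) (u i)" if "i < k + l" for i
      using u that y unfolding sig_basis_def gorth_def by (simp add: g_simps)
    have "x = (\<Sum>i<k+l. ((if i < k then - 1 else 1) * g x (u i)) *\<^sub>R u i)"
      using u x unfolding sig_basis_def by blast
    then have "norm x = norm (\<Sum>i<k+l. ((if i < k then - 1 else 1) * g x (u i)) *\<^sub>R u i)" by simp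
    also have "\<dots> \<le> (\<Sum>i<k+l. (K * norm (u i) * norm (u i)) * norm (x + y))"
    proof (rule sum_norm_le)
      fix i assume i: "i \<in> {..<k+l}"
      have "norm (((if i < k then - 1 else 1) * g x (u i)) *\<^sub>R u i) = \<bar>g (x + y) (u i)\<bar> * norm (u i)"
        using gy i by simp
      also have "\<dots> \<le> (K * norm (x + y) * norm (u i)) * norm (u i)" using K by (intro mult_right_mono) auto
      finally show "norm (((if i < k then - 1 else 1) * g x (u i)) *\<^sub>R u i) \<le> (K * norm (u i) * norm (u i)) * norm (x + y)"
        by (simp add: mult_ac)
    qed
    finally have 1: "norm x \<le> D * norm (x + y)" by (simp add: D_def sum_distrib_right)
    have "norm y \<le> norm (x + y) + norm x" using norm_triangle_ineq4[of "x + y" x] by simp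
    then show ?thesis using 1 by (simp add: algebra_simps)
  qed
  then show ?thesis using D by (intro exI[of _ "2 * D + 1"]) auto
qed

text \<open>Let J vanish at t. Write J = E x + N with x = J \<tau> and N \<tau> = 0, and put v = N'
  \<tau>. Taylor's formula makes x + (t - \<tau>) v small compared with its two parts. Since x lies
  in \<open>Jt \<tau>\<close> and v in its orthogonal complement, both are zero for t near \<tau>,
  and so is J. By \<open>kernel_field\<close> the complement of \<open>Jt t\<close> is then
  trivial.\<close>

lemma nonfocal_nearby:
  assumes \<tau>: "\<tau> \<in> {0..1}"
  shows "\<exists>\<delta>>0. \<forall>t\<in>{0..1}. t \<noteq> \<tau> \<longrightarrow> \<bar>t - \<tau>\<bar> < \<delta> \<longrightarrow> Jt t = UNIV"
proof -
  obtain E E' D where D: "D > 0"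
    and E: "\<And>x. x \<in> Jt \<tau> \<Longrightarrow> JP (E x) (E' x) \<and> E x \<tau> = x \<and> norm (E' x \<tau>) \<le> D * norm x"
    using field_section[OF \<tau>] by blast
  obtain B where B: "B > 0" "\<And>x y. x \<in> Jt \<tau> \<Longrightarrow> y \<in> gorth g (Jt \<tau>) \<Longrightarrow> norm x + norm y \<le> B * norm (x + y)"
    using splitting_bound[OF subspace_Jt J_nondeg[OF \<tau>]] by blast
  obtain C where C: "C > 0" "\<And>J J' s t. jac R J J' \<Longrightarrow> s \<in> {0..1} \<Longrightarrow> t \<in> {0..1} \<Longrightarrow>
      norm (J t - J s) \<le> C * \<bar>t - s\<bar> * (norm (J s) + norm (J' s)) \<and>
      norm (J t - J s - (t - s) *\<^sub>R J' s) \<le> C * (t - s)\<^sup>2 * (norm (J s) + norm (J' s))"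
    using jac_estimates by blast
  define \<delta> where "\<delta> = 1 / (B * C * (1 + D))"
  have "\<delta> > 0" using B C D by (simp add: \<delta>_def)
  moreover have "Jt t = UNIV" if t: "t \<in> {0..1}" "t \<noteq> \<tau>" "\<bar>t - \<tau>\<bar> < \<delta>" for t
  proof -
    have "y = 0" if y: "y \<in> gorth g (Jt t)" for y
    proof -
      obtain J J' where J: "JP J J'" "J t = 0" "J' t = y" using kernel_field[OF t(1) y] by blast
      define x where "x = J \<tau>"
      have x: "x \<in> Jt \<tau>" using J unfolding x_def Jt_iff by blast
      define N where "N s = J s - E x s" for s
      define N' where "N' s = J' s - E' x s" for s
      have N: "JP N N'" unfolding N_def N'_def using J E[OF x] by (intro JP_diff) auto
      have N\<tau>: "N \<tau> = 0" using E[OF x] by (simp add: N_def x_def)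
      define v where "v = N' \<tau>"
      have v: "v \<in> gorth g (Jt \<tau>)" unfolding gorth_def
      proof (intro CollectI ballI)
        fix w assume "w \<in> Jt \<tau>"
        then obtain K K' where "JP K K'" "K \<tau> = w" unfolding Jt_iff by blast
        then show "g v w = 0" using lagrangian[OF N _ \<tau>, of K K'] N\<tau> by (simp add: v_def g_simps)
      qed
      define h where "h = t - \<tau>"
      have hv: "h *\<^sub>R v \<in> gorth g (Jt \<tau>)" using v subspace_gorth by (simp add: subspace_mul)
      have e1: "norm (E x t - x) \<le> C * \<bar>h\<bar> * (norm x + D * norm x)"
      proof -
        have "norm (E x t - E x \<tau>) \<le> C * \<bar>t - \<tau>\<bar> * (norm (E x \<tau>) + norm (E' x \<tau>))"
          using C(2)[OF JP_jac[OF conjunct1[OF E[OF x]]] \<tau> t(1)] by blast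
        also have "\<dots> \<le> C * \<bar>h\<bar> * (norm x + D * norm x)"
          using E[OF x] C(1) unfolding h_def by (intro mult_left_mono add_mono) auto
        finally show ?thesis using E[OF x] by simp
      qed
      \<comment> \<open>The second-order remainder is small against |h v|; a first-order bound on N
        t would be of the same size and useless here.\<close>
      have e2: "norm (N t - h *\<^sub>R v) \<le> C * h\<^sup>2 * norm v"
        using C(2)[OF JP_jac[OF N] \<tau> t(1)] N\<tau> by (simp add: h_def v_def)
      have "E x t + N t = 0" using J(2) by (simp add: N_def)
      then have "x + h *\<^sub>R v = - ((E x t - x) + (N t - h *\<^sub>R v))" by (simp add: algebra_simps add_eq_0_iff)
      then have "norm (x + h *\<^sub>R v) \<le> norm (E x t - x) + norm (N t - h *\<^sub>R v)"
        by (metis norm_minus_cancel norm_triangle_ineq)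
      also have "\<dots> \<le> C * \<bar>h\<bar> * (norm x + D * norm x) + C * h\<^sup>2 * norm v" using e1 e2 by linarith
      also have "C * h\<^sup>2 * norm v = C * \<bar>h\<bar> * norm (h *\<^sub>R v)"
        by (simp add: power2_eq_square abs_mult_self_eq[symmetric, of h] mult_ac del: abs_mult_self_eq)
      also have "C * \<bar>h\<bar> * (norm x + D * norm x) + C * \<bar>h\<bar> * norm (h *\<^sub>R v) \<le>
          C * \<bar>h\<bar> * ((1 + D) * (norm x + norm (h *\<^sub>R v)))"
        unfolding distrib_left[symmetric] using C(1) D by (intro mult_left_mono) (auto simp: algebra_simps)
      finally have "norm x + norm (h *\<^sub>R v) \<le> B * (C * \<bar>h\<bar> * ((1 + D) * (norm x + norm (h *\<^sub>R v))))"
        using B(2)[OF x hv] B(1) by (meson mult_left_mono less_imp_le order_trans)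
      then have le: "norm x + norm (h *\<^sub>R v) \<le> (B * C * (1 + D) * \<bar>h\<bar>) * (norm x + norm (h *\<^sub>R v))"
        by (simp add: mult_ac)
      have "B * C * (1 + D) > 0" using B C D by simp
      then have lt: "B * C * (1 + D) * \<bar>h\<bar> < 1"
        using t(3) unfolding \<delta>_def h_def by (simp only: pos_less_divide_eq mult.commute)
      have "norm x + norm (h *\<^sub>R v) = 0"
      proof (rule ccontr)
        assume "norm x + norm (h *\<^sub>R v) \<noteq> 0"
        then have "0 < norm x + norm (h *\<^sub>R v)" by (metis add_nonneg_nonneg norm_ge_zero order_le_less)
        then have "(B * C * (1 + D) * \<bar>h\<bar>) * (norm x + norm (h *\<^sub>R v)) < 1 * (norm x + norm (h *\<^sub>R v))"
          using lt by (rule mult_strict_right_mono[rotated])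
        then show False using le by simp
      qed
      then have "norm x = 0" "norm (h *\<^sub>R v) = 0"
        using norm_ge_zero[of x] norm_ge_zero[of "h *\<^sub>R v"] by linarith+
      then have x0: "x = 0" and v0: "v = 0" using t(2) by (auto simp: h_def)
      have "norm (E' x \<tau>) \<le> 0" using E[OF x] x0 by auto
      then have "J' \<tau> = 0" using v0 by (simp add: v_def N'_def)
      then have "J' t = 0" using jac_zero(2)[OF JP_jac[OF J(1)] \<tau> _ _ t(1)] x0 x_def by simp
      then show "y = 0" using J(3) by simp
    qed
    then have "gorth g (Jt t) = {0}" using subspace_0[OF subspace_gorth] by blast
    then have "gorth g (gorth g (Jt t)) = UNIV" by (simp add: gorth_def g_simps)
    then show ?thesis using gorth_gorth[OF subspace_Jt J_nondeg[OF t(1)]] by simp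
  qed
  ultimately show ?thesis by blast
qed

text \<open>Integration by parts on [0, a] and on [a, b] leaves the kink at a. The term at 0
  combines with \<open>S\<close> and vanishes by the initial condition on J.\<close>

lemma I_jacobi_glue:
  assumes V: "V \<in> H1P P" "V b = 0" and J: "JP J J'" and Z: "jac R Z Z'" "Z a = J a" "Z b = 0"
    and ab: "0 \<le> a" "a \<le> b" "b \<le> 1"
  shows "II V (glue a b J Z) = g (V a) (J' a - Z' a)"
proof -
  obtain W where W: "wd V W" and V0: "V 0 \<in> P" using V by (auto simp: H1P_iff)
  have J0: "J 0 \<in> P" "g (V 0) (J' 0 + S (J 0)) = 0"
    using J V0 g_sym[of "V 0"] by (auto simp: JP_def gorth_def)
  have "II V (glue a b J Z) = integral {0..a} (FF W V J' J) + integral {a..b} (FF W V Z' Z) - g (S (V 0)) (J 0)"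
    using J Z ab by (intro I_glue W wd_jac) (auto simp: JP_def)
  also have "integral {0..a} (FF W V J' J) = g (V a) (J' a) - g (V 0) (J' 0)"
    using J ab by (intro FF_jacobi W) (auto simp: JP_def)
  also have "integral {a..b} (FF W V Z' Z) = g (V b) (Z' b) - g (V a) (Z' a)"
    using Z ab by (intro FF_jacobi W) auto
  finally show ?thesis using V(2) J0 S_sym[OF V0 J0(1)] by (simp add: g_simps)
qed

lemma glue_in_H1P:
  assumes J: "wd A A'" "A 0 \<in> P" and Z: "wd Z Z'" "Z a = A a" "Z b = 0" and ab: "0 \<le> a" "a < b" "b \<le> 1"
  shows "glue a b A Z \<in> H1P P" "t \<ge> b \<Longrightarrow> glue a b A Z t = 0"
proof -
  show *: "glue a b A Z t = 0" if "t \<ge> b" for t using that Z ab by (auto simp: glue_def)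
  have "wd (glue a b A Z) (glue a b A' Z')" using assms by (intro wd_glue) auto
  then show "glue a b A Z \<in> H1P P" using J ab *[of 1] by (auto simp: H1P_iff glue_def)
qed

text \<open>Fields J up to time a, continued by the Jacobi field that joins J a to 0 at time b.\<close>

definition JT :: "((real \<Rightarrow> 'a) \<Rightarrow> bool) \<Rightarrow> real \<Rightarrow> real \<Rightarrow> (real \<Rightarrow> 'a) set" where
  "JT Q a b = {glue a b J Z | J J' Z Z'. JP J J' \<and> jac R Z Z' \<and> Z a = J a \<and> Z b = 0 \<and> Q J}"

text \<open>Altering J by a field that vanishes at the distinguished endpoint does not change the left-hand side,
  so J may be chosen with Cauchy data bounded by J at that endpoint.\<close>

lemma energy_estimate:
  assumes \<tau>: "\<tau> \<in> {0..1}"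
  shows "\<exists>\<delta>>0. \<exists>D>0. \<forall>a b J J' Z Z'. 0 \<le> a \<longrightarrow> a < b \<longrightarrow> b \<le> 1 \<longrightarrow> b - a < \<delta> \<longrightarrow> \<tau> = a \<or> \<tau> = b \<longrightarrow>
    JP J J' \<longrightarrow> jac R Z Z' \<longrightarrow> Z a = J a \<longrightarrow> Z b = 0 \<longrightarrow>
    \<bar>(b - a) * II (glue a b J Z) (glue a b J Z) - g (J \<tau>) (J \<tau>)\<bar> \<le> D * (b - a) * (norm (J \<tau>))\<^sup>2"
proof -
  obtain E E' D where D: "D > 0"
    and E: "\<And>x. x \<in> Jt \<tau> \<Longrightarrow> JP (E x) (E' x) \<and> E x \<tau> = x \<and> norm (E' x \<tau>) \<le> D * norm x"
    using field_section[OF \<tau>] by blast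
  obtain \<delta> B where \<delta>: "\<delta> > 0" and B: "B > 0" and bvp0: "\<forall>a b. 0 \<le> a \<longrightarrow> a < b \<longrightarrow> b \<le> 1 \<longrightarrow> b - a < \<delta> \<longrightarrow>
     (\<forall>Z Z'. jac R Z Z' \<longrightarrow> Z b = 0 \<longrightarrow> norm ((b - a) *\<^sub>R Z' a + Z a) \<le> B * (b - a) * norm (Z a)) \<and>
     (\<forall>x y. \<exists>Z Z'. jac R Z Z' \<and> Z a = x \<and> Z b = y)"
    using boundary_value_problem by (elim exE conjE) (rule that)
  have bvp: "norm ((b - a) *\<^sub>R Z' a + Z a) \<le> B * (b - a) * norm (Z a)"
    if "0 \<le> a" "a < b" "b \<le> 1" "b - a < \<delta>" "jac R Z Z'" "Z b = 0" for a b Z Z'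
    by (rule bvp0[rule_format, OF that(1-4), THEN conjunct1, rule_format, OF that(5,6)])
  have solve: "\<exists>Z Z'. jac R Z Z' \<and> Z a = x \<and> Z b = y" if "0 \<le> a" "a < b" "b \<le> 1" "b - a < \<delta>" for a b x y
    by (rule bvp0[rule_format, OF that, THEN conjunct2, rule_format])
  obtain C where C: "C > 0" "\<And>J J' s t. jac R J J' \<Longrightarrow> s \<in> {0..1} \<Longrightarrow> t \<in> {0..1} \<Longrightarrow>
      norm (J t) + norm (J' t) \<le> C * (norm (J s) + norm (J' s)) \<and>
      norm (J t - J s) \<le> C * \<bar>t - s\<bar> * (norm (J s) + norm (J' s))"
    using jac_estimates by blast
  obtain K where K: "K > 0" "\<And>x y. \<bar>g x y\<bar> \<le> K * norm x * norm y" using g_bound by blast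
  define G where "G = C * (1 + D)"
  \<comment> \<open>One summand each for the error terms \<open>b1\<close> and \<open>b2\<close>
    below, and one for \<open>b3\<close> and \<open>b4\<close> together.\<close>
  define Q where "Q = K * G * G + K * G * (B * G) + K * G * (G + 1)"
  have G: "G > 0" using C D by (simp add: G_def)
  have Q: "Q > 0" unfolding Q_def using K G B by (intro add_pos_pos mult_pos_pos) auto
  have main: "\<bar>(b - a) * II (glue a b J Z) (glue a b J Z) - g (J \<tau>) (J \<tau>)\<bar> \<le> Q * (b - a) * (norm (J \<tau>))\<^sup>2"
    if ab: "0 \<le> a" "a < b" "b \<le> 1" "b - a < \<delta>" and \<tau>ab: "\<tau> = a \<or> \<tau> = b"
      and J: "JP J J'" and Z: "jac R Z Z'" "Z a = J a" "Z b = 0" for a b J J' Z Z'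
  proof -
    let ?h = "b - a"
    have a01: "a \<in> {0..1}" and b01: "b \<in> {0..1}" using ab by auto
    have zero_deriv: "T' a = 0" if "jac R T T'" "T a = 0" "T b = 0" for T T'
    proof -
      have "norm (?h *\<^sub>R T' a + T a) \<le> B * ?h * norm (T a)" by (rule bvp[OF ab that(1,3)])
      then have "?h * norm (T' a) \<le> 0" using that ab by simp
      then show ?thesis using ab(2) by (simp add: mult_le_0_iff)
    qed
    define x where "x = J \<tau>"
    have x: "x \<in> Jt \<tau>" using J unfolding x_def Jt_iff by blast
    have Ex: "JP (E x) (E' x)" "E x \<tau> = x" "norm (E' x \<tau>) \<le> D * norm x" using E[OF x] by auto
    obtain T T' where T: "jac R T T'" "T a = E x a" "T b = 0" using solve[OF ab] by blast
    define N where "N s = J s - E x s" for s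
    define N' where "N' s = J' s - E' x s" for s
    have N: "JP N N'" unfolding N_def N'_def using J Ex by (intro JP_diff) auto
    have N\<tau>: "N \<tau> = 0" using Ex by (simp add: N_def x_def)
    define U where "U s = Z s - T s" for s
    define U' where "U' s = Z' s - T' s" for s
    have U: "jac R U U'" unfolding U_def U'_def using jac_lin[OF Z(1) T(1), of 1 "-1"] by simp
    have U1: "U a = N a" "U b = 0" using Z T by (auto simp: U_def N_def)
    let ?V = "glue a b J Z"
    have VX: "?V \<in> H1P P" "?V b = 0"
      using glue_in_H1P[of J J' Z Z' a b] J Z ab wd_jac by (auto simp: JP_def)
    have "II ?V ?V = g (?V a) (J' a - Z' a)" using VX J Z ab by (intro I_jacobi_glue) auto
    also have "?V a = J a" by (simp add: glue_def)
    also have "g (J a) (J' a - Z' a) = g (J a) (E' x a - T' a) + g (J a) (N' a - U' a)"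
      by (simp add: N'_def U'_def g_simps)
    \<comment> \<open>If \<tau> = a, the field U vanishes at both ends and the Lagrangian identity
      removes N' a. If \<tau> = b, then N - U vanishes at both ends, so N continued by U has no
      kink.\<close>
    also have "g (J a) (N' a - U' a) = 0"
      using \<tau>ab
    proof
      assume "\<tau> = a"
      then have Na: "N a = 0" using N\<tau> by simp
      have "U' a = 0" using zero_deriv[OF U] U1 Na by simp
      moreover have "g (J a) (N' a) = 0" using lagrangian[OF J N a01] Na by (simp add: g_simps)
      ultimately show ?thesis by (simp add: g_simps)
    next
      assume "\<tau> = b"
      then have Nb: "N b = 0" using N\<tau> by simp
      have "jac R (\<lambda>s. N s - U s) (\<lambda>s. N' s - U' s)"
        using jac_lin[OF JP_jac[OF N] U, of 1 "-1"] by simp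
      from zero_deriv[OF this] have "N' a - U' a = 0" using U1 Nb by simp
      then show ?thesis by (simp add: g_simps)
    qed
    also have "g (J a) (E' x a - T' a) = g (E x a) (E' x a - T' a) + g (N a) (E' x a - T' a)"
      by (simp add: N_def g_simps)
    \<comment> \<open>The other cross term. For \<tau> = b it follows from the Wronskian of N and T,
      zero because both vanish at b, together with the Lagrangian identity for N and E x.\<close>
    also have "g (N a) (E' x a - T' a) = 0"
      using \<tau>ab
    proof
      assume "\<tau> = a"
      then show ?thesis using N\<tau> by (simp add: g_simps)
    next
      assume "\<tau> = b"
      then have Nb: "N b = 0" using N\<tau> by simp
      have "g (N' a) (T a) - g (N a) (T' a) = g (N' b) (T b) - g (N b) (T' b)"
        by (rule wronskian[OF JP_jac[OF N] T(1) a01 b01])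
      then have "g (N a) (T' a) = g (N' a) (E x a)" using Nb T by (simp add: g_simps)
      moreover have "g (N a) (E' x a) = g (N' a) (E x a)" using lagrangian[OF N Ex(1) a01] by simp
      ultimately show ?thesis by (simp add: g_simps)
    qed
    finally have II: "II ?V ?V = g (E x a) (E' x a - T' a)" by simp
    have sum\<tau>: "norm (E x \<tau>) + norm (E' x \<tau>) \<le> (1 + D) * norm x" using Ex by (simp add: algebra_simps)
    have "norm (E x a) + norm (E' x a) \<le> C * (norm (E x \<tau>) + norm (E' x \<tau>))"
      using C(2)[OF JP_jac[OF Ex(1)] \<tau> a01] by blast
    also have "\<dots> \<le> C * ((1 + D) * norm x)" using sum\<tau> C by (intro mult_left_mono) auto
    finally have Ea: "norm (E x a) + norm (E' x a) \<le> G * norm x" by (simp add: G_def mult_ac)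
    have Ea1: "norm (E x a) \<le> G * norm x" "norm (E' x a) \<le> G * norm x"
      using Ea norm_ge_zero[of "E x a"] norm_ge_zero[of "E' x a"] by linarith+
    have "norm (E x a - E x \<tau>) \<le> C * \<bar>a - \<tau>\<bar> * (norm (E x \<tau>) + norm (E' x \<tau>))"
      using C(2)[OF JP_jac[OF Ex(1)] \<tau> a01] by blast
    also have "\<dots> \<le> C * ?h * ((1 + D) * norm x)"
      using sum\<tau> C \<tau>ab ab by (intro mult_mono) auto
    finally have Eax: "norm (E x a - x) \<le> G * ?h * norm x" using Ex by (simp add: G_def mult_ac)
    have "norm (?h *\<^sub>R T' a + T a) \<le> B * ?h * norm (T a)" by (rule bvp[OF ab T(1,3)])
    also have "\<dots> \<le> B * ?h * (G * norm x)" using Ea1 B ab T by (intro mult_left_mono) auto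
    finally have T1: "norm (?h *\<^sub>R T' a + E x a) \<le> B * ?h * (G * norm x)" using T by simp
    \<comment> \<open>Since h T' a is close to - E x a, the leading part of h II is g(E x a, E x a),
      which in turn is close to g(x, x).\<close>
    have eq: "?h * II ?V ?V - g x x = ?h * g (E x a) (E' x a) - g (E x a) (?h *\<^sub>R T' a + E x a)
        + (g (E x a - x) (E x a) + g x (E x a - x))"
      unfolding II by (simp add: g_simps algebra_simps)
    have b1: "\<bar>?h * g (E x a) (E' x a)\<bar> \<le> ?h * (K * (G * norm x) * (G * norm x))"
    proof -
      have "\<bar>g (E x a) (E' x a)\<bar> \<le> K * norm (E x a) * norm (E' x a)" by (rule K)
      also have "\<dots> \<le> K * (G * norm x) * (G * norm x)" using Ea1 K G by (intro mult_mono) auto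
      finally show ?thesis using ab by (simp add: abs_mult)
    qed
    have b2: "\<bar>g (E x a) (?h *\<^sub>R T' a + E x a)\<bar> \<le> K * (G * norm x) * (B * ?h * (G * norm x))"
    proof -
      have "\<bar>g (E x a) (?h *\<^sub>R T' a + E x a)\<bar> \<le> K * norm (E x a) * norm (?h *\<^sub>R T' a + E x a)" by (rule K)
      also have "\<dots> \<le> K * (G * norm x) * (B * ?h * (G * norm x))" using Ea1 T1 K G by (intro mult_mono) auto
      finally show ?thesis .
    qed
    have b3: "\<bar>g (E x a - x) (E x a)\<bar> \<le> K * (G * ?h * norm x) * (G * norm x)"
    proof -
      have "\<bar>g (E x a - x) (E x a)\<bar> \<le> K * norm (E x a - x) * norm (E x a)" by (rule K)
      also have "\<dots> \<le> K * (G * ?h * norm x) * (G * norm x)" using Ea1 Eax K G ab by (intro mult_mono) auto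
      finally show ?thesis .
    qed
    have b4: "\<bar>g x (E x a - x)\<bar> \<le> K * norm x * (G * ?h * norm x)"
    proof -
      have "\<bar>g x (E x a - x)\<bar> \<le> K * norm x * norm (E x a - x)" by (rule K)
      also have "\<dots> \<le> K * norm x * (G * ?h * norm x)" using Eax K by (intro mult_left_mono) auto
      finally show ?thesis .
    qed
    have "\<bar>?h * II ?V ?V - g x x\<bar> \<le> ?h * (K * (G * norm x) * (G * norm x)) +
        K * (G * norm x) * (B * ?h * (G * norm x)) + (K * (G * ?h * norm x) * (G * norm x) + K * norm x * (G * ?h * norm x))"
      unfolding eq using b1 b2 b3 b4 by linarith
    also have "\<dots> = Q * ?h * (norm x)\<^sup>2"
      by (simp add: Q_def power2_eq_square algebra_simps)
    finally show ?thesis by (simp add: x_def)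
  qed
  show ?thesis
    by (rule exI[of _ \<delta>], rule conjI[OF \<delta>], rule exI[of _ Q], rule conjI[OF Q]) (intro allI impI, rule main)
qed

lemma JTI:
  "JP J J' \<Longrightarrow> jac R Z Z' \<Longrightarrow> Z a = J a \<Longrightarrow> Z b = 0 \<Longrightarrow> Q J \<Longrightarrow> V = glue a b J Z \<Longrightarrow> V \<in> JT Q a b"
  unfolding JT_def by blast

lemma subspace_JT:
  assumes Q: "Q (\<lambda>_. 0)" "\<And>J K a b. Q J \<Longrightarrow> Q K \<Longrightarrow> Q (\<lambda>t. a *\<^sub>R J t + b *\<^sub>R K t)"
  shows "subspace (JT Q a b)"
proof (rule subspaceI)
  show "0 \<in> JT Q a b"
    by (rule JTI[of "\<lambda>_. 0" "\<lambda>_. 0" "\<lambda>_. 0" "\<lambda>_. 0"])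
      (use JP_zero jac_zero_field Q in \<open>auto simp: glue_def fun_eq_iff\<close>)
next
  fix v w assume "v \<in> JT Q a b" "w \<in> JT Q a b"
  then obtain J J' Z Z' K K' T T' where v: "v = glue a b J Z" "JP J J'" "jac R Z Z'" "Z a = J a" "Z b = 0" "Q J"
    and w: "w = glue a b K T" "JP K K'" "jac R T T'" "T a = K a" "T b = 0" "Q K" unfolding JT_def by blast
  show "v + w \<in> JT Q a b"
  proof (rule JTI[OF JP_lin[OF v(2) w(2), of 1 1] jac_lin[OF v(3) w(3), of 1 1]])
    show "v + w = glue a b (\<lambda>t. 1 *\<^sub>R J t + 1 *\<^sub>R K t) (\<lambda>t. 1 *\<^sub>R Z t + 1 *\<^sub>R T t)"
      using glue_lin[of 1 a b J Z 1 K T] v(1) w(1) by simp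
  qed (use v w Q(2)[OF v(6) w(6), of 1 1] in auto)
next
  fix v and c :: real assume "v \<in> JT Q a b"
  then obtain J J' Z Z' where v: "v = glue a b J Z" "JP J J'" "jac R Z Z'" "Z a = J a" "Z b = 0" "Q J"
    unfolding JT_def by blast
  show "c *\<^sub>R v \<in> JT Q a b"
  proof (rule JTI[OF JP_lin[OF v(2) v(2), of c 0] jac_lin[OF v(3) v(3), of c 0]])
    show "c *\<^sub>R v = glue a b (\<lambda>t. c *\<^sub>R J t + 0 *\<^sub>R J t) (\<lambda>t. c *\<^sub>R Z t + 0 *\<^sub>R Z t)"
      using glue_lin[of c a b J Z 0 J Z] v(1) by simp
  qed (use v Q(2)[OF v(6) v(6), of c 0] in auto)
qed

lemma JT_subset: 
  assumes "0 \<le> a" "a < b" "b \<le> 1"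
  shows "JT Q a b \<subseteq> H1P P"
  using glue_in_H1P(1)[OF wd_jac _ wd_jac] assms unfolding JT_def JP_def by fastforce

text \<open>The rescaled form differs from g(J \<tau>, J \<tau>) by at most D (b - a) |J \<tau>|^2,
  while |x|^2 is at most B |g(x, x)| both on the negative span and on its complement in
  \<open>Jt \<tau>\<close>. On short intervals the signs therefore agree. Fields with J \<tau> = 0
  fall into the nonnegative part, so the possibly larger dimension of \<open>JT\<close> adds
  nothing.\<close>

lemma JT_index:
  assumes \<tau>: "\<tau> \<in> {0..1}" and k: "has_index g (Jt \<tau>) k"
  shows "\<exists>\<delta>>0. \<forall>a b. 0 \<le> a \<longrightarrow> a < b \<longrightarrow> b \<le> 1 \<longrightarrow> b - a < \<delta> \<longrightarrow> \<tau> = a \<or> \<tau> = b \<longrightarrow> has_index II (JT (\<lambda>_. True) a b) k"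
proof -
  let ?C = "Jt \<tau>"
  obtain k' l u where u: "sig_basis ?C k' l u" and "has_index g ?C k'"
    using sig_basis_exists[OF subspace_Jt J_nondeg[OF \<tau>]] by metis
  then have kk: "k' = k" using has_index_unique[OF _ k subspace_Jt] by simp
  have uC: "\<And>i. i < k + l \<Longrightarrow> u i \<in> ?C"
    and uu: "\<And>i j. i < k + l \<Longrightarrow> j < k + l \<Longrightarrow> g (u i) (u j) = (if i = j then (if i < k then - 1 else 1) else 0)"
    and ux: "\<And>x. x \<in> ?C \<Longrightarrow> x = (\<Sum>i<k+l. ((if i < k then - 1 else 1) * g x (u i)) *\<^sub>R u i)"
    using u unfolding sig_basis_def kk by auto
  \<comment> \<open>Each |c i| is at most the Euclidean norm of \<open>c\<close>, which yields the
    sum; the summand 1 secures positivity.\<close>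
  define B where "B = 1 + (\<Sum>i<k+l. norm (u i))\<^sup>2"
  have B: "B > 0" unfolding B_def by (simp add: add_pos_nonneg)
  have normle: "(norm (\<Sum>i<k+l. c i *\<^sub>R u i))\<^sup>2 \<le> B * (\<Sum>i<k+l. (c i)\<^sup>2)" for c
  proof -
    let ?s = "\<Sum>i<k+l. (c i)\<^sup>2"
    have s: "?s \<ge> 0" by (intro sum_nonneg) auto
    have ci: "\<bar>c i\<bar> \<le> sqrt ?s" if "i < k + l" for i
    proof -
      have "(c i)\<^sup>2 \<le> ?s" using that by (intro member_le_sum) auto
      then show ?thesis using real_sqrt_le_mono by fastforce
    qed
    have "norm (\<Sum>i<k+l. c i *\<^sub>R u i) \<le> (\<Sum>i<k+l. sqrt ?s * norm (u i))"
      using ci by (intro sum_norm_le) (auto intro: mult_right_mono)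
    then have "norm (\<Sum>i<k+l. c i *\<^sub>R u i) \<le> sqrt ?s * (\<Sum>i<k+l. norm (u i))" by (simp add: sum_distrib_left)
    then have "(norm (\<Sum>i<k+l. c i *\<^sub>R u i))\<^sup>2 \<le> (sqrt ?s * (\<Sum>i<k+l. norm (u i)))\<^sup>2"
      by (intro power_mono) auto
    also have "\<dots> = ?s * (\<Sum>i<k+l. norm (u i))\<^sup>2" using s by (simp add: power_mult_distrib)
    also have "\<dots> \<le> B * ?s" using s by (simp add: B_def algebra_simps)
    finally show ?thesis .
  qed
  have gxx: "g (\<Sum>i<k+l. c i *\<^sub>R u i) (\<Sum>i<k+l. c i *\<^sub>R u i) = (\<Sum>i<k+l. (if i < k then - 1 else 1) * (c i)\<^sup>2)" for c
  proof -
    let ?x = "\<Sum>i<k+l. c i *\<^sub>R u i"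
    have gu: "g ?x (u j) = (if j < k then - 1 else 1) * c j" if "j < k + l" for j
    proof -
      have "g ?x (u j) = (\<Sum>i<k+l. c i * g (u i) (u j))" by (rule form_sum) auto
      also have "\<dots> = (\<Sum>i<k+l. if i = j then (if j < k then - 1 else 1) * c j else 0)"
        using uu that by (intro sum.cong) auto
      finally show ?thesis using that by simp
    qed
    have "g ?x ?x = (\<Sum>i<k+l. c i * g ?x (u i))" by (rule form_sum_right) auto
    also have "\<dots> = (\<Sum>i<k+l. (if i < k then - 1 else 1) * (c i)\<^sup>2)"
      using gu by (intro sum.cong) (auto simp: power2_eq_square)
    finally show ?thesis .
  qed
  have neg: "(norm x)\<^sup>2 \<le> - B * g x x" if x: "x = (\<Sum>i<k. c i *\<^sub>R u i)" for x c
  proof -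
    define c' where "c' i = (if i < k then c i else 0)" for i
    have "x = (\<Sum>i<k+l. c' i *\<^sub>R u i)" unfolding x
      by (rule sum.mono_neutral_cong_left) (auto simp: c'_def)
    moreover have "(\<Sum>i<k+l. (if i < k then - 1 else 1) * (c' i)\<^sup>2) = - (\<Sum>i<k+l. (c' i)\<^sup>2)"
      unfolding sum_negf[symmetric] by (intro sum.cong) (auto simp: c'_def)
    ultimately show ?thesis using normle[of c'] gxx[of c'] by simp
  qed
  have pos: "(norm x)\<^sup>2 \<le> B * g x x" if x: "x \<in> ?C" "\<And>i. i < k \<Longrightarrow> g x (u i) = 0" for x
  proof -
    define c where "c i = (if i < k then - 1 else 1) * g x (u i)" for i
    have xc: "x = (\<Sum>i<k+l. c i *\<^sub>R u i)" unfolding c_def by (rule ux[OF x(1)])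
    moreover have "(\<Sum>i<k+l. (if i < k then - 1 else 1) * (c i)\<^sup>2) = (\<Sum>i<k+l. (c i)\<^sup>2)"
      using x(2) by (intro sum.cong) (auto simp: c_def)
    ultimately show ?thesis using normle[of c] gxx[of c] by simp
  qed
  obtain \<delta>1 D where \<delta>1: "\<delta>1 > 0" and D: "D > 0"
    and en0: "\<forall>a b J J' Z Z'. 0 \<le> a \<longrightarrow> a < b \<longrightarrow> b \<le> 1 \<longrightarrow> b - a < \<delta>1 \<longrightarrow> \<tau> = a \<or> \<tau> = b \<longrightarrow>
    JP J J' \<longrightarrow> jac R Z Z' \<longrightarrow> Z a = J a \<longrightarrow> Z b = 0 \<longrightarrow>
    \<bar>(b - a) * II (glue a b J Z) (glue a b J Z) - g (J \<tau>) (J \<tau>)\<bar> \<le> D * (b - a) * (norm (J \<tau>))\<^sup>2"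
    using energy_estimate[OF \<tau>] by (elim exE conjE) (rule that)
  note en = en0[rule_format]
  obtain \<delta>2 where \<delta>2: "\<delta>2 > 0" and solve0: "\<forall>a b x y. 0 \<le> a \<longrightarrow> a < b \<longrightarrow> b \<le> 1 \<longrightarrow> b - a < \<delta>2 \<longrightarrow>
     (\<exists>Z Z'. jac R Z Z' \<and> Z a = x \<and> Z b = y)"
    using boundary_value_solvable by (elim exE conjE) (rule that)
  note solve = solve0[rule_format]
  define \<delta> where "\<delta> = min (min \<delta>1 \<delta>2) (1 / (B * D))"
  have "\<delta> > 0" using \<delta>1 \<delta>2 B D by (simp add: \<delta>_def)
  moreover have "has_index II (JT (\<lambda>_. True) a b) k"
    if ab: "0 \<le> a" "a < b" "b \<le> 1" "b - a < \<delta>" and \<tau>ab: "\<tau> = a \<or> \<tau> = b" for a b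
  proof -
    let ?h = "b - a"
    have h: "?h > 0" "?h < \<delta>1" "?h < \<delta>2" using ab by (auto simp: \<delta>_def)
    have BD: "B * (D * ?h) < 1" using ab B D by (auto simp: \<delta>_def field_simps)
    let ?JT = "JT (\<lambda>_. True) a b"
    have subJT: "subspace ?JT" by (rule subspace_JT) auto
    have "\<exists>J J' Z Z'. i < k \<longrightarrow> JP J J' \<and> J \<tau> = u i \<and> jac R Z Z' \<and> Z a = J a \<and> Z b = 0" for i
    proof (cases "i < k")
      case True
      then obtain J J' where "JP J J'" "J \<tau> = u i" using uC[of i] unfolding Jt_iff by auto
      moreover obtain Z Z' where "jac R Z Z'" "Z a = J a" "Z b = 0" using solve[of a b "J a" 0] ab h by blast
      ultimately show ?thesis by blast
    qed simp
    then obtain J J' Z Z' where F: "\<And>i. i < k \<Longrightarrow> JP (J i) (J' i) \<and> J i \<tau> = u i \<and> jac R (Z i) (Z' i) \<and> Z i a = J i a \<and> Z i b = 0"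
      by metis
    define v where "v i = glue a b (J i) (Z i)" for i
    define sJ where "sJ c t = (\<Sum>i<k. c i *\<^sub>R J i t)" for c :: "nat \<Rightarrow> real" and t
    define sJ' where "sJ' c t = (\<Sum>i<k. c i *\<^sub>R J' i t)" for c :: "nat \<Rightarrow> real" and t
    define sZ where "sZ c t = (\<Sum>i<k. c i *\<^sub>R Z i t)" for c :: "nat \<Rightarrow> real" and t
    define sZ' where "sZ' c t = (\<Sum>i<k. c i *\<^sub>R Z' i t)" for c :: "nat \<Rightarrow> real" and t
    have sv: "(\<Sum>i<k. c i *\<^sub>R v i) = glue a b (sJ c) (sZ c)" for c
      unfolding v_def glue_sum sJ_def sZ_def ..
    have s1: "JP (sJ c) (sJ' c)" "jac R (sZ c) (sZ' c)" for c
      unfolding sJ_def[abs_def] sJ'_def[abs_def] sZ_def[abs_def] sZ'_def[abs_def]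
      using F by (auto intro!: JP_sum jac_sum)
    have s2: "sZ c a = sJ c a" "sZ c b = 0" "sJ c \<tau> = (\<Sum>i<k. c i *\<^sub>R u i)" for c
      using F by (auto simp: sJ_def sZ_def intro!: sum.cong)
    have negv: "neg_fam II ?JT k v" unfolding neg_fam_def
    proof (intro conjI allI impI)
      show "v i \<in> ?JT" if "i < k" for i
        using F[OF that] by (intro JTI[of "J i" "J' i" "Z i" "Z' i"]) (auto simp: v_def)
      fix c :: "nat \<Rightarrow> real" assume c: "\<exists>i<k. c i \<noteq> 0"
      let ?x = "sJ c \<tau>"
      have gx: "g ?x ?x < 0"
      proof -
        define c' where "c' i = (if i < k then c i else 0)" for i
        have "?x = (\<Sum>i<k+l. c' i *\<^sub>R u i)" unfolding s2
          by (rule sum.mono_neutral_cong_left) (auto simp: c'_def)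
        then have "g ?x ?x = (\<Sum>i<k+l. (if i < k then - 1 else 1) * (c' i)\<^sup>2)" using gxx by simp
        also have "\<dots> = - (\<Sum>i<k+l. (c' i)\<^sup>2)"
          unfolding sum_negf[symmetric] by (intro sum.cong) (auto simp: c'_def)
        also have "\<dots> < 0"
        proof -
          obtain i where "i < k" "c i \<noteq> 0" using c by blast
          then have "0 < (\<Sum>i<k+l. (c' i)\<^sup>2)" by (intro sum_pos2[where i = i]) (auto simp: c'_def)
          then show ?thesis by simp
        qed
        finally show ?thesis .
      qed
      have "\<bar>?h * II (glue a b (sJ c) (sZ c)) (glue a b (sJ c) (sZ c)) - g ?x ?x\<bar> \<le> D * ?h * (norm ?x)\<^sup>2"
        using ab h \<tau>ab s1 s2 by (intro en) auto
      moreover have "D * ?h * (norm ?x)\<^sup>2 \<le> D * ?h * (- B * g ?x ?x)"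
        using neg[OF s2(3)] D h by (intro mult_left_mono) auto
      moreover have "D * ?h * (- B * g ?x ?x) = (B * (D * ?h)) * (- g ?x ?x)" by simp
      moreover have "(B * (D * ?h)) * (- g ?x ?x) < 1 * (- g ?x ?x)"
        using BD gx by (intro mult_strict_right_mono) auto
      ultimately have "?h * II (glue a b (sJ c) (sZ c)) (glue a b (sJ c) (sZ c)) < 0" by linarith
      then show "II (\<Sum>i<k. c i *\<^sub>R v i) (\<Sum>i<k. c i *\<^sub>R v i) < 0"
        unfolding sv using h by (simp add: mult_less_0_iff)
    qed
    define T where "T = JT (\<lambda>J. \<forall>i<k. g (J \<tau>) (u i) = 0) a b"
    have Tnn: "0 \<le> II t t" if t: "t \<in> T" for t
    proof -
      obtain J J' Z Z' where J: "t = glue a b J Z" "JP J J'" "jac R Z Z'" "Z a = J a" "Z b = 0"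
        "\<forall>i<k. g (J \<tau>) (u i) = 0" using t unfolding T_def JT_def by blast
      let ?x = "J \<tau>"
      have "?x \<in> ?C" using J(2) unfolding Jt_iff by blast
      then have px: "(norm ?x)\<^sup>2 \<le> B * g ?x ?x" using pos J(6) by blast
      then have "0 \<le> B * g ?x ?x" using zero_le_power2 order_trans by blast
      then have gx: "0 \<le> g ?x ?x" using B by (simp add: zero_le_mult_iff)
      have "\<bar>?h * II t t - g ?x ?x\<bar> \<le> D * ?h * (norm ?x)\<^sup>2"
        unfolding J(1) using ab h \<tau>ab J by (intro en) auto
      moreover have "D * ?h * (norm ?x)\<^sup>2 \<le> D * ?h * (B * g ?x ?x)"
        using px D h by (intro mult_left_mono) auto
      moreover have "D * ?h * (B * g ?x ?x) = (B * (D * ?h)) * g ?x ?x" by simp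
      moreover have "(B * (D * ?h)) * g ?x ?x \<le> 1 * g ?x ?x"
        using BD gx by (intro mult_right_mono) auto
      ultimately have "0 \<le> ?h * II t t" by linarith
      then show ?thesis using h by (simp add: zero_le_mult_iff)
    qed
    have Tsub: "subspace T" unfolding T_def by (rule subspace_JT) (auto simp: g_simps)
    have dec: "\<exists>c. \<exists>t\<in>T. w = (\<Sum>i<k. c i *\<^sub>R v i) + t" if w: "w \<in> ?JT" for w
    proof -
      obtain K K' X X' where K: "w = glue a b K X" "JP K K'" "jac R X X'" "X a = K a" "X b = 0"
        using w unfolding JT_def by blast
      define c where "c i = - g (K \<tau>) (u i)" for i
      let ?t = "glue a b (\<lambda>t. 1 *\<^sub>R K t + (- 1) *\<^sub>R sJ c t) (\<lambda>t. 1 *\<^sub>R X t + (- 1) *\<^sub>R sZ c t)"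
      have "g (sJ c \<tau>) (u j) = g (K \<tau>) (u j)" if "j < k" for j
      proof -
        have "g (sJ c \<tau>) (u j) = (\<Sum>i<k. c i * g (u i) (u j))" unfolding s2 by (rule form_sum) auto
        also have "\<dots> = (\<Sum>i<k. if i = j then g (K \<tau>) (u j) else 0)"
          using uu that by (intro sum.cong) (auto simp: c_def)
        finally show ?thesis using that by simp
      qed
      then have "\<forall>i<k. g (1 *\<^sub>R K \<tau> + (- 1) *\<^sub>R sJ c \<tau>) (u i) = 0" by (simp add: g_simps)
      moreover have "JP (\<lambda>t. 1 *\<^sub>R K t + (- 1) *\<^sub>R sJ c t) (\<lambda>t. 1 *\<^sub>R K' t + (- 1) *\<^sub>R sJ' c t)"
        by (rule JP_lin[OF K(2) s1(1)])
      moreover have "jac R (\<lambda>t. 1 *\<^sub>R X t + (- 1) *\<^sub>R sZ c t) (\<lambda>t. 1 *\<^sub>R X' t + (- 1) *\<^sub>R sZ' c t)"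
        by (rule jac_lin[OF K(3) s1(2)])
      moreover have "1 *\<^sub>R X a + (- 1) *\<^sub>R sZ c a = 1 *\<^sub>R K a + (- 1) *\<^sub>R sJ c a" "1 *\<^sub>R X b + (- 1) *\<^sub>R sZ c b = 0"
        using K s2 by auto
      ultimately have "?t \<in> T" unfolding T_def by (intro JTI[where V = "?t"]) auto
      moreover have "?t = 1 *\<^sub>R w + (- 1) *\<^sub>R (\<Sum>i<k. c i *\<^sub>R v i)" unfolding sv K(1) glue_lin ..
      then have "w = (\<Sum>i<k. c i *\<^sub>R v i) + ?t" by simp
      ultimately show ?thesis by blast
    qed
    show ?thesis
    \<comment> \<open>The lifted fields \<open>v i\<close> need not be II-orthogonal to
      \<open>T\<close>, only their values at \<tau> are g-orthogonal; hence the criterion for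
      oblique splittings.\<close>
    proof (rule H.has_index_decomposition[OF negv subJT JT_subset[OF ab(1-3)] Tsub _ Tnn dec])
      show "T \<subseteq> ?JT" unfolding T_def JT_def by blast
    qed
  qed
  ultimately show ?thesis by blast
qed

end

section \<open>Evolution of the index\<close>

context morse_sturm
begin

text \<open>Like the constrained space on [0, b], but the constant may jump at a. In particular Kp 0 b is the
  constrained space on [0, b], extended by zero.\<close>

definition Kp :: "real \<Rightarrow> real \<Rightarrow> (real \<Rightarrow> 'a) set" where
  "Kp a b = {V \<in> H1P P. (\<forall>t\<in>{b..1}. V t = 0) \<and>
     (\<exists>W. wd V W \<and> (\<exists>c. con W V 0 a c) \<and> (\<exists>c. con W V a b c))}"

text \<open>On a degenerate interval the condition is void, so membership in \<open>Kp 0 b\<close>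
  involves only the constant on [0, b].\<close>

lemma con_point: "con W V p p c"
  unfolding con_def by (intro exI[of _ "{p}"]) auto

lemma Kp_subset: "Kp a b \<subseteq> H1P P"
  by (auto simp: Kp_def)

lemma Kp_I:
  "V \<in> H1P P \<Longrightarrow> \<forall>t\<in>{b..1}. V t = 0 \<Longrightarrow> wd V W \<Longrightarrow> con W V 0 a c \<Longrightarrow> con W V a b d \<Longrightarrow> V \<in> Kp a b"
  unfolding Kp_def by blast

lemma Kp0_I:
  "V \<in> H1P P \<Longrightarrow> \<forall>t\<in>{b..1}. V t = 0 \<Longrightarrow> wd V W \<Longrightarrow> con W V 0 b d \<Longrightarrow> V \<in> Kp 0 b"
  by (rule Kp_I[OF _ _ _ con_point])

lemma Kp_lin:
  assumes "V \<in> Kp a b" "V' \<in> Kp a b"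
  shows "x *\<^sub>R V + y *\<^sub>R V' \<in> Kp a b"
proof -
  obtain W c d where W: "V \<in> H1P P" "\<forall>t\<in>{b..1}. V t = 0" "wd V W" "con W V 0 a c" "con W V a b d"
    using assms(1) unfolding Kp_def by blast
  obtain W' c' d' where W': "V' \<in> H1P P" "\<forall>t\<in>{b..1}. V' t = 0" "wd V' W'" "con W' V' 0 a c'" "con W' V' a b d'"
    using assms(2) unfolding Kp_def by blast
  have eq: "x *\<^sub>R V + y *\<^sub>R V' = (\<lambda>t. x *\<^sub>R V t + y *\<^sub>R V' t)" by (simp add: fun_eq_iff scaleR_fun_def)
  have "x *\<^sub>R V + y *\<^sub>R V' \<in> H1P P" using W(1) W'(1) by simp
  moreover have "\<forall>t\<in>{b..1}. (x *\<^sub>R V + y *\<^sub>R V') t = 0" using W(2) W'(2) by (simp add: eq)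
  ultimately show ?thesis
    unfolding Kp_def using wd_lin[OF W(3) W'(3), of x y] con_lin[OF W(4) W'(4), of x y] con_lin[OF W(5) W'(5), of x y]
    by (intro CollectI conjI exI[of _ "\<lambda>t. x *\<^sub>R W t + y *\<^sub>R W' t"]) (auto simp: eq)
qed

lemma Kp_zero: "0 \<in> Kp a b"
proof -
  have "con (\<lambda>_. 0) 0 p q 0" for p q
    unfolding con_def by (intro exI[of _ "{}"]) (auto simp: g_simps)
  then show ?thesis unfolding Kp_def using wd_zero by (auto intro!: exI[of _ "\<lambda>_. 0"])
qed

lemma subspace_Kp: "subspace (Kp a b)"
proof (rule subspaceI)
  show "x + y \<in> Kp a b" if "x \<in> Kp a b" "y \<in> Kp a b" for x y using Kp_lin[OF that, of 1 1] by simp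
  show "c *\<^sub>R x \<in> Kp a b" if "x \<in> Kp a b" for x c using Kp_lin[OF that that, of c 0] by simp
qed (rule Kp_zero)

lemma Kspace_eq: "Kspace g Y P = Kp 0 1"
proof -
  have vY: "vector_derivative Y (at s within {0..1}) = Y' s" if "s \<in> {0..1}" for s
    using jacD(3)[OF Y_jac that] .
  show ?thesis
  proof (intro equalityI subsetI)
    fix V assume V: "V \<in> Kspace g Y P"
    then have VX: "V \<in> H1P P" by (simp add: Kspace_def)
    then obtain W where W: "wd V W" "V 1 = 0" by (auto simp: H1P_iff)
    obtain c N where N: "negligible N" "\<And>s. s \<in> {0..1} - N \<Longrightarrow>
      g (vector_derivative V (at s)) (Y s) - g (V s) (vector_derivative Y (at s within {0..1})) = c"
      using V unfolding Kspace_def by blast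
    obtain N' where N': "negligible N'" "\<And>s. s \<in> {0..1} - N' \<Longrightarrow> vector_derivative V (at s) = W s"
      using wd_ae[OF W(1)] by blast
    have "con W V 0 1 c" unfolding con_def
    proof (intro exI[of _ "N \<union> N'"] conjI ballI)
      fix s assume "s \<in> {0..1} - (N \<union> N')"
      then show "g (W s) (Y s) - g (V s) (Y' s) = c" using N(2)[of s] N'(2)[of s] vY[of s] by auto
    qed (use N N' in \<open>auto simp: negligible_Un\<close>)
    with VX _ W(1) show "V \<in> Kp 0 1" by (rule Kp0_I) (use W in auto)
  next
    fix V assume V: "V \<in> Kp 0 1"
    then obtain W c where W: "V \<in> H1P P" "wd V W" "con W V 0 1 c" unfolding Kp_def by blast
    obtain N where N: "negligible N" "\<And>s. s \<in> {0..1} - N \<Longrightarrow> g (W s) (Y s) - g (V s) (Y' s) = c"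
      using W(3) unfolding con_def by blast
    obtain N' where N': "negligible N'" "\<And>s. s \<in> {0..1} - N' \<Longrightarrow> vector_derivative V (at s) = W s"
      using wd_ae[OF W(2)] by blast
    have "\<forall>s\<in>{0..1} - (N \<union> N'). g (vector_derivative V (at s)) (Y s) - g (V s) (vector_derivative Y (at s within {0..1})) = c"
    proof
      fix s assume "s \<in> {0..1} - (N \<union> N')"
      then show "g (vector_derivative V (at s)) (Y s) - g (V s) (vector_derivative Y (at s within {0..1})) = c"
        using N(2)[of s] N'(2)[of s] vY[of s] by auto
    qed
    then show "V \<in> Kspace g Y P" unfolding Kspace_def using W(1) N(1) N'(1) negligible_Un by blast
  qed
qed

lemma glue_Kp:
  assumes A: "wd A A'" "A 0 \<in> P" "con A' A 0 a c" and Z: "wd Z Z'" "Z a = A a" "Z b = 0" "con Z' Z a b d"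
    and ab: "0 \<le> a" "a < b" "b \<le> 1"
  shows "wd (glue a b A Z) (glue a b A' Z')" "con (glue a b A' Z') (glue a b A Z) 0 a c"
    "con (glue a b A' Z') (glue a b A Z) a b d" "glue a b A Z \<in> Kp a b"
proof -
  show 1: "wd (glue a b A Z) (glue a b A' Z')" using assms by (intro wd_glue) auto
  show 2: "con (glue a b A' Z') (glue a b A Z) 0 a c"
    by (rule con_ae[OF A(3) negligible_empty]) (auto simp: glue_def)
  show 3: "con (glue a b A' Z') (glue a b A Z) a b d"
    by (rule con_ae[OF Z(4) negligible_sing[of a]]) (auto simp: glue_def)
  show "glue a b A Z \<in> Kp a b" unfolding Kp_def
    using 1 2 3 glue_in_H1P[OF A(1,2) Z(1-3) ab] by auto
qed

lemma JT_Kp: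
  assumes ab: "0 \<le> a" "a < b" "b \<le> 1" shows "JT Q a b \<subseteq> Kp a b"
proof
  fix V assume "V \<in> JT Q a b"
  then obtain J J' Z Z' where V: "V = glue a b J Z" "JP J J'" "jac R Z Z'" "Z a = J a" "Z b = 0"
    unfolding JT_def by blast
  obtain c where "con J' J 0 1 c" using con_jacobi[OF JP_jac[OF V(2)]] by blast
  then have c: "con J' J 0 a c" by (rule con_subinterval) (use ab in auto)
  obtain d where "con Z' Z 0 1 d" using con_jacobi[OF V(3)] by blast
  then have d: "con Z' Z a b d" by (rule con_subinterval) (use ab in auto)
  show "V \<in> Kp a b" unfolding V(1)
    using V by (intro glue_Kp(4)[OF wd_jac[OF JP_jac[OF V(2)]] _ c wd_jac[OF V(3)] _ _ d ab]) (auto simp: JP_def)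
qed

lemma Kp_node_split:
  assumes V: "V \<in> Kp a b" "V a = 0" and ab: "0 \<le> a" "a < b" "b \<le> 1"
  shows "\<exists>u\<in>Kp 0 a. \<exists>v\<in>K0 a b. V = u + v"
proof -
  obtain W c d where W: "V \<in> H1P P" "\<forall>t\<in>{b..1}. V t = 0" "wd V W" "con W V 0 a c" "con W V a b d"
    using V(1) unfolding Kp_def by blast
  define u where "u t = (if t \<le> a then V t else 0)" for t
  define u' where "u' t = (if t \<le> a then W t else 0)" for t
  have u: "wd u u'" unfolding u_def u'_def using ab V by (intro wd_cut W) auto
  have "con u' u 0 a c" by (rule con_ae[OF W(4) negligible_empty]) (auto simp: u_def u'_def)
  moreover have uX: "u \<in> H1P P" using u W(1) ab by (auto simp: H1P_iff u_def)
  moreover have "\<forall>t\<in>{a..1}. u t = 0" using V(2) by (auto simp: u_def)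
  ultimately have "u \<in> Kp 0 a" using u by (intro Kp0_I)
  moreover have "V - u \<in> K0 a b"
  proof -
    have "con (\<lambda>t. W t - u' t) (V - u) a b d"
      by (rule con_ae[OF W(5) negligible_sing[of a]]) (auto simp: u_def u'_def)
    moreover have "V - u \<in> H1P P" using W(1) uX by simp
    moreover have "\<forall>t\<in>{0..a} \<union> {b..1}. (V - u) t = 0" using W(2) ab by (auto simp: u_def)
    ultimately show ?thesis unfolding K0_def using wd_diff[OF W(3) u] by blast
  qed
  moreover have "V = u + (V - u)" by simp
  ultimately show ?thesis by blast
qed

text \<open>The representative of the weak derivative is chosen to vanish beyond a. Products with
  fields supported in [a, b] are then zero pointwise.\<close>

lemma Kp_cut_derivative:
  assumes "u \<in> Kp 0 a" "0 \<le> a" "a \<le> 1"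
  shows "\<exists>W c. wd u (\<lambda>t. if t \<le> a then W t else 0) \<and> con (\<lambda>t. if t \<le> a then W t else 0) u 0 a c \<and>
    (\<forall>t\<in>{a..1}. u t = 0)"
proof -
  obtain W c where W: "\<forall>t\<in>{a..1}. u t = 0" "wd u W" "con W u 0 a c"
    using assms unfolding Kp_def by blast
  have "wd (\<lambda>t. if t \<le> a then u t else 0) (\<lambda>t. if t \<le> a then W t else 0)"
    using W assms by (intro wd_cut) auto
  then have "wd u (\<lambda>t. if t \<le> a then W t else 0)"
    by (rule wd_cong) (use W(1) assms in auto)
  moreover have "con (\<lambda>t. if t \<le> a then W t else 0) u 0 a c"
    by (rule con_ae[OF W(3) negligible_empty]) auto
  ultimately show ?thesis using W(1) by blast
qed

lemma K0_cut_derivative: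
  assumes "v \<in> K0 a b" "0 \<le> a" "a < b" "b \<le> 1"
  shows "\<exists>W c. wd v (\<lambda>t. if a < t \<and> t \<le> b then W t else 0) \<and>
    con (\<lambda>t. if a < t \<and> t \<le> b then W t else 0) v a b c \<and> (\<forall>t\<in>{0..a} \<union> {b..1}. v t = 0)"
proof -
  obtain W c where W: "\<forall>t\<in>{0..a} \<union> {b..1}. v t = 0" "wd v W" "con W v a b c"
    using assms unfolding K0_def by blast
  have "wd v (\<lambda>t. if a < t \<and> t \<le> b then W t else 0)"
    by (rule wd_support[OF W(2)]) (use W(1) assms in auto)
  moreover have "con (\<lambda>t. if a < t \<and> t \<le> b then W t else 0) v a b c"
    by (rule con_ae[OF W(3) negligible_sing[of a]]) auto
  ultimately show ?thesis using W(1) by blast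
qed

text \<open>A field vanishing at a is the sum of its pieces on [0, a] and [a, b]. Their supports
  overlap only at a, so they are orthogonal, and the second piece contributes no negative
  direction.\<close>

lemma node_zero_index:
  assumes ab: "0 \<le> a" "a < b" "b \<le> 1"
    and m: "has_index II (Kp 0 a) m" and nn: "\<And>V. V \<in> K0 a b \<Longrightarrow> 0 \<le> II V V"
  shows "has_index II {V \<in> Kp a b. V a = 0} m"
proof -
  have a1: "a \<le> 1" using ab by simp
  have "has_index II {V \<in> Kp a b. V a = 0} (m + 0)"
  proof (rule H.has_index_orthogonal_sum[OF m H.has_index_nonneg[OF nn]])
    show "Kp 0 a \<subseteq> H1P P" by (rule Kp_subset)
    show "K0 a b \<subseteq> H1P P" by (auto simp: K0_def)
    show "II u v = 0" if u: "u \<in> Kp 0 a" and v: "v \<in> K0 a b" for u v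
    proof -
      obtain U c where U: "wd u (\<lambda>t. if t \<le> a then U t else 0)" "\<forall>t\<in>{a..1}. u t = 0"
        using Kp_cut_derivative[OF u ab(1) a1] by blast
      obtain W c where W: "wd v (\<lambda>t. if a < t \<and> t \<le> b then W t else 0)" "\<forall>t\<in>{0..a} \<union> {b..1}. v t = 0"
        using K0_cut_derivative[OF v ab] by blast
      have "integral {0..1} (FF (\<lambda>t. if t \<le> a then U t else 0) u (\<lambda>t. if a < t \<and> t \<le> b then W t else 0) v) =
          integral {0..1} (\<lambda>_::real. 0)"
      proof (rule integral_cong)
        fix s :: real assume s: "s \<in> {0..1}"
        show "FF (\<lambda>t. if t \<le> a then U t else 0) u (\<lambda>t. if a < t \<and> t \<le> b then W t else 0) v s = 0"
          using s U(2)[rule_format, of s] W(2)[rule_format, of s] by (cases "s \<le> a") (auto simp: FF_def g_simps blinfun.zero_right)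
      qed
      moreover have "v 0 = 0" using W(2) ab by auto
      ultimately show ?thesis using I1_wd[OF U(1) W(1)] by (simp add: g_simps)
    qed
    show "\<exists>u\<in>Kp 0 a. \<exists>v\<in>K0 a b. w = u + v" if "w \<in> {V \<in> Kp a b. V a = 0}" for w
      using Kp_node_split[OF _ _ ab] that by blast
    show "Kp 0 a \<subseteq> {V \<in> Kp a b. V a = 0}"
    proof
      fix u assume u: "u \<in> Kp 0 a"
      obtain U c where U: "wd u (\<lambda>t. if t \<le> a then U t else 0)" "con (\<lambda>t. if t \<le> a then U t else 0) u 0 a c"
        "\<forall>t\<in>{a..1}. u t = 0"
        using Kp_cut_derivative[OF u ab(1) a1] by blast
      have "con (\<lambda>t. if t \<le> a then U t else 0) u a b 0"
        unfolding con_def using U(3) ab by (intro exI[of _ "{a}"]) (auto simp: g_simps)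
      moreover have "u \<in> H1P P" using u Kp_subset by blast
      moreover have "\<forall>t\<in>{b..1}. u t = 0" "u a = 0" using U(3) ab by auto
      ultimately show "u \<in> {V \<in> Kp a b. V a = 0}" using Kp_I[OF _ _ U(1,2)] by blast
    qed
    show "K0 a b \<subseteq> {V \<in> Kp a b. V a = 0}"
    proof
      fix v assume v: "v \<in> K0 a b"
      obtain W c where W: "wd v (\<lambda>t. if a < t \<and> t \<le> b then W t else 0)"
        "con (\<lambda>t. if a < t \<and> t \<le> b then W t else 0) v a b c" "\<forall>t\<in>{0..a} \<union> {b..1}. v t = 0"
        using K0_cut_derivative[OF v ab] by blast
      have "con (\<lambda>t. if a < t \<and> t \<le> b then W t else 0) v 0 a 0"
        unfolding con_def using W(3) by (intro exI[of _ "{}"]) (auto simp: g_simps)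
      moreover have "v \<in> H1P P" using v by (simp add: K0_def)
      moreover have "\<forall>t\<in>{b..1}. v t = 0" "v a = 0" using W(3) ab by auto
      ultimately show "v \<in> {V \<in> Kp a b. V a = 0}" using Kp_I[OF _ _ W(1) _ W(2)] by blast
    qed
  qed
  then show ?thesis by simp
qed

lemma Kp_00_index: "has_index II (Kp 0 0) 0"
proof (rule H.has_index_nonneg)
  fix V assume "V \<in> Kp 0 0"
  then have V: "\<And>t. t \<in> {0..1} \<Longrightarrow> V t = 0" by (simp add: Kp_def)
  have w: "wd V (\<lambda>_. 0)" by (rule wd_cong[OF wd_zero]) (use V in auto)
  have "integral {0..1} (FF (\<lambda>_. 0) V (\<lambda>_. 0) V) = integral {0..1} (\<lambda>_::real. 0)"
    by (rule integral_cong) (simp add: FF_def g_simps V)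
  then show "0 \<le> II V V" using I1_wd[OF w w] V[of 0] by (simp add: g_simps)
qed

text \<open>Subtracting the broken Jacobi field with the same value at a leaves a field vanishing at
  a, and by the kink formula the two parts are orthogonal. With \<tau> = b the restriction sits at a
  while \<open>k\<close> is computed at b, which is what the approach to an instant from the left
  requires.\<close>

lemma Kp_Jt_index:
  assumes \<tau>: "\<tau> \<in> {0..1}" and k: "has_index g (Jt \<tau>) k"
  shows "\<exists>\<delta>>0. \<forall>a b m. 0 \<le> a \<longrightarrow> a < b \<longrightarrow> b \<le> 1 \<longrightarrow> b - a < \<delta> \<longrightarrow> \<tau> = a \<or> \<tau> = b \<longrightarrow>
    has_index II (Kp 0 a) m \<longrightarrow> has_index II {V \<in> Kp a b. V a \<in> Jt a} (m + k)"
proof -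
  obtain \<delta>1 where \<delta>1: "\<delta>1 > 0" and jt0: "\<forall>a b. 0 \<le> a \<longrightarrow> a < b \<longrightarrow> b \<le> 1 \<longrightarrow> b - a < \<delta>1 \<longrightarrow> \<tau> = a \<or> \<tau> = b \<longrightarrow>
    has_index II (JT (\<lambda>_. True) a b) k"
    using JT_index[OF \<tau> k] by (elim exE conjE) (rule that)
  note jt = jt0[rule_format]
  obtain \<delta>2 where \<delta>2: "\<delta>2 > 0" and nn0: "\<forall>a b V. 0 \<le> a \<longrightarrow> a < b \<longrightarrow> b \<le> 1 \<longrightarrow> b - a < \<delta>2 \<longrightarrow> V \<in> K0 a b \<longrightarrow> 0 \<le> II V V"
    using K0_nonneg by (elim exE conjE) (rule that)
  note nn = nn0[rule_format]
  obtain \<delta>3 where \<delta>3: "\<delta>3 > 0" and solve0: "\<forall>a b x y. 0 \<le> a \<longrightarrow> a < b \<longrightarrow> b \<le> 1 \<longrightarrow> b - a < \<delta>3 \<longrightarrow>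
     (\<exists>Z Z'. jac R Z Z' \<and> Z a = x \<and> Z b = y)"
    using boundary_value_solvable by (elim exE conjE) (rule that)
  define \<delta> where "\<delta> = min \<delta>1 (min \<delta>2 \<delta>3)"
  have "\<delta> > 0" using \<delta>1 \<delta>2 \<delta>3 by (simp add: \<delta>_def)
  moreover have "has_index II {V \<in> Kp a b. V a \<in> Jt a} (m + k)"
    if ab: "0 \<le> a" "a < b" "b \<le> 1" "b - a < \<delta>" and \<tau>ab: "\<tau> = a \<or> \<tau> = b" and m: "has_index II (Kp 0 a) m" for a b m
  proof -
    have h: "b - a < \<delta>1" "b - a < \<delta>2" "b - a < \<delta>3" using ab by (auto simp: \<delta>_def)
    have U: "has_index II {V \<in> Kp a b. V a = 0} m"
      using ab h by (intro node_zero_index m nn[of a b]) auto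
    show ?thesis
    proof (rule H.has_index_orthogonal_sum[OF U jt[OF ab(1-3) h(1) \<tau>ab]])
      show "{V \<in> Kp a b. V a = 0} \<subseteq> H1P P" using Kp_subset by blast
      show "JT (\<lambda>_. True) a b \<subseteq> H1P P" by (rule JT_subset[OF ab(1-3)])
      show "II u v = 0" if u: "u \<in> {V \<in> Kp a b. V a = 0}" and v: "v \<in> JT (\<lambda>_. True) a b" for u v
      proof -
        obtain J J' Z Z' where V: "v = glue a b J Z" "JP J J'" "jac R Z Z'" "Z a = J a" "Z b = 0"
          using v unfolding JT_def by blast
        have "u \<in> H1P P" "u b = 0" "u a = 0" using u ab by (auto simp: Kp_def)
        then show ?thesis unfolding V(1)
          using I_jacobi_glue[of u b J J' Z Z' a] V ab by (simp add: g_simps)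
      qed
      show "\<exists>u\<in>{V \<in> Kp a b. V a = 0}. \<exists>v\<in>JT (\<lambda>_. True) a b. w = u + v"
        if w: "w \<in> {V \<in> Kp a b. V a \<in> Jt a}" for w
      proof -
        obtain J J' where J: "JP J J'" "J a = w a" using w unfolding Jt_iff by auto
        obtain Z Z' where Z: "jac R Z Z'" "Z a = J a" "Z b = 0"
          using solve0[rule_format, OF ab(1-3) h(3), of "J a" 0] by blast
        define v where "v = glue a b J Z"
        have v: "v \<in> JT (\<lambda>_. True) a b" by (rule JTI[OF J(1) Z]) (simp_all add: v_def)
        then have vK: "v \<in> Kp a b" using JT_Kp[OF ab(1-3)] by blast
        have "w - v \<in> Kp a b" using w vK subspace_Kp by (simp add: subspace_diff)
        moreover have "(w - v) a = 0" using J by (simp add: v_def glue_def)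
        moreover have "w = (w - v) + v" by simp
        ultimately show ?thesis using v by blast
      qed
      show "{V \<in> Kp a b. V a = 0} \<subseteq> {V \<in> Kp a b. V a \<in> Jt a}"
        using subspace_0[OF subspace_Jt] by auto
      show "JT (\<lambda>_. True) a b \<subseteq> {V \<in> Kp a b. V a \<in> Jt a}"
      proof
        fix v assume v: "v \<in> JT (\<lambda>_. True) a b"
        then obtain J J' Z Z' where V: "v = glue a b J Z" "JP J J'" unfolding JT_def by blast
        then have "v a \<in> Jt a" by (auto simp: glue_def Jt_iff)
        then show "v \<in> {V \<in> Kp a b. V a \<in> Jt a}" using v JT_Kp[OF ab(1-3)] by blast
      qed
    qed
  qed
  ultimately show ?thesis by (intro exI[of _ \<delta>] conjI allI impI) (assumption | blast)+
qed

section \<open>Multiples of Y and the jump of the constant\<close>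

lemma Y_primitive:
  assumes k: "continuous_on {0..1} k"
  defines "f \<equiv> \<lambda>t. integral {0..t} (\<lambda>s. k s / g (Y s) (Y s))"
  shows "t \<in> {0..1} \<Longrightarrow> (f has_vector_derivative k t / g (Y t) (Y t)) (at t within {0..1})"
    "continuous_on {0..1} (\<lambda>s. k s / g (Y s) (Y s))" "f 0 = 0"
proof -
  show c: "continuous_on {0..1} (\<lambda>s. k s / g (Y s) (Y s))"
    using Y_neg by (intro continuous_intros k bb.continuous_on jac_continuous(1)[OF Y_jac]) force+
  show "t \<in> {0..1} \<Longrightarrow> (f has_vector_derivative k t / g (Y t) (Y t)) (at t within {0..1})"
    unfolding f_def by (rule integral_has_vector_derivative[OF c])
  show "f 0 = 0" by (simp add: f_def)
qed

lemma Y_field: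
  assumes f: "\<And>t. t \<in> {0..1} \<Longrightarrow> (f has_vector_derivative f' t) (at t within {0..1})" "continuous_on {0..1} f'"
  shows "wd (\<lambda>s. f s *\<^sub>R Y s) (\<lambda>s. f' s *\<^sub>R Y s + f s *\<^sub>R Y' s)"
proof (rule wd_C1)
  show "((\<lambda>s. f s *\<^sub>R Y s) has_vector_derivative f' t *\<^sub>R Y t + f t *\<^sub>R Y' t) (at t within {0..1})"
    if "t \<in> {0..1}" for t
    using f(1)[OF that] jacD(1)[OF Y_jac that]
    by (auto intro!: derivative_eq_intros simp: has_real_derivative_iff_has_vector_derivative)
  have "continuous_on {0..1} f"
    using f(1) has_vector_derivative_continuous unfolding continuous_on_eq_continuous_within by blast
  then show "continuous_on {0..1} (\<lambda>s. f' s *\<^sub>R Y s + f s *\<^sub>R Y' s)"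
    using jac_continuous[OF Y_jac] f(2) by (intro continuous_intros)
qed

lemma Y_field_con:
  assumes "\<And>s. s \<in> {p..q} \<Longrightarrow> f' s * g (Y s) (Y s) = c"
  shows "con (\<lambda>s. f' s *\<^sub>R Y s + f s *\<^sub>R Y' s) (\<lambda>s. f s *\<^sub>R Y s) p q c"
  unfolding con_def using assms g_sym[of "Y' _"] by (intro exI[of _ "{}"]) (auto simp: g_simps)

text \<open>The multiple of Y by \<open>hY\<close> meets the constraint with constant -1. Since g(Y,
  Y) < 0, \<open>hY\<close> increases and can be normalised on any interval.\<close>

definition hY :: "real \<Rightarrow> real" where
  "hY t = integral {0..t} (\<lambda>s. - 1 / g (Y s) (Y s))"

lemma hY:
  shows "t \<in> {0..1} \<Longrightarrow> (hY has_vector_derivative - 1 / g (Y t) (Y t)) (at t within {0..1})"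
    "continuous_on {0..1} (\<lambda>s. - 1 / g (Y s) (Y s))" "hY 0 = 0"
  using Y_primitive[of "\<lambda>_. - 1"] unfolding hY_def[abs_def] by auto

lemma hY_less:
  assumes "0 \<le> p" "p < q" "q \<le> 1" shows "hY p < hY q"
proof -
  have "\<exists>x\<in>{p<..<q}. hY q - hY p = (q - p) *\<^sub>R (- 1 / g (Y x) (Y x))"
  proof (rule mvt_simple[OF assms(2)])
    show "(hY has_derivative (\<lambda>h. h *\<^sub>R (- 1 / g (Y x) (Y x)))) (at x within {p..q})" if "p \<le> x" "x \<le> q" for x
      using hY(1)[of x] that assms unfolding has_vector_derivative_def
      by (auto intro: has_derivative_subset)
  qed
  then obtain x where x: "x \<in> {p<..<q}" "hY q - hY p = (q - p) * (- 1 / g (Y x) (Y x))" by auto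
  have "g (Y x) (Y x) < 0" using x assms by (intro Y_neg) auto
  then have "0 < (q - p) * (- 1 / g (Y x) (Y x))" using assms by (intro mult_pos_pos divide_neg_neg) auto
  then show ?thesis using x(2) by linarith
qed

text \<open>The factor of Y is piecewise a primitive of a multiple of 1 / g(Y, Y), so that pairing with e measures
  the jump of the constant at a.\<close>

lemma broken_field:
  assumes ab: "0 < a" "a < b" "b \<le> 1"
  shows "\<exists>e E p q. 0 < p \<and> 0 < q \<and> e \<in> Kp a b \<and> wd e E \<and> con E e 0 a (- p) \<and> con E e a b q \<and>
    (\<forall>V W c d. V \<in> H1P P \<longrightarrow> wd V W \<longrightarrow> con W V 0 a c \<longrightarrow> con W V a b d \<longrightarrow> II V e = c - d)"
proof -
  \<comment> \<open>Slopes, in the parameter \<open>hY\<close>, of the tent that is 0 at 0 and at b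
    and 1 at a. The resulting constants are - p on the left and q on the right.\<close>
  define p where "p = 1 / hY a"
  define q where "q = 1 / (hY b - hY a)"
  have hpos: "0 < hY a" "0 < hY b - hY a" using hY_less[of 0 a] hY_less[of a b] hY(3) ab by auto
  then have pq: "0 < p" "0 < q" by (auto simp: p_def q_def)
  define f1 where "f1 t = p * hY t" for t
  define f2 where "f2 t = q * (hY b - hY t)" for t
  define f1' where "f1' t = p * (- 1 / g (Y t) (Y t))" for t
  define f2' where "f2' t = - q * (- 1 / g (Y t) (Y t))" for t
  have hd: "(hY has_real_derivative - 1 / g (Y t) (Y t)) (at t within {0..1})" if "t \<in> {0..1}" for t
    unfolding has_real_derivative_iff_has_vector_derivative by (rule hY(1)[OF that])
  have d1: "(f1 has_vector_derivative f1' t) (at t within {0..1})"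
    and d2: "(f2 has_vector_derivative f2' t) (at t within {0..1})" if "t \<in> {0..1}" for t
    unfolding f1_def[abs_def] f2_def[abs_def] f1'_def f2'_def has_real_derivative_iff_has_vector_derivative[symmetric]
    using hd[OF that] by (auto intro!: derivative_eq_intros)
  have c1: "continuous_on {0..1} f1'" and c2: "continuous_on {0..1} f2'"
    unfolding f1'_def[abs_def] f2'_def[abs_def] by (rule continuous_on_mult_left[OF hY(2)])+
  define A where "A s = f1 s *\<^sub>R Y s" for s
  define A' where "A' s = f1' s *\<^sub>R Y s + f1 s *\<^sub>R Y' s" for s
  define Z where "Z s = f2 s *\<^sub>R Y s" for s
  define Z' where "Z' s = f2' s *\<^sub>R Y s + f2 s *\<^sub>R Y' s" for s
  have A: "wd A A'" unfolding A_def[abs_def] A'_def[abs_def] by (rule Y_field[OF d1 c1])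
  have Z: "wd Z Z'" unfolding Z_def[abs_def] Z'_def[abs_def] by (rule Y_field[OF d2 c2])
  have Yne: "g (Y s) (Y s) \<noteq> 0" if "s \<in> {0..1}" for s using Y_neg[OF that] by simp
  have conA: "con A' A 0 a (- p)" unfolding A_def[abs_def] A'_def[abs_def]
    using ab Yne by (intro Y_field_con) (auto simp: f1'_def)
  have conZ: "con Z' Z a b q" unfolding Z_def[abs_def] Z'_def[abs_def]
    using ab Yne by (intro Y_field_con) (auto simp: f2'_def)
  have vals: "f1 0 = 0" "f1 a = 1" "f2 a = 1" "f2 b = 0"
    using hpos hY(3) by (auto simp: f1_def f2_def p_def q_def)
  have A0: "A 0 \<in> P" using vals subspace_0[OF P(1)] by (simp add: A_def)
  have ZA: "Z a = A a" "Z b = 0" using vals by (auto simp: A_def Z_def)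
  have ab0: "0 \<le> a" using ab by simp
  note gl = glue_Kp[OF A A0 conA Z ZA conZ ab0 ab(2,3)]
  have "II V (glue a b A Z) = c - d"
    if V: "V \<in> H1P P" "wd V W" and con: "con W V 0 a c" "con W V a b d" for V W c d
  proof -
    have "II V (glue a b A Z) = integral {0..a} (FF W V A' A) + integral {a..b} (FF W V Z' Z) - g (S (V 0)) (A 0)"
      using ab ZA by (intro I_glue V A Z) auto
    moreover have "integral {0..a} (FF W V A' A) = c * (f1 a - f1 0) + f1 a * g (V a) (Y' a) - f1 0 * g (V 0) (Y' 0)"
      unfolding A_def[abs_def] A'_def[abs_def] using ab by (intro FF_Y[OF V(2) con(1) d1 c1]) auto
    moreover have "integral {a..b} (FF W V Z' Z) = d * (f2 b - f2 a) + f2 b * g (V b) (Y' b) - f2 a * g (V a) (Y' a)"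
      unfolding Z_def[abs_def] Z'_def[abs_def] using ab by (intro FF_Y[OF V(2) con(2) d2 c2]) auto
    ultimately show ?thesis using vals by (simp add: A_def g_simps)
  qed
  then have all: "\<forall>V W c d. V \<in> H1P P \<longrightarrow> wd V W \<longrightarrow> con W V 0 a c \<longrightarrow> con W V a b d \<longrightarrow>
      II V (glue a b A Z) = c - d"
    by (intro allI impI)
  show ?thesis
    by (intro exI conjI, rule pq(1), rule pq(2), rule gl(4), rule gl(1), rule gl(2), rule gl(3), rule all)
qed

lemma con_join:
  assumes "con W V 0 a c" "con W V a b c"
  shows "con W V 0 b c"
proof -
  obtain N N' where "negligible N" "\<forall>s\<in>{0..a} - N. g (W s) (Y s) - g (V s) (Y' s) = c"
    "negligible N'" "\<forall>s\<in>{a..b} - N'. g (W s) (Y s) - g (V s) (Y' s) = c"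
    using assms unfolding con_def by blast
  note * = this
  show ?thesis unfolding con_def
  proof (intro exI[of _ "N \<union> N'"] conjI ballI)
    fix s assume "s \<in> {0..b} - (N \<union> N')"
    then show "g (W s) (Y s) - g (V s) (Y' s) = c"
      using *(2,4) by (cases "s \<le> a") auto
  qed (use * in \<open>simp add: negligible_Un\<close>)
qed

text \<open>Pairing with the tent field e gives the difference c - d of the two constants, so its
  orthogonal complement in \<open>Kp a b\<close> is \<open>Kp 0 b\<close>, while II e e = - (p + q)
  is negative. Closing the jump thus costs exactly one.\<close>

lemma Kp_index_drop:
  assumes ab: "0 < a" "a < b" "b \<le> 1" and M: "has_index II (Kp a b) M"
  shows "\<exists>m. has_index II (Kp 0 b) m \<and> M = m + 1"
proof -
  obtain e E p q where pq: "0 < p" "0 < q" and e: "e \<in> Kp a b"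
    and E: "wd e E" "con E e 0 a (- p)" "con E e a b q"
    and IIe0: "\<forall>V W c d. V \<in> H1P P \<longrightarrow> wd V W \<longrightarrow> con W V 0 a c \<longrightarrow> con W V a b d \<longrightarrow> II V e = c - d"
    using broken_field[OF ab] by (elim exE conjE) (rule that)
  note IIe = IIe0[rule_format]
  have eX: "e \<in> H1P P" using e Kp_subset by blast
  have ee: "II e e = - (p + q)" using IIe[OF eX E] by simp
  have sub: "Kp 0 b \<subseteq> Kp a b"
  proof
    fix V assume "V \<in> Kp 0 b"
    then obtain W c where W: "V \<in> H1P P" "\<forall>t\<in>{b..1}. V t = 0" "wd V W" "con W V 0 b c" unfolding Kp_def by blast
    have "con W V 0 a c" "con W V a b c" using ab by (auto intro: con_subinterval[OF W(4)])
    then show "V \<in> Kp a b" unfolding Kp_def using W by blast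
  qed
  obtain m where m: "has_index II (Kp 0 b) m"
    using H.has_index_mono[OF M subspace_Kp Kp_subset subspace_Kp sub] by blast
  have e1: "has_index II (range (\<lambda>c. c *\<^sub>R e)) 1"
    unfolding has_index_def
  proof (intro exI[of _ "\<lambda>_::nat. (1 / sqrt (p + q)) *\<^sub>R e"] conjI ballI impI allI)
    fix v assume v0: "v \<in> range (\<lambda>c. c *\<^sub>R e)" "\<forall>i<1::nat. II v ((1 / sqrt (p + q)) *\<^sub>R e) = 0"
    have "II v ((1 / sqrt (p + q)) *\<^sub>R e) = 0" using v0(2)[rule_format, of 0] by simp
    moreover obtain c where v: "v = c *\<^sub>R e" using v0(1) by blast
    ultimately have "c = 0" using ee eX pq by (simp add: H.form_simps)
    then show "0 \<le> II v v" using v eX by (simp add: H.form_simps)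
  next
    have "(- p - q) / (p + q) = - 1" using pq by (simp add: divide_eq_eq)
    then show "II ((1 / sqrt (p + q)) *\<^sub>R e) ((1 / sqrt (p + q)) *\<^sub>R e) = (if i = j then - 1 else 0)"
      if "i < 1" "j < 1" for i j :: nat
      using ee eX pq that by (simp add: H.form_simps)
  qed auto
  have "has_index II (Kp a b) (m + 1)"
  proof (rule H.has_index_orthogonal_sum[OF m e1 Kp_subset])
    show "range (\<lambda>c. c *\<^sub>R e) \<subseteq> H1P P" using eX by auto
    show "II u v = 0" if u: "u \<in> Kp 0 b" and v: "v \<in> range (\<lambda>c. c *\<^sub>R e)" for u v
    proof -
      obtain W c where W: "u \<in> H1P P" "wd u W" "con W u 0 b c" using u unfolding Kp_def by blast
      have "con W u 0 a c" "con W u a b c" using ab by (auto intro: con_subinterval[OF W(3)])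
      then have "II u e = 0" using IIe[OF W(1,2)] by simp
      then show ?thesis using v W(1) eX by (auto simp: H.form_simps)
    qed
    show "\<exists>u\<in>Kp 0 b. \<exists>v\<in>range (\<lambda>c. c *\<^sub>R e). w = u + v" if w: "w \<in> Kp a b" for w
    proof -
      obtain W c d where W: "w \<in> H1P P" "\<forall>t\<in>{b..1}. w t = 0" "wd w W" "con W w 0 a c" "con W w a b d"
        using w unfolding Kp_def by blast
      \<comment> \<open>Subtracting l e changes the constants to c + l p and d - l q; this l makes
        them equal.\<close>
      define l where "l = (d - c) / (p + q)"
      have l: "l * (p + q) = d - c" using pq by (simp add: l_def)
      let ?u = "\<lambda>t. 1 *\<^sub>R w t + (- l) *\<^sub>R e t" and ?U = "\<lambda>t. 1 *\<^sub>R W t + (- l) *\<^sub>R E t"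
      have u: "wd ?u ?U" by (rule wd_lin[OF W(3) E(1)])
      have c1: "con ?U ?u 0 a (1 * c + (- l) * (- p))" by (rule con_lin[OF W(4) E(2)])
      have c2: "con ?U ?u a b (1 * d + (- l) * q)" by (rule con_lin[OF W(5) E(3)])
      have c12: "1 * c + (- l) * (- p) = 1 * d + (- l) * q" using l by (simp add: algebra_simps)
      have con: "con ?U ?u 0 b (1 * d + (- l) * q)" by (rule con_join[OF c1[unfolded c12] c2])
      have eq: "?u = 1 *\<^sub>R w + (- l) *\<^sub>R e" by (simp add: fun_eq_iff scaleR_fun_def)
      have "?u \<in> Kp a b" unfolding eq by (rule Kp_lin[OF w e])
      then have "?u \<in> H1P P" "\<forall>t\<in>{b..1}. ?u t = 0" unfolding Kp_def by auto
      then have "?u \<in> Kp 0 b" using u con by (rule Kp0_I)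
      moreover have "w = ?u + l *\<^sub>R e" unfolding eq by simp
      ultimately show ?thesis by blast
    qed
    show "range (\<lambda>c. c *\<^sub>R e) \<subseteq> Kp a b" using e subspace_Kp by (auto simp: subspace_mul)
  qed (rule sub)
  then have "M = m + 1" using H.has_index_unique[OF M _ subspace_Kp Kp_subset] by blast
  then show ?thesis using m by blast
qed

text \<open>The straight line from 0 to x has the function \<open>k\<close> in place of a constant.
  Adding f Y with f' g(Y, Y) = c - k repairs this, and c is chosen so that f vanishes at a as well
  as at 0, which preserves the end values.\<close>

lemma Kp_evaluation_onto:
  assumes ab: "0 < a" "a < b" "b \<le> 1" and Z: "jac R Z Z'" "Z a = x" "Z b = 0"
  shows "\<exists>V\<in>Kp a b. V a = x"
proof -
  have cY: "continuous_on {0..1} Y" "continuous_on {0..1} Y'" using jac_continuous[OF Y_jac] by auto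
  define l where "l t = t *\<^sub>R ((1 / a) *\<^sub>R x)" for t :: real
  define l' where "l' t = (1 / a) *\<^sub>R x" for t :: real
  have l: "(l has_vector_derivative l' t) (at t within {0..1})" for t
    unfolding l_def l'_def using ab by (auto intro!: derivative_eq_intros)
  have cl: "continuous_on {0..1} l" "continuous_on {0..1} l'"
    unfolding l_def[abs_def] l'_def[abs_def] using ab by (auto intro!: continuous_intros)
  define k where "k s = g (l' s) (Y s) - g (l s) (Y' s)" for s
  have ck: "continuous_on {0..1} k" unfolding k_def[abs_def]
    using cl cY by (intro continuous_intros bb.continuous_on)
  define r where "r t = integral {0..t} (\<lambda>s. (- k s) / g (Y s) (Y s))" for t
  have ck': "continuous_on {0..1} (\<lambda>s. - k s)" using ck by (intro continuous_intros)
  have r: "(r has_vector_derivative (- k t) / g (Y t) (Y t)) (at t within {0..1})" if "t \<in> {0..1}" for t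
    unfolding r_def[abs_def] by (rule Y_primitive(1)[OF ck' that])
  have ha: "0 < hY a" using hY_less[of 0 a] hY(3) ab by auto
  define c where "c = r a / hY a"
  define f where "f t = r t - c * hY t" for t
  define f' where "f' t = (- k t) / g (Y t) (Y t) - c * (- 1 / g (Y t) (Y t))" for t
  have f: "(f has_vector_derivative f' t) (at t within {0..1})" if "t \<in> {0..1}" for t
    using r[OF that] hY(1)[OF that]
    unfolding f_def[abs_def] f'_def has_real_derivative_iff_has_vector_derivative[symmetric]
    by (auto intro!: derivative_eq_intros)
  have cf': "continuous_on {0..1} f'" unfolding f'_def[abs_def]
    by (rule continuous_on_diff[OF Y_primitive(2)[OF ck'] continuous_on_mult_left[OF hY(2)]])
  have fa: "f 0 = 0" "f a = 0" using hY(3) ha by (auto simp: f_def c_def r_def)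
  define A where "A t = 1 *\<^sub>R l t + 1 *\<^sub>R (f t *\<^sub>R Y t)" for t
  define A' where "A' t = 1 *\<^sub>R l' t + 1 *\<^sub>R (f' t *\<^sub>R Y t + f t *\<^sub>R Y' t)" for t
  have A: "wd A A'" unfolding A_def[abs_def] A'_def[abs_def]
    by (intro wd_lin wd_C1[of l] Y_field f cf' l cl)
  have "con A' A 0 a c" unfolding con_def
  proof (intro exI[of _ "{}"] conjI ballI)
    fix s assume "s \<in> {0..a} - {}"
    then have s: "s \<in> {0..1}" using ab by auto
    have ne: "g (Y s) (Y s) \<noteq> 0" using Y_neg[OF s] by simp
    have "g (A' s) (Y s) - g (A s) (Y' s) = k s + f' s * g (Y s) (Y s)"
      using g_sym[of "Y' s" "Y s"] by (simp add: A_def A'_def k_def g_simps algebra_simps)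
    also have "\<dots> = c" using ne by (simp add: f'_def field_simps)
    finally show "g (A' s) (Y s) - g (A s) (Y' s) = c" .
  qed simp
  moreover have "A 0 \<in> P" using fa subspace_0[OF P(1)] by (simp add: A_def l_def)
  moreover have "Z a = A a" using fa Z ab by (simp add: A_def l_def)
  moreover obtain d where "con Z' Z 0 1 d" using con_jacobi[OF Z(1)] by blast
  then have "con Z' Z a b d" by (rule con_subinterval) (use ab in auto)
  ultimately have "glue a b A Z \<in> Kp a b"
    using ab by (intro glue_Kp(4)[OF A _ _ wd_jac[OF Z(1)] _ Z(3)]) auto
  moreover have "glue a b A Z a = x" using \<open>Z a = A a\<close> Z by (simp add: glue_def)
  ultimately show ?thesis by blast
qed

text \<open>The fields of the family that vanish at a, cut off at a, span an isotropic space whose orthogonal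
  complement consists of the V with V a in the range of the family at a.\<close>

lemma Kp_index_kernel:
  assumes \<tau>: "a \<in> {0<..1}"
    and \<nu>: "sig_basis (gorth g (Jt a)) \<nu> \<pi> u"
  shows "\<exists>\<delta>>0. \<forall>b m. a < b \<longrightarrow> b \<le> 1 \<longrightarrow> b - a < \<delta> \<longrightarrow>
    has_index II {V \<in> Kp a b. V a \<in> Jt a} m \<longrightarrow> has_index II (Kp a b) (m + (\<nu> + \<pi>))"
proof -
  obtain \<delta> where \<delta>: "\<delta> > 0" and solve0: "\<forall>a b x y. 0 \<le> a \<longrightarrow> a < b \<longrightarrow> b \<le> 1 \<longrightarrow> b - a < \<delta> \<longrightarrow>
     (\<exists>Z Z'. jac R Z Z' \<and> Z a = x \<and> Z b = y)"
    using boundary_value_solvable by (elim exE conjE) (rule that)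
  have a01: "a \<in> {0..1}" using \<tau> by auto
  have uG: "\<And>i. i < \<nu> + \<pi> \<Longrightarrow> u i \<in> gorth g (Jt a)"
    and uu: "\<And>i j. i < \<nu> + \<pi> \<Longrightarrow> j < \<nu> + \<pi> \<Longrightarrow> g (u i) (u j) = (if i = j then (if i < \<nu> then - 1 else 1) else 0)"
    and ux: "\<And>x. x \<in> gorth g (Jt a) \<Longrightarrow> x = (\<Sum>i<\<nu>+\<pi>. ((if i < \<nu> then - 1 else 1) * g x (u i)) *\<^sub>R u i)"
    using \<nu> unfolding sig_basis_def by auto
  have "has_index II (Kp a b) (m + (\<nu> + \<pi>))"
    if b: "a < b" "b \<le> 1" "b - a < \<delta>" and m: "has_index II {V \<in> Kp a b. V a \<in> Jt a} m" for b m
  proof -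
    have ab: "0 < a" "0 \<le> a" using \<tau> by auto
    have "\<exists>N N'. i < \<nu> + \<pi> \<longrightarrow> JP N N' \<and> N a = 0 \<and> N' a = u i" for i
      using kernel_field[OF a01] uG by blast
    then obtain N N' where N: "\<And>i. i < \<nu> + \<pi> \<Longrightarrow> JP (N i) (N' i) \<and> N i a = 0 \<and> N' i a = u i" by metis
    \<comment> \<open>\<open>N i\<close> vanishes at a, so its Jacobi continuation is zero and its
      kink at a is \<open>u i\<close>.\<close>
    define e where "e i = glue a b (N i) (\<lambda>_. 0)" for i
    have eJT: "e i \<in> JT (\<lambda>_. True) a b" if "i < \<nu> + \<pi>" for i
      using N[OF that] by (intro JTI[of "N i" "N' i" "\<lambda>_. 0" "\<lambda>_. 0"]) (auto simp: e_def jac_zero_field)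
    have eK: "e i \<in> Kp a b" if "i < \<nu> + \<pi>" for i using eJT[OF that] JT_Kp[OF ab(2) b(1,2)] by blast
    have IIe: "II V (e i) = g (V a) (u i)" if V: "V \<in> Kp a b" and i: "i < \<nu> + \<pi>" for V i
    proof -
      have "V \<in> H1P P" "V b = 0" using V b by (auto simp: Kp_def)
      then have "II V (glue a b (N i) (\<lambda>_. 0)) = g (V a) (N' i a - 0)"
        using N[OF i] ab b by (intro I_jacobi_glue[where Z' = "\<lambda>_. 0"]) (auto simp: jac_zero_field)
      then show ?thesis using N[OF i] by (simp add: e_def)
    qed
    have ea: "e i a = 0" if "i < \<nu> + \<pi>" for i using N[OF that] by (simp add: e_def glue_def)
    \<comment> \<open>Dual partners of the isotropic fields: the pairing of V with
      \<open>e i\<close> is g(V a, u i), and the sign turns the diagonal entries into 1.\<close>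
    have "\<exists>V. i < \<nu> + \<pi> \<longrightarrow> V \<in> Kp a b \<and> V a = (if i < \<nu> then - 1 else 1) *\<^sub>R u i" for i
    proof -
      obtain Z Z' where "jac R Z Z'" "Z a = (if i < \<nu> then - 1 else 1) *\<^sub>R u i" "Z b = 0"
        using solve0[rule_format, OF ab(2) b] by blast
      then show ?thesis using Kp_evaluation_onto[OF ab(1) b(1,2)] by blast
    qed
    then obtain w where w: "\<And>i. i < \<nu> + \<pi> \<Longrightarrow> w i \<in> Kp a b \<and> w i a = (if i < \<nu> then - 1 else 1) *\<^sub>R u i" by metis
    have eq: "{V \<in> Kp a b. V a \<in> Jt a} = {V \<in> Kp a b. \<forall>i<\<nu> + \<pi>. II V (e i) = 0}"
    proof -
      have "V a \<in> Jt a \<longleftrightarrow> (\<forall>i<\<nu> + \<pi>. II V (e i) = 0)" if V: "V \<in> Kp a b" for V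
      proof
        assume "V a \<in> Jt a"
        then show "\<forall>i<\<nu> + \<pi>. II V (e i) = 0"
          using IIe[OF V] uG g_sym[of "V a"] by (auto simp: gorth_def)
      next
        assume *: "\<forall>i<\<nu> + \<pi>. II V (e i) = 0"
        have "V a \<in> gorth g (gorth g (Jt a))" unfolding gorth_def[of g "gorth g (Jt a)"]
        proof (intro CollectI ballI)
          fix y assume y: "y \<in> gorth g (Jt a)"
          have "g (V a) y = (\<Sum>i<\<nu>+\<pi>. ((if i < \<nu> then - 1 else 1) * g y (u i)) * g (V a) (u i))"
            by (subst ux[OF y], rule form_sum_right) auto
          also have "\<dots> = 0" using * IIe[OF V] by (intro sum.neutral) auto
          finally show "g (V a) y = 0" .
        qed
        then show "V a \<in> Jt a" using gorth_gorth[OF subspace_Jt J_nondeg[OF a01]] by simp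
      qed
      then show ?thesis by blast
    qed
    show ?thesis
    proof (rule H.has_index_isotropic[OF subspace_Kp Kp_subset])
      show "e i \<in> Kp a b" if "i < \<nu> + \<pi>" for i by (rule eK[OF that])
      show "II (e i) (e j) = 0" if "i < \<nu> + \<pi>" "j < \<nu> + \<pi>" for i j
        using IIe[OF eK[OF that(1)] that(2)] ea[OF that(1)] by (simp add: g_simps)
      show "w i \<in> Kp a b" if "i < \<nu> + \<pi>" for i using w[OF that] by blast
      show "II (w j) (e i) = (if i = j then 1 else 0)" if "i < \<nu> + \<pi>" "j < \<nu> + \<pi>" for i j
        using IIe[of "w j" i] w[OF that(2)] uu[OF that(2,1)] that by (auto simp: g_simps)
      show "has_index II {v \<in> Kp a b. \<forall>i<\<nu> + \<pi>. II v (e i) = 0} m" using m eq by simp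
    qed
  qed
  then show ?thesis using \<delta> by (intro exI[of _ \<delta>] conjI allI impI) (assumption | blast)+
qed

section \<open>Adding up the jumps along [0, 1]\<close>

definition nu :: "real \<Rightarrow> nat" where "nu t = the_enat (neg_index g (gorth g (Jt t)))"
definition pii :: "real \<Rightarrow> nat" where "pii t = the_enat (neg_index (\<lambda>x y. - g x y) (gorth g (Jt t)))"
definition foc :: "real \<Rightarrow> real set" where "foc t = {s. 0 < s \<and> s < t \<and> focal g R P S s}"

lemma sgn_inst_eq: "sgn_inst g R P S t = int (pii t) - int (nu t)"
  by (simp add: sgn_inst_def sgn_form_def nu_def pii_def)

lemma signature_data:
  assumes t: "t \<in> {0..1}"
  obtains u k where "sig_basis (gorth g (Jt t)) (nu t) (pii t) u" "has_index g (Jt t) k" "k + nu t = 1"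
proof -
  note C = subspace_Jt J_nondeg[OF t]
  obtain k where k: "has_index g (Jt t) k" using has_index_exists[OF C(1)] by blast
  obtain \<nu> \<pi> u where u: "sig_basis (gorth g (Jt t)) \<nu> \<pi> u"
    and i: "has_index g (gorth g (Jt t)) \<nu>" "has_index (\<lambda>x y. - g x y) (gorth g (Jt t)) \<pi>"
    using sig_basis_exists[OF subspace_gorth nondeg_on_gorth[OF C]] by blast
  have "neg_index g (gorth g (Jt t)) = enat \<nu>" by (rule neg_index_eq[OF i(1) subspace_gorth]) simp
  moreover have "neg_index (\<lambda>x y. - g x y) (gorth g (Jt t)) = enat \<pi>"
    by (rule neg.neg_index_eq[OF i(2) subspace_gorth]) simp
  ultimately have "nu t = \<nu>" "pii t = \<pi>" by (auto simp: nu_def pii_def)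
  moreover have "k + \<nu> = 1" by (rule index_complement[OF C k i(1) index_g])
  ultimately show thesis using that u k by blast
qed

lemma nonfocal_signature:
  assumes "Jt t = UNIV" shows "nu t = 0" "pii t = 0"
proof -
  have G: "gorth g (Jt t) = {0}" using assms gorth_UNIV by simp
  have "neg_index g {0} = enat 0"
    by (rule neg_index_eq[OF has_index_nonneg]) (auto simp: g_simps subspace_def)
  moreover have "neg_index (\<lambda>x y. - g x y) {0} = enat 0"
    by (rule neg.neg_index_eq[OF neg.has_index_nonneg]) (auto simp: g_simps subspace_def)
  ultimately show "nu t = 0" "pii t = 0" unfolding nu_def pii_def G by auto
qed

text \<open>The assertion with t in place of the right end point 1. Finiteness is carried along
  because a sum over an infinite set is zero by convention.\<close>

definition formula_at :: "real \<Rightarrow> bool" where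
  "formula_at t \<longleftrightarrow> finite (foc t) \<and> (\<exists>m. has_index II (Kp 0 t) m \<and>
     int m = int (the_enat (neg_index g P)) + (\<Sum>s\<in>foc t. sgn_inst g R P S s) - int (nu t))"

text \<open>With the node at 0, \<open>Jt 0\<close> = P, so the condition on V 0 is automatic.
  \<open>Kp 0 0\<close> has index zero, and what remains is the index of g on P; small positive
  times are not focal.\<close>

lemma formula_start: "\<exists>\<delta>>0. \<forall>b. 0 < b \<longrightarrow> b \<le> 1 \<longrightarrow> b < \<delta> \<longrightarrow> formula_at b"
proof -
  obtain k where k: "has_index g P k" using has_index_exists[OF P(1)] by blast
  have kP: "the_enat (neg_index g P) = k" using neg_index_eq[OF k P(1)] by simp
  have k0: "has_index g (Jt 0) k" using k Jt_0 by simp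
  have zero01: "(0::real) \<in> {0..1}" by simp
  obtain \<delta>1 where \<delta>1: "\<delta>1 > 0" and i0: "\<forall>a b m. 0 \<le> a \<longrightarrow> a < b \<longrightarrow> b \<le> 1 \<longrightarrow> b - a < \<delta>1 \<longrightarrow> 0 = a \<or> 0 = b \<longrightarrow>
    has_index II (Kp 0 a) m \<longrightarrow> has_index II {V \<in> Kp a b. V a \<in> Jt a} (m + k)"
    using Kp_Jt_index[OF zero01 k0] by (elim exE conjE) (rule that)
  obtain \<delta>2 where \<delta>2: "\<delta>2 > 0" and nf: "\<And>t. t \<in> {0..1} \<Longrightarrow> t \<noteq> 0 \<Longrightarrow> \<bar>t - 0\<bar> < \<delta>2 \<Longrightarrow> Jt t = UNIV"
    using nonfocal_nearby[of 0] by auto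
  have "formula_at b" if b: "0 < b" "b \<le> 1" "b < min \<delta>1 \<delta>2" for b
  proof -
    have "has_index II {V \<in> Kp 0 b. V 0 \<in> Jt 0} (0 + k)"
      using b Kp_00_index by (intro i0[rule_format]) auto
    moreover have "{V \<in> Kp 0 b. V 0 \<in> Jt 0} = Kp 0 b" unfolding Jt_0 by (auto simp: Kp_def H1P_iff)
    ultimately have "has_index II (Kp 0 b) k" by simp
    moreover have "foc b = {}" using nf b by (auto simp: foc_def focal_def)
    moreover have "nu b = 0" using nf[of b] b by (intro nonfocal_signature) auto
    ultimately show ?thesis unfolding formula_at_def kP by auto
  qed
  moreover have "min \<delta>1 \<delta>2 > 0" using \<delta>1 \<delta>2 by simp
  ultimately show ?thesis by blast
qed

text \<open>Just left of b every vector is a value of some J, so inserting the node adds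
  \<open>k\<close>, computed at b. Closing the jump costs 1 = k + nu b, which leaves m - nu b. The
  sum is unchanged: a and the instants between a and b are nonfocal, and b itself is counted only
  beyond b.\<close>

lemma formula_left:
  assumes b: "b \<in> {0<..1}"
  shows "\<exists>\<delta>>0. \<forall>a. 0 < a \<longrightarrow> a < b \<longrightarrow> b - a < \<delta> \<longrightarrow> formula_at a \<longrightarrow> formula_at b"
proof -
  have b01: "b \<in> {0..1}" using b by auto
  obtain u k where k: "has_index g (Jt b) k" "k + nu b = 1" using signature_data[OF b01] by metis
  obtain \<delta>1 where \<delta>1: "\<delta>1 > 0" and i0: "\<forall>a c m. 0 \<le> a \<longrightarrow> a < c \<longrightarrow> c \<le> 1 \<longrightarrow> c - a < \<delta>1 \<longrightarrow> b = a \<or> b = c \<longrightarrow>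
    has_index II (Kp 0 a) m \<longrightarrow> has_index II {V \<in> Kp a c. V a \<in> Jt a} (m + k)"
    using Kp_Jt_index[OF b01 k(1)] by (elim exE conjE) (rule that)
  obtain \<delta>2 where \<delta>2: "\<delta>2 > 0" and nf: "\<And>t. t \<in> {0..1} \<Longrightarrow> t \<noteq> b \<Longrightarrow> \<bar>t - b\<bar> < \<delta>2 \<Longrightarrow> Jt t = UNIV"
    using nonfocal_nearby[OF b01] by auto
  have "formula_at b" if a: "0 < a" "a < b" "b - a < min \<delta>1 \<delta>2" and F: "formula_at a" for a
  proof -
    obtain m where fin: "finite (foc a)" and m: "has_index II (Kp 0 a) m"
      "int m = int (the_enat (neg_index g P)) + (\<Sum>s\<in>foc a. sgn_inst g R P S s) - int (nu a)"
      using F unfolding formula_at_def by blast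
    have Ja: "Jt a = UNIV" using nf[of a] a b by auto
    have "has_index II {V \<in> Kp a b. V a \<in> Jt a} (m + k)"
      using a b m(1) by (intro i0[rule_format]) auto
    then have "has_index II (Kp a b) (m + k)" using Ja by simp
    then obtain m' where m': "has_index II (Kp 0 b) m'" "m + k = m' + 1"
      using Kp_index_drop[OF a(1,2)] b by auto
    have foc: "foc b = foc a"
    proof -
      have nf': "\<not> focal g R P S s" if "a \<le> s" "s < b" for s using nf[of s] that a b by (auto simp: focal_def)
      show ?thesis
      proof (intro equalityI subsetI)
        fix s assume s: "s \<in> foc b"
        then have "s < a" using nf'[of s] by (force simp: foc_def)
        then show "s \<in> foc a" using s by (auto simp: foc_def)
      next
        fix s assume "s \<in> foc a"
        then show "s \<in> foc b" using a by (auto simp: foc_def)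
      qed
    qed
    have "m = m' + nu b" using m'(2) k(2) by linarith
    then have "int m' = int m - int (nu b)" by simp
    then show ?thesis unfolding formula_at_def foc
      using fin m'(1) m(2) nonfocal_signature(1)[OF Ja] by auto
  qed
  moreover have "min \<delta>1 \<delta>2 > 0" using \<delta>1 \<delta>2 by simp
  ultimately show ?thesis by blast
qed

text \<open>The fields with V a in \<open>Jt a\<close> add \<open>k\<close>, dropping that
  restriction adds nu a + pii a, and closing the jump costs 1 = k + nu a; so the index grows by pii
  a. Together with the term - nu a in the formula at a this is sgn(a), and nu vanishes at the
  nonfocal b.\<close>

lemma formula_right:
  assumes a: "a \<in> {0<..1}"
  shows "\<exists>\<delta>>0. \<forall>b. a < b \<longrightarrow> b \<le> 1 \<longrightarrow> b - a < \<delta> \<longrightarrow> formula_at a \<longrightarrow> formula_at b"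
proof -
  have a01: "a \<in> {0..1}" using a by auto
  obtain u k where u: "sig_basis (gorth g (Jt a)) (nu a) (pii a) u" and k: "has_index g (Jt a) k" "k + nu a = 1"
    using signature_data[OF a01] by metis
  obtain \<delta>1 where \<delta>1: "\<delta>1 > 0" and i0: "\<forall>a' b m. 0 \<le> a' \<longrightarrow> a' < b \<longrightarrow> b \<le> 1 \<longrightarrow> b - a' < \<delta>1 \<longrightarrow> a = a' \<or> a = b \<longrightarrow>
    has_index II (Kp 0 a') m \<longrightarrow> has_index II {V \<in> Kp a' b. V a' \<in> Jt a'} (m + k)"
    using Kp_Jt_index[OF a01 k(1)] by (elim exE conjE) (rule that)
  obtain \<delta>2 where \<delta>2: "\<delta>2 > 0" and nf: "\<And>t. t \<in> {0..1} \<Longrightarrow> t \<noteq> a \<Longrightarrow> \<bar>t - a\<bar> < \<delta>2 \<Longrightarrow> Jt t = UNIV"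
    using nonfocal_nearby[OF a01] by auto
  obtain \<delta>3 where \<delta>3: "\<delta>3 > 0" and ker0: "\<forall>b m. a < b \<longrightarrow> b \<le> 1 \<longrightarrow> b - a < \<delta>3 \<longrightarrow>
    has_index II {V \<in> Kp a b. V a \<in> Jt a} m \<longrightarrow> has_index II (Kp a b) (m + (nu a + pii a))"
    using Kp_index_kernel[OF a u] by (elim exE conjE) (rule that)
  have "formula_at b" if b: "a < b" "b \<le> 1" "b - a < min \<delta>1 (min \<delta>2 \<delta>3)" and F: "formula_at a" for b
  proof -
    obtain m where fin: "finite (foc a)" and m: "has_index II (Kp 0 a) m"
      "int m = int (the_enat (neg_index g P)) + (\<Sum>s\<in>foc a. sgn_inst g R P S s) - int (nu a)"
      using F unfolding formula_at_def by blast
    have Jb: "Jt b = UNIV" using nf[of b] a b by auto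
    have "has_index II {V \<in> Kp a b. V a \<in> Jt a} (m + k)"
      using a b m(1) by (intro i0[rule_format]) auto
    then have "has_index II (Kp a b) (m + k + (nu a + pii a))"
      using b by (intro ker0[rule_format]) auto
    then obtain m' where m': "has_index II (Kp 0 b) m'" "m + k + (nu a + pii a) = m' + 1"
      using Kp_index_drop[OF _ b(1,2)] a by auto
    have "m' = m + pii a" using m'(2) k(2) by linarith
    then have int: "int m' = int m + int (pii a)" by simp
    have nf': "\<not> focal g R P S s" if "a < s" "s < b" for s using nf[of s] that a b by (auto simp: focal_def)
    have nb: "nu b = 0" by (rule nonfocal_signature[OF Jb])
    show ?thesis
    proof (cases "focal g R P S a")
      case True
      have foc: "foc b = insert a (foc a)"
      proof (intro equalityI subsetI)
        fix s assume s: "s \<in> foc b"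
        then have "s \<le> a" using nf'[of s] by (force simp: foc_def)
        then show "s \<in> insert a (foc a)" using s by (auto simp: foc_def)
      next
        fix s assume "s \<in> insert a (foc a)"
        then show "s \<in> foc b" using True a b by (auto simp: foc_def)
      qed
      have "a \<notin> foc a" by (simp add: foc_def)
      then show ?thesis unfolding formula_at_def foc using fin m'(1) int m(2) nb sgn_inst_eq by auto
    next
      case False
      have Ja: "Jt a = UNIV" using False a by (auto simp: focal_def)
      have foc: "foc b = foc a"
      proof (intro equalityI subsetI)
        fix s assume s: "s \<in> foc b"
        then have "s \<le> a" using nf'[of s] by (force simp: foc_def)
        moreover have "s \<noteq> a" using s False by (auto simp: foc_def)
        ultimately show "s \<in> foc a" using s by (auto simp: foc_def)
      next
        fix s assume "s \<in> foc a"
        then show "s \<in> foc b" using a b by (auto simp: foc_def)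
      qed
      show ?thesis unfolding formula_at_def foc using fin m'(1) int m(2) nb nonfocal_signature[OF Ja] by auto
    qed
  qed
  moreover have "min \<delta>1 (min \<delta>2 \<delta>3) > 0" using \<delta>1 \<delta>2 \<delta>3 by simp
  ultimately show ?thesis by blast
qed

text \<open>The implication from p to q is transitive and holds on short intervals around each point
  of [0, 1], hence from 0 to 1.\<close>

lemma formula_at_1: "formula_at 1"
proof -
  \<comment> \<open>The formula is available at positive times only; declaring t = 0 true supplies
    the start of the chain.\<close>
  define F where "F t \<longleftrightarrow> t = 0 \<or> formula_at t" for t
  define Q where "Q p q \<longleftrightarrow> (0 \<le> p \<longrightarrow> q \<le> 1 \<longrightarrow> F p \<longrightarrow> F q)" for p q
  have "Q 0 1"
  proof (rule Bolzano)
    show "(0::real) \<le> 1" by simp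
    show "Q p r" if "Q p q" "Q q r" "p \<le> q" "q \<le> r" for p q r using that by (auto simp: Q_def)
    fix x :: real assume x: "0 \<le> x" "x \<le> 1"
    show "\<exists>d>0. \<forall>p q. p \<le> x \<and> x \<le> q \<and> q - p < d \<longrightarrow> Q p q"
    proof (cases "x = 0")
      case True
      obtain \<delta> where \<delta>: "\<delta> > 0" "\<forall>b. 0 < b \<longrightarrow> b \<le> 1 \<longrightarrow> b < \<delta> \<longrightarrow> formula_at b"
        using formula_start by blast
      have "Q p q" if "p \<le> x" "x \<le> q" "q - p < \<delta>" for p q
        unfolding Q_def F_def
      proof (intro impI)
        assume "0 \<le> p" "q \<le> 1"
        then show "q = 0 \<or> formula_at q" using that True \<delta>(2)[rule_format, of q] by (cases "q = 0") auto
      qed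
      then show ?thesis using \<delta>(1) by blast
    next
      case False
      then have x01: "x \<in> {0<..1}" using x by auto
      obtain \<delta>1 where \<delta>1: "\<delta>1 > 0" "\<forall>a. 0 < a \<longrightarrow> a < x \<longrightarrow> x - a < \<delta>1 \<longrightarrow> formula_at a \<longrightarrow> formula_at x"
        using formula_left[OF x01] by blast
      obtain \<delta>2 where \<delta>2: "\<delta>2 > 0" "\<forall>b. x < b \<longrightarrow> b \<le> 1 \<longrightarrow> b - x < \<delta>2 \<longrightarrow> formula_at x \<longrightarrow> formula_at b"
        using formula_right[OF x01] by blast
      \<comment> \<open>The bound by x keeps p positive, so that the formula itself, and not the
        convention at 0, is available at p.\<close>
      define d where "d = min x (min \<delta>1 \<delta>2)"
      have "Q p q" if pq: "p \<le> x" "x \<le> q" "q - p < d" for p q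
        unfolding Q_def
      proof (intro impI)
        assume "0 \<le> p" and q1: "q \<le> 1" and Fp: "F p"
        have p: "0 < p" using pq by (simp add: d_def)
        then have fp: "formula_at p" using Fp by (simp add: F_def)
        have fx: "formula_at x"
        proof (cases "p = x")
          case False
          then show ?thesis using pq p fp by (intro \<delta>1(2)[rule_format, of p]) (auto simp: d_def)
        qed (use fp in simp)
        have "formula_at q"
        proof (cases "x = q")
          case False
          then show ?thesis using pq q1 fx by (intro \<delta>2(2)[rule_format, of q]) (auto simp: d_def)
        qed (use fx in simp)
        then show "F q" by (simp add: F_def)
      qed
      moreover have "d > 0" using \<delta>1 \<delta>2 x01 by (simp add: d_def)
      ultimately show ?thesis by blast
    qed
  qed
  then show ?thesis by (simp add: Q_def F_def)
qed

end

text \<open>The statement of the theorem sums fields pointwise; with the vector space structure on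
  functions this is the ordinary index.\<close>

lemma neg_index_fun_eq: "neg_index_fun B W = neg_index B W"
proof -
  have "(\<lambda>s. \<Sum>i<k. c i *\<^sub>R V i s) = (\<Sum>i<k. c i *\<^sub>R V i)"
    for k :: nat and c and V :: "nat \<Rightarrow> 'a \<Rightarrow> 'b"
    by (simp add: fun_eq_iff sum_apply_fun scaleR_fun_def)
  then show ?thesis unfolding neg_index_fun_def neg_index_def by simp
qed

theorem theorem4p11:
  fixes g :: "real^'n \<Rightarrow> real^'n \<Rightarrow> real"
    and R :: "real \<Rightarrow> ((real^'n) \<Rightarrow>\<^sub>L (real^'n))"
    and P :: "(real^'n) set"
    and S :: "real^'n \<Rightarrow> real^'n"
    and Y :: "real \<Rightarrow> real^'n"
  assumes "bilinear g" and "\<forall>x y. g x y = g y x"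
    and "nondeg_on g UNIV" and "neg_index g UNIV = 1"
    and "R C1_differentiable_on {0..1}"
    and "\<forall>t\<in>{0..1}. \<forall>x y. g (blinfun_apply (R t) x) y = g x (blinfun_apply (R t) y)"
    and "subspace P" and "nondeg_on g P"
    and "\<forall>x\<in>P. S x \<in> P"
    and "\<forall>x\<in>P. \<forall>y\<in>P. \<forall>a b. S (a *\<^sub>R x + b *\<^sub>R y) = a *\<^sub>R S x + b *\<^sub>R S y"
    and "\<forall>x\<in>P. \<forall>y\<in>P. g (S x) y = g x (S y)"
    and "jacobi_sol R Y" and "\<forall>t\<in>{0..1}. g (Y t) (Y t) < 0"
    and "\<forall>t\<in>{0..1}. nondeg_on g (JJt g R P S t)"
  shows "finite {t. 0 < t \<and> t < 1 \<and> focal g R P S t} \<and>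
    (\<exists>m. neg_index_fun (I1 g R S) (Kspace g Y P) = enat m \<and>
      int m = int (the_enat (neg_index g P))
              + (\<Sum>t\<in>{t. 0 < t \<and> t < 1 \<and> focal g R P S t}. sgn_inst g R P S t)
              - int (the_enat (neg_index g (gorth g (JJt g R P S 1)))))"
proof -
  interpret g: nondeg_sym_form g
    using assms(1-3) by unfold_locales auto
  obtain k where k: "has_index g UNIV k" using g.has_index_exists[of UNIV] by auto
  then have "neg_index g UNIV = enat k" by (rule g.neg_index_eq) auto
  then have k1: "k = 1" using assms(4) by (simp add: one_enat_def)
  obtain Y' where Y': "jac R Y Y'" using assms(12) jacobi_sol_iff by blast
  interpret morse_sturm g R P S Y Y'
  proof unfold_locales
    show "continuous_on {0..1} R" using assms(5) by (rule C1_differentiable_imp_continuous_on)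
    show "has_index g UNIV 1" using k k1 by simp
  qed (use assms Y' in auto)
  have foc: "foc 1 = {t. 0 < t \<and> t < 1 \<and> focal g R P S t}" by (simp add: foc_def)
  obtain m where m: "finite (foc 1)" "has_index (I1 g R S) (Kp 0 1) m"
    "int m = int (the_enat (neg_index g P)) + (\<Sum>s\<in>foc 1. sgn_inst g R P S s) - int (nu 1)"
    using formula_at_1 unfolding formula_at_def by blast
  have "neg_index_fun (I1 g R S) (Kspace g Y P) = enat m"
    unfolding neg_index_fun_eq Kspace_eq by (rule H.neg_index_eq[OF m(2) subspace_Kp Kp_subset])
  then show ?thesis using m unfolding foc nu_def by blast
qed

end
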